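(* Let $E$ be a Hermite–Biehler function such that every polynomial belongs to the de Branges space $\mathcal{H}(E)$. Let the spectral data $((t_n),(\nu_n))$ for $\mathcal{H}(E)$ be regular and let $(t_n)$ be lacunary. Assume also that $\Phi(u)=0$ for $\mu$-a.e. $u$ in some interval $(0,\delta)$, $\delta>0$. Then $\mathbb{H}_{\Phi,\mu}$ is compact in $\mathcal{H}(E)$ if and only if the integrals $\lambda_n=\int_0^\infty\Phi(u)u^{-n}\,d\mu(u)$ exist for all $n\in\mathbb{Z}_+$ and $\lim_{n\to\infty}\lambda_n=0$.
   Context: $\mu$ is a regular positive Borel measure on $(0,\infty)$ and $\Phi:(0,\infty)\to\mathbb{C}$ is $\mu$-measurable. The Hausdorff operator is $$(\mathbb{H}_{\Phi,\mu}F)(z)=\int_0^\infty \Phi(u)\,F\left(\tfrac{z}{u}\right)d\mu(u),\quad z\in\mathbb{C}.$$ $\mathbb{Z}_+=\{0,1,2,\dots\}$. An entire function $E$ is in the Hermite–Biehler class if $|E(z)|>|E^{\#}(z)|$ for $z$ in the open upper half-plane $\mathbb{C}^+$, where $F^{\#}(z):=\overline{F(\overline z)}$. The de Branges space is $\mathcal{H}(E)=\{F \text{ entire}: F/E,\ F^{\#}/E\in H^2(\mathbb{C}^+)\}$ ($H^2(\mathbb{C}^+)$ is the Hardy space of the upper half-plane), a Hilbert space with norm $\|F\|_E^2=\int_{-\infty}^\infty |F(t)/E(t)|^2dt$. "$\mathbb{H}_{\Phi,\mu}$ is compact in $\mathcal{H}(E)$" means that $\mathbb{H}_{\Phi,\mu}F$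 is defined and belongs to $\mathcal{H}(E)$ for every $F\in\mathcal{H}(E)$ and that $\mathbb{H}_{\Phi,\mu}$ is a compact linear operator on $\mathcal{H}(E)$. Spectral data: a pair $((t_n),(\nu_n))$, indexed by a set of consecutive integers, where $(t_n)$ is an increasing sequence of reals with no finite accumulation point, $\nu_n>0$, $\sum_n\nu_n/(1+t_n^2)<\infty$, is spectral data for $\mathcal{H}(E)$ if there is an entire function $A$, real on $\mathbb{R}$, with only simple zeros, located exactly at the points $t_n$, such that the functions $\nu_n^{1/2}A(z)/(z-t_n)$ form an orthonormal basis of $\mathcal{H}(E)$; equivalently $\mathcal{H}(E)$ consists of the functions $F(z)=A(z)\sum_n a_n\nu_n^{1/2}/(z-t_n)$, $(a_n)\in\ell^2$, with $\|F\|_E=\|(a_n)\|_{\ell^2}$. The sequence $(t_n)$ is lacunary if for some $\kappa>0$ one has $t_{n+1}-t_n\ge\kappa|t_n|$ for all $n$. The spectral data are regular if for some $c>0$ and any $n$, $$\sum_{|t_k|\le|t_n|}\nu_k+t_n^2\sum_{|t_k|>|t_n|}\frac{\nu_k}{t_k^2}\le c\,\nu_n.$$ *)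

theory Defs
  imports "HOL-Complex_Analysis.Complex_Analysis"
begin

definition entire :: "(complex \<Rightarrow> complex) \<Rightarrow> bool" where
  "entire F \<longleftrightarrow> F holomorphic_on UNIV"

definition sharp :: "(complex \<Rightarrow> complex) \<Rightarrow> complex \<Rightarrow> complex" where
  "sharp F z = cnj (F (cnj z))"

definition hermite_biehler :: "(complex \<Rightarrow> complex) \<Rightarrow> bool" where
  "hermite_biehler E \<longleftrightarrow> entire E \<and> (\<forall>z. Im z > 0 \<longrightarrow> cmod (E z) > cmod (sharp E z))"

definition hardy_space2 :: "(complex \<Rightarrow> complex) set" where
  "hardy_space2 = {f. f holomorphic_on {z. Im z > 0} \<and>
     (SUP y\<in>{0<..}. \<integral>\<^sup>+ x. ennreal ((cmod (f (Complex x y)))\<^sup>2) \<partial>lborel) < \<infinity>}"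

definition de_Branges_space :: "(complex \<Rightarrow> complex) \<Rightarrow> (complex \<Rightarrow> complex) set" where
  "de_Branges_space E = {F. entire F \<and> (\<lambda>z. F z / E z) \<in> hardy_space2
                              \<and> (\<lambda>z. sharp F z / E z) \<in> hardy_space2}"

definition de_Branges_inner ::
  "(complex \<Rightarrow> complex) \<Rightarrow> (complex \<Rightarrow> complex) \<Rightarrow> (complex \<Rightarrow> complex) \<Rightarrow> complex" where
  "de_Branges_inner E F G =
     (LINT x|lborel. F (of_real x) / E (of_real x) * cnj (G (of_real x) / E (of_real x)))"

definition de_Branges_norm :: "(complex \<Rightarrow> complex) \<Rightarrow> (complex \<Rightarrow> complex) \<Rightarrow> real" where
  "de_Branges_norm E F = sqrt (LINT x|lborel. (cmod (F (of_real x) / E (of_real x)))\<^sup>2)"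

definition orthonormal_basis ::
  "(complex \<Rightarrow> complex) \<Rightarrow> int set \<Rightarrow> (int \<Rightarrow> complex \<Rightarrow> complex) \<Rightarrow> bool" where
  "orthonormal_basis E I e \<longleftrightarrow>
     (\<forall>n\<in>I. e n \<in> de_Branges_space E) \<and>
     (\<forall>m\<in>I. \<forall>n\<in>I. de_Branges_inner E (e m) (e n) = (if m = n then 1 else 0)) \<and>
     (\<forall>F\<in>de_Branges_space E. \<forall>\<epsilon>>0. \<exists>J c. finite J \<and> J \<subseteq> I \<and>
        de_Branges_norm E (\<lambda>z. F z - (\<Sum>n\<in>J. c n * e n z)) < \<epsilon>)"

(* At z = t n the quotient A z / (z - t n) is read as its removable value deriv A (t n). *)
definition spectral_data ::
  "(complex \<Rightarrow> complex) \<Rightarrow> int set \<Rightarrow> (int \<Rightarrow> real) \<Rightarrow> (int \<Rightarrow> real) \<Rightarrow> bool" where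
  "spectral_data E I t \<nu> \<longleftrightarrow>
     (\<forall>a\<in>I. \<forall>b\<in>I. {a..b} \<subseteq> I) \<and>
     strict_mono_on I t \<and> (\<forall>x. \<not> x islimpt t ` I) \<and>
     (\<forall>n\<in>I. \<nu> n > 0) \<and> (\<lambda>n. \<nu> n / (1 + (t n)\<^sup>2)) summable_on I \<and>
     (\<exists>A. entire A \<and> (\<forall>x\<in>\<real>. A x \<in> \<real>) \<and>
          {z. A z = 0} = (\<lambda>n. of_real (t n)) ` I \<and>
          (\<forall>n\<in>I. zorder A (of_real (t n)) = 1) \<and>
          orthonormal_basis E I
            (\<lambda>n z. of_real (sqrt (\<nu> n)) *
               (if z = of_real (t n) then deriv A z else A z / (z - of_real (t n)))))"

definition lacunary :: "int set \<Rightarrow> (int \<Rightarrow> real) \<Rightarrow> bool" where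
  "lacunary I t \<longleftrightarrow>
     (\<exists>\<kappa>>0. \<forall>n. n \<in> I \<longrightarrow> n + 1 \<in> I \<longrightarrow> t (n + 1) - t n \<ge> \<kappa> * \<bar>t n\<bar>)"

(* For spectral data the first sum is finite and the second one converges. *)
definition regular_spectral_data :: "int set \<Rightarrow> (int \<Rightarrow> real) \<Rightarrow> (int \<Rightarrow> real) \<Rightarrow> bool" where
  "regular_spectral_data I t \<nu> \<longleftrightarrow>
     (\<exists>c>0. \<forall>n\<in>I.
        (\<Sum>\<^sub>\<infinity>k\<in>{k\<in>I. \<bar>t k\<bar> \<le> \<bar>t n\<bar>}. \<nu> k)
        + (t n)\<^sup>2 * (\<Sum>\<^sub>\<infinity>k\<in>{k\<in>I. \<bar>t k\<bar> > \<bar>t n\<bar>}. \<nu> k / (t k)\<^sup>2) \<le> c * \<nu> n)"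

(* Sets that are open or compact relative to the half-line are exactly the open or compact
   real sets contained in it.  Finiteness on compact sets is not demanded. *)
definition regular_borel_measure :: "real measure \<Rightarrow> bool" where
  "regular_borel_measure \<mu> \<longleftrightarrow>
     sets \<mu> = sets (restrict_space borel {0<..}) \<and>
     (\<forall>B\<in>sets \<mu>.
        emeasure \<mu> B = (INF U\<in>{U. open U \<and> B \<subseteq> U \<and> U \<subseteq> {0<..}}. emeasure \<mu> U) \<and>
        emeasure \<mu> B = (SUP K\<in>{K. compact K \<and> K \<subseteq> B}. emeasure \<mu> K))"

definition hausdorff_op ::
  "real measure \<Rightarrow> (real \<Rightarrow> complex) \<Rightarrow> (complex \<Rightarrow> complex) \<Rightarrow> complex \<Rightarrow> complex" where
  "hausdorff_op \<mu> \<Phi> F z = (LINT u|completion \<mu>. \<Phi> u * F (z / of_real u))"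

definition hausdorff_defined ::
  "real measure \<Rightarrow> (real \<Rightarrow> complex) \<Rightarrow> (complex \<Rightarrow> complex) \<Rightarrow> bool" where
  "hausdorff_defined \<mu> \<Phi> F \<longleftrightarrow>
     (\<forall>z. integrable (completion \<mu>) (\<lambda>u. \<Phi> u * F (z / of_real u)))"

definition compact_linear_operator ::
  "(complex \<Rightarrow> complex) \<Rightarrow> ((complex \<Rightarrow> complex) \<Rightarrow> complex \<Rightarrow> complex) \<Rightarrow> bool" where
  "compact_linear_operator E T \<longleftrightarrow>
     (\<forall>F\<in>de_Branges_space E. T F \<in> de_Branges_space E) \<and>
     (\<forall>F\<in>de_Branges_space E. \<forall>G\<in>de_Branges_space E. \<forall>a b.
        T (\<lambda>z. a * F z + b * G z) = (\<lambda>z. a * T F z + b * T G z)) \<and>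
     (\<forall>F :: nat \<Rightarrow> complex \<Rightarrow> complex.
        (\<forall>k. F k \<in> de_Branges_space E) \<and> (\<exists>C. \<forall>k. de_Branges_norm E (F k) \<le> C) \<longrightarrow>
        (\<exists>r :: nat \<Rightarrow> nat. \<exists>G\<in>de_Branges_space E. strict_mono r \<and>
           (\<lambda>k. de_Branges_norm E (\<lambda>z. T (F (r k)) z - G z)) \<longlonglongrightarrow> 0))"

definition hausdorff_compact ::
  "(complex \<Rightarrow> complex) \<Rightarrow> real measure \<Rightarrow> (real \<Rightarrow> complex) \<Rightarrow> bool" where
  "hausdorff_compact E \<mu> \<Phi> \<longleftrightarrow>
     (\<forall>F\<in>de_Branges_space E. hausdorff_defined \<mu> \<Phi> F) \<and>
     compact_linear_operator E (hausdorff_op \<mu> \<Phi>)"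

end

theory Submission
  imports Defs
begin

text \<open>
  On monomials the Hausdorff operator acts by \<open>z\<^sup>n \<mapsto> \<lambda>\<^sub>n z\<^sup>n\<close>, where \<open>\<lambda>\<^sub>n\<close> is the
  integral of \<open>\<Phi>(u) u\<^sup>-\<^sup>n d\<mu>(u)\<close>. The theorem therefore says that the operator behaves
  like a diagonal operator on \<open>\<ell>\<^sup>2\<close>, which is compact exactly when its diagonal tends to zero. What has to
  be proved is that the monomials form a Riesz basis of \<open>H(E)\<close> up to normalisation: with suitable
  weights \<open>\<omega> k\<close>, the norm of \<open>F\<close> is comparable to the \<open>\<ell>\<^sup>2\<close>-norm of its Taylor coefficients multiplied by
  \<open>\<omega> k\<close>, and every entire function for which the latter is finite belongs to the space
  (\<open>monomials_riesz_basis\<close>).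

  Order the spectral points by modulus as \<open>s 0, s 1, \<dots>\<close> and let \<open>p i\<close> be these moduli. Regularity
  forces the masses \<open>\<nu> i\<close> to grow and the quotients \<open>\<nu> i / (p i)\<^sup>2\<close> to decay geometrically, hence \<open>p i\<close>
  to grow geometrically; lacunarity keeps the points apart relative to their size. The basis functions
  are multiples of \<open>A(z) / (z - s n)\<close>, and everything depends on the size of the generating function \<open>A\<close>.
  Since the constant \<open>1\<close> lies in the space, \<open>1 / A\<close> is bounded on circles that stay away from the zeros.
  Dividing \<open>A\<close> by its first \<open>N\<close> zeros leaves a zero-free function on a large disc whose logarithm is
  bounded by a multiple of \<open>log\<^sup>2\<close> of the radius, and the Borel-Caratheodory inequality makes it nearly
  constant on fixed discs (\<open>cofactor_nearly_constant\<close>). So \<open>A\<close> may be treated as a constant multiple of the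
  product of its normalised linear factors. This gives a lower bound for \<open>A'(s n)\<close> and an upper bound for the Taylor coefficients
  of \<open>A(z) / (z - s n)\<close>, which say that the matrix passing from normalised monomials to the orthonormal
  basis and the matrix passing back both decay geometrically away from the diagonal
  (\<open>monomial_coefficient_decay\<close>, \<open>basis_taylor_decay\<close>). By Schur's test both matrices are bounded on
  \<open>\<ell>\<^sup>2\<close>.

  The Hilbert space facts about \<open>H(E)\<close> rest on one property of the Hardy space: the norm on the real line
  dominates the norms on all horizontal lines and the values in the half-plane (\<open>hardy_half_plane\<close>).
  It makes point evaluations continuous (\<open>evaluation_bound\<close>) and the space closed under bounded pointwise
  limits (\<open>H_closed_under_bounded_limits\<close>).

  If \<open>\<Phi>\<close> vanishes near zero and the moments exist, Taylor series may be integrated term by term, so the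
  operator multiplies the \<open>k\<close>-th coefficient by the \<open>k\<close>-th moment, and compactness follows from a diagonal
  subsequence. Conversely, if the moments stayed away from zero along a subsequence, the images of the
  corresponding normalised monomials would have no convergent subsequence.
\<close>

section \<open>Poisson integrals of bounded holomorphic functions\<close>

definition poisson_kernel :: "complex \<Rightarrow> real \<Rightarrow> real" where
  "poisson_kernel z s = Im z / (pi * ((s - Re z)\<^sup>2 + (Im z)\<^sup>2))"

abbreviation truncated_poisson :: "(complex \<Rightarrow> complex) \<Rightarrow> complex \<Rightarrow> real \<Rightarrow> complex" where
  "truncated_poisson g z R \<equiv> integral {-R..R} (\<lambda>s. of_real (poisson_kernel z s) * g (of_real s))"

text \<open>
  This is Cauchy's formula for the function \<open>g(w) / (w - cnj z)\<close> on the rectangle with base from \<open>-R\<close> to \<open>R\<close>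
  and height \<open>R\<close>. The pole of the extra factor lies below the real line. On the base the factor turns the
  Cauchy kernel into the Poisson kernel, and on the other three sides it makes the integrand of order
  \<open>1 / R\<^sup>2\<close>, while their total length is \<open>4R\<close>.
\<close>

lemma bounded_half_plane_poisson_limit:
  assumes cont: "continuous_on {z. Im z \<ge> 0} g" and hol: "g holomorphic_on {z. Im z > 0}"
    and bound: "\<And>z. Im z \<ge> 0 \<Longrightarrow> cmod (g z) \<le> B" and z: "Im z > 0"
  shows "(\<lambda>n. truncated_poisson g z (real n))
           \<longlonglongrightarrow> g z"
proof -
  define f where "f w = g w / (w - cnj z)" for w
  define h where "h w = f w / (w - z)" for w
  have B0: "B \<ge> 0" using bound[of z] z norm_ge_zero[of "g z"] by linarith
  have cnjz: "w \<noteq> cnj z" if "Im w \<ge> 0" for w using that z by auto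
  have contf: "continuous_on {z. Im z \<ge> 0} f"
    unfolding f_def using cnjz by (intro continuous_intros cont) auto
  have holf: "f holomorphic_on {z. Im z > 0}"
    unfolding f_def using cnjz by (intro holomorphic_intros hol) (auto simp: less_imp_le)
  have int_S: "interior {z. Im z \<ge> 0} = {z. Im z > 0}"
    using interior_halfspace_ge[of \<i> 0] by (simp add: inner_complex_def)
  have main: "cmod (g z - truncated_poisson g z R)
      \<le> 16 * B * Im z / (pi * R)" if R: "R > 2 * cmod z + 1" for R :: real
  proof -
    define a1 a2 a3 a4 where "a1 = Complex (-R) 0" and "a2 = Complex R 0"
      and "a3 = Complex R R" and "a4 = Complex (-R) R"
    have R0: "R > 0" using R norm_ge_zero[of z] by linarith
    have zR: "cmod z < R / 2" using R by linarith
    have zbox: "z \<in> box a1 a3"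
    proof -
      have "\<bar>Re z\<bar> < R" "\<bar>Im z\<bar> < R"
        using zR R0 abs_Re_le_cmod[of z] abs_Im_le_cmod[of z] by linarith+
      then show ?thesis using z by (simp add: in_box_complex_iff a1_def a3_def abs_less_iff)
    qed
    have pim: "path_image (rectpath a1 a3) \<subseteq> {z. Im z \<ge> 0} - {z}"
    proof -
      have "path_image (rectpath a1 a3) = cbox a1 a3 - box a1 a3"
        using R0 by (intro path_image_rectpath_cbox_minus_box) (auto simp: a1_def a3_def)
      moreover have "Im w \<ge> 0" if "w \<in> cbox a1 a3" for w
        using that unfolding in_cbox_complex_iff by (simp add: a1_def)
      ultimately show ?thesis using zbox by blast
    qed
    have "(h has_contour_integral (2*pi * \<i> * winding_number (rectpath a1 a3) z * f z)) (rectpath a1 a3)"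
      unfolding h_def
    proof (rule Cauchy_integral_formula_weak[where S = "{z. Im z \<ge> 0}" and k = "{}"])
      show "convex {z. Im z \<ge> 0}" using convex_halfspace_Im_ge[of 0] by simp
      fix x assume "x \<in> interior {z. Im z \<ge> 0} - {}"
      then have "Im x > 0" using int_S by auto
      then show "f field_differentiable at x"
        using holf open_halfspace_Im_gt[of 0] by (auto simp: holomorphic_on_open field_differentiable_def)
    qed (use contf pim z int_S in auto)
    then have ci: "(h has_contour_integral (2*pi * \<i> * f z)) (rectpath a1 a3)"
      using winding_number_rectpath[OF zbox] by simp
    have conth: "continuous_on ({z. Im z \<ge> 0} - {z}) h"
      unfolding h_def by (intro continuous_intros continuous_on_subset[OF contf]) auto
    have eq: "rectpath a1 a3 = linepath a1 a2 +++ linepath a2 a3 +++ linepath a3 a4 +++ linepath a4 a1"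
      by (simp add: rectpath_def Let_def a1_def a2_def a3_def a4_def)
    have sub: "closed_segment a1 a2 \<subseteq> path_image (rectpath a1 a3)"
         "closed_segment a2 a3 \<subseteq> path_image (rectpath a1 a3)"
         "closed_segment a3 a4 \<subseteq> path_image (rectpath a1 a3)"
         "closed_segment a4 a1 \<subseteq> path_image (rectpath a1 a3)"
      unfolding eq by (auto simp: path_image_join)
    have ints: "h contour_integrable_on linepath a1 a2" "h contour_integrable_on linepath a2 a3"
         "h contour_integrable_on linepath a3 a4" "h contour_integrable_on linepath a4 a1"
      using sub pim by (auto intro!: contour_integrable_continuous_linepath continuous_on_subset[OF conth])
    have "contour_integral (rectpath a1 a3) h = contour_integral (linepath a1 a2) h +
       (contour_integral (linepath a2 a3) h + (contour_integral (linepath a3 a4) h + contour_integral (linepath a4 a1) h))"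
      unfolding eq using ints by (simp add: contour_integrable_joinI valid_path_join)
    then have sum: "2*pi * \<i> * f z = contour_integral (linepath a1 a2) h +
       (contour_integral (linepath a2 a3) h + (contour_integral (linepath a3 a4) h + contour_integral (linepath a4 a1) h))"
      using contour_integral_unique[OF ci] by simp
    have far: "cmod (h w) \<le> 4 * B / R\<^sup>2" if w: "Im w \<ge> 0" "cmod w \<ge> R" for w
    proof -
      have 1: "cmod (w - z) \<ge> R / 2" using norm_triangle_ineq2[of w z] w zR by linarith
      have 2: "cmod (w - cnj z) \<ge> R / 2" using norm_triangle_ineq2[of w "cnj z"] w zR by simp
      have "cmod (h w) = cmod (g w) / (cmod (w - cnj z) * cmod (w - z))"
        by (simp add: h_def f_def norm_divide norm_mult)
      also have "\<dots> \<le> B / ((R/2) * (R/2))"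
        using 1 2 R0 bound[of w] w B0 by (intro frac_le mult_mono) auto
      also have "\<dots> = 4 * B / R\<^sup>2" by (simp add: power2_eq_square)
      finally show ?thesis .
    qed
    have seg: "Im w \<ge> 0 \<and> cmod w \<ge> R" if "w \<in> closed_segment a2 a3 \<or> w \<in> closed_segment a3 a4 \<or> w \<in> closed_segment a4 a1" for w
    proof -
      have "w \<in> path_image (rectpath a1 a3)" using that sub by blast
      then have "Im w \<ge> 0" using pim by auto
      moreover have "\<bar>Re w\<bar> = R \<or> \<bar>Im w\<bar> = R"
        using that R0
        by (auto simp: a1_def a2_def a3_def a4_def closed_segment_same_Re closed_segment_same_Im)
      ultimately show ?thesis using abs_Re_le_cmod[of w] abs_Im_le_cmod[of w] by auto
    qed
    have K0: "0 \<le> 4 * B / R\<^sup>2" using B0 by simp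
    have b1: "cmod (contour_integral (linepath a2 a3) h) \<le> 4 * B / R\<^sup>2 * R"
    proof -
      have "cmod (a3 - a2) = R" using R0 by (simp add: a1_def a2_def a3_def a4_def cmod_def real_sqrt_mult)
      moreover have "cmod (contour_integral (linepath a2 a3) h) \<le> 4 * B / R\<^sup>2 * cmod (a3 - a2)"
        by (rule contour_integral_bound_linepath[OF ints(2) K0]) (use seg far in blast)
      ultimately show ?thesis by metis
    qed
    have b2: "cmod (contour_integral (linepath a3 a4) h) \<le> 4 * B / R\<^sup>2 * (2*R)"
    proof -
      have "cmod (a4 - a3) = (2*R)" using R0 by (simp add: a1_def a2_def a3_def a4_def cmod_def real_sqrt_mult)
      moreover have "cmod (contour_integral (linepath a3 a4) h) \<le> 4 * B / R\<^sup>2 * cmod (a4 - a3)"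
        by (rule contour_integral_bound_linepath[OF ints(3) K0]) (use seg far in blast)
      ultimately show ?thesis by metis
    qed
    have b3: "cmod (contour_integral (linepath a4 a1) h) \<le> 4 * B / R\<^sup>2 * R"
    proof -
      have "cmod (a1 - a4) = R" using R0 by (simp add: a1_def a2_def a3_def a4_def cmod_def real_sqrt_mult)
      moreover have "cmod (contour_integral (linepath a4 a1) h) \<le> 4 * B / R\<^sup>2 * cmod (a1 - a4)"
        by (rule contour_integral_bound_linepath[OF ints(4) K0]) (use seg far in blast)
      ultimately show ?thesis by metis
    qed
    have "cmod (2*pi * \<i> * f z - contour_integral (linepath a1 a2) h) \<le> 4 * B / R\<^sup>2 * R + 4 * B / R\<^sup>2 * (2*R) + 4 * B / R\<^sup>2 * R"
    proof -
      have tri: "cmod (x1 + (x2 + (x3 + x4)) - x1) \<le> k2 + k3 + k4"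
        if "cmod x2 \<le> k2" "cmod x3 \<le> k3" "cmod x4 \<le> k4" for x1 x2 x3 x4 k2 k3 k4
        using that norm_triangle_ineq[of x2 "x3 + x4"] norm_triangle_ineq[of x3 x4] by simp
      show ?thesis unfolding sum by (rule tri[OF b1 b2 b3])
    qed
    also have "\<dots> = 16 * B / R" using R0 by (simp add: field_simps power2_eq_square)
    finally have est: "cmod (2*pi * \<i> * f z - contour_integral (linepath a1 a2) h) \<le> 16 * B / R" .
    have "contour_integral (linepath a1 a2) h = integral {-R..R} (\<lambda>s. h (of_real s))"
      by (subst contour_integral_linepath_Reals_eq) (use R0 in \<open>auto simp: a1_def a2_def complex_is_Real_iff\<close>)
    moreover have "of_real (Im z / pi) * h (of_real s) = of_real (poisson_kernel z s) * g (of_real s)" for s :: real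
    proof -
      have "(of_real s - cnj z) * (of_real s - z) = of_real ((s - Re z)\<^sup>2 + (Im z)\<^sup>2)"
        by (simp add: complex_eq_iff power2_eq_square algebra_simps)
      then have "h (of_real s) = g (of_real s) / of_real ((s - Re z)\<^sup>2 + (Im z)\<^sup>2)"
        by (simp add: h_def f_def)
      then show ?thesis by (simp add: poisson_kernel_def)
    qed
    ultimately have I: "of_real (Im z / pi) * contour_integral (linepath a1 a2) h
       = truncated_poisson g z R"
      by (simp flip: integral_mult_right)
    have "z - cnj z = 2 * \<i> * of_real (Im z)" by (simp add: complex_eq_iff)
    then have "of_real (Im z / pi) * (2*pi * \<i> * f z) = g z"
      using z by (simp add: f_def)
    then have "g z - truncated_poisson g z R
        = of_real (Im z / pi) * (2*pi * \<i> * f z - contour_integral (linepath a1 a2) h)"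
      using I by (simp add: right_diff_distrib)
    then have "cmod (g z - truncated_poisson g z R)
        = Im z / pi * cmod (2*pi * \<i> * f z - contour_integral (linepath a1 a2) h)"
      using z by (simp add: norm_mult norm_divide)
    also have "\<dots> \<le> Im z / pi * (16 * B / R)" using est z by (intro mult_left_mono) auto
    finally show ?thesis by (simp add: mult.commute mult.left_commute)
  qed
  have "(\<lambda>n. g z - truncated_poisson g z (real n)) \<longlonglongrightarrow> 0"
  proof (rule Lim_null_comparison)
    have "\<forall>\<^sub>F n in sequentially. real n > 2 * cmod z + 1"
      using eventually_gt_at_top filterlim_real_sequentially by (auto simp: filterlim_at_top_dense)
    then show "\<forall>\<^sub>F n in sequentially. cmod (g z - truncated_poisson g z (real n))
      \<le> 16 * B * Im z / (pi * real n)"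
      by eventually_elim (rule main)
    have "(\<lambda>n. (16 * B * Im z / pi) * (1 / real n)) \<longlonglongrightarrow> (16 * B * Im z / pi) * 0"
      by (intro tendsto_intros lim_1_over_n)
    then show "(\<lambda>n. 16 * B * Im z / (pi * real n)) \<longlonglongrightarrow> 0" by simp
  qed
  from tendsto_diff[OF tendsto_const[of "g z"] this] show ?thesis by simp
qed

lemma poisson_kernel_nonneg: "Im z > 0 \<Longrightarrow> poisson_kernel z s \<ge> 0"
  by (simp add: poisson_kernel_def)

lemma continuous_poisson_kernel: "Im z > 0 \<Longrightarrow> continuous_on S (poisson_kernel z)"
proof -
  assume z: "Im z > 0"
  have "(s - Re z)\<^sup>2 + (Im z)\<^sup>2 \<noteq> 0" for s :: real
    using z by (metis less_irrefl sum_power2_eq_zero_iff)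
  then show ?thesis unfolding poisson_kernel_def by (intro continuous_intros) auto
qed

lemma measurable_poisson_kernel [measurable]: "poisson_kernel z \<in> borel_measurable borel"
  unfolding poisson_kernel_def by measurable

text \<open>
  The truncated formula for the constant function \<open>1\<close> says that the integrals over \<open>[-n, n]\<close> tend to \<open>1\<close>;
  monotone convergence does the rest.
\<close>

lemma poisson_kernel_integral:
  assumes z: "Im z > 0"
  shows "integrable lborel (poisson_kernel z)" and "(LINT s|lborel. poisson_kernel z s) = 1"
proof -
  let ?f = "\<lambda>n::nat. \<lambda>s. indicator {-real n..real n} s *\<^sub>R poisson_kernel z s"
  have si: "set_integrable lborel {-real n..real n} (poisson_kernel z)" for n
    by (intro borel_integrable_atLeastAtMost' continuous_poisson_kernel z)
  have i: "integrable lborel (?f n)" for n using si[of n] by (simp add: set_integrable_def)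
  have eq: "integral\<^sup>L lborel (?f n) = integral {-real n..real n} (poisson_kernel z)" for n
    using set_borel_integral_eq_integral(2)[OF si[of n]] by (simp add: set_lebesgue_integral_def)
  have "(\<lambda>n. integral {-real n..real n} (\<lambda>s. complex_of_real (poisson_kernel z s) * 1)) \<longlonglongrightarrow> 1"
    using bounded_half_plane_poisson_limit[of "\<lambda>_. 1" 1 z] z by simp
  then have "(\<lambda>n. integral {-real n..real n} (\<lambda>s. complex_of_real (poisson_kernel z s))) \<longlonglongrightarrow> 1"
    by simp
  moreover have "integral {-real n..real n} (\<lambda>s. complex_of_real (poisson_kernel z s))
       = complex_of_real (integral {-real n..real n} (poisson_kernel z))" for n
    using si[of n] set_borel_integral_eq_integral(1)[OF si[of n]]
    by (metis has_integral_of_real integrable_integral integral_unique)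
  ultimately have "(\<lambda>n. complex_of_real (integral {-real n..real n} (poisson_kernel z))) \<longlonglongrightarrow> of_real 1"
    by simp
  then have lim: "(\<lambda>n. integral\<^sup>L lborel (?f n)) \<longlonglongrightarrow> 1"
    unfolding eq tendsto_of_real_iff .
  have mono: "mono (\<lambda>n. ?f n s)" for s
    using poisson_kernel_nonneg[OF z, of s] by (auto simp: mono_def indicator_def)
  have conv: "(\<lambda>n. ?f n s) \<longlonglongrightarrow> poisson_kernel z s" for s
  proof (rule tendsto_eventually)
    obtain N where N: "\<bar>s\<bar> \<le> real N" using real_arch_simple by blast
    show "\<forall>\<^sub>F n in sequentially. ?f n s = poisson_kernel z s"
      using eventually_ge_at_top[of N] by eventually_elim (use N in \<open>auto simp: abs_le_iff indicator_def\<close>)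
  qed
  show "integrable lborel (poisson_kernel z)" "(LINT s|lborel. poisson_kernel z s) = 1"
    by (rule integral_monotone_convergence_nonneg[OF i _ _ _ lim];
        use mono conv poisson_kernel_nonneg[OF z] in auto)+
qed

text \<open>
  If \<open>a\<close> is the weighted mean of \<open>\<phi>\<close>, the integral of \<open>K (\<phi> - a)\<^sup>2\<close> is nonnegative and equals the difference
  of the two sides.
\<close>

lemma weighted_mean_square_le:
  fixes K \<phi> :: "real \<Rightarrow> real"
  assumes K: "integrable lborel K" "\<And>s. K s \<ge> 0" and one: "(LINT s|lborel. K s) = 1"
    and \<phi>: "\<phi> \<in> borel_measurable lborel" "\<And>s. \<bar>\<phi> s\<bar> \<le> B"
  shows "integrable lborel (\<lambda>s. K s * \<phi> s)" "integrable lborel (\<lambda>s. K s * (\<phi> s)\<^sup>2)"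
    and "(LINT s|lborel. K s * \<phi> s)\<^sup>2 \<le> (LINT s|lborel. K s * (\<phi> s)\<^sup>2)"
proof -
  have [measurable]: "K \<in> borel_measurable lborel" "\<phi> \<in> borel_measurable lborel"
    using K(1) \<phi>(1) by auto
  have B0: "B \<ge> 0" using \<phi>(2)[of 0] by linarith
  show i1: "integrable lborel (\<lambda>s. K s * \<phi> s)"
  proof (rule Bochner_Integration.integrable_bound)
    show "integrable lborel (\<lambda>s. B * K s)" using K by simp
    show "AE s in lborel. norm (K s * \<phi> s) \<le> norm (B * K s)"
      using K(2) \<phi>(2) B0 by (auto simp: abs_mult mult.commute[of B] intro!: mult_left_mono AE_I2)
  qed simp
  show i2: "integrable lborel (\<lambda>s. K s * (\<phi> s)\<^sup>2)"
  proof (rule Bochner_Integration.integrable_bound)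
    show "integrable lborel (\<lambda>s. B\<^sup>2 * K s)" using K by simp
    have "(\<phi> s)\<^sup>2 \<le> B\<^sup>2" for s using power_mono[OF \<phi>(2)[of s] abs_ge_zero, of 2] by simp
    then show "AE s in lborel. norm (K s * (\<phi> s)\<^sup>2) \<le> norm (B\<^sup>2 * K s)"
      using K(2) by (auto simp: abs_mult mult.commute[of "B\<^sup>2"] intro!: mult_left_mono AE_I2)
  qed simp
  define a where "a = (LINT s|lborel. K s * \<phi> s)"
  have "0 \<le> (LINT s|lborel. K s * (\<phi> s - a)\<^sup>2)"
    using K(2) by (intro integral_nonneg_AE) auto
  also have "(\<lambda>s. K s * (\<phi> s - a)\<^sup>2) = (\<lambda>s. K s * (\<phi> s)\<^sup>2 - 2 * a * (K s * \<phi> s) + a\<^sup>2 * K s)"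
    by (auto simp: power2_diff algebra_simps)
  also have "(LINT s|lborel. K s * (\<phi> s)\<^sup>2 - 2 * a * (K s * \<phi> s) + a\<^sup>2 * K s)
      = (LINT s|lborel. K s * (\<phi> s)\<^sup>2) - 2 * a * a + a\<^sup>2 * 1"
    using i1 i2 K by (simp add: a_def one)
  finally show "(LINT s|lborel. K s * \<phi> s)\<^sup>2 \<le> (LINT s|lborel. K s * (\<phi> s)\<^sup>2)"
    by (simp add: a_def power2_eq_square)
qed

lemma borel_measurable_on_real_line:
  assumes "continuous_on {z. Im z \<ge> 0} g" "y \<ge> 0"
  shows "(\<lambda>s. g (Complex s y)) \<in> borel_measurable borel"
proof (rule borel_measurable_continuous_onI)
  have "continuous_on UNIV (\<lambda>s. Complex s y)" by (intro continuous_intros)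
  then show "continuous_on UNIV (\<lambda>s. g (Complex s y))"
    by (rule continuous_on_compose2[OF assms(1)]) (use assms in auto)
qed

abbreviation line_energy :: "(complex \<Rightarrow> complex) \<Rightarrow> real \<Rightarrow> ennreal" where
  "line_energy f y \<equiv> \<integral>\<^sup>+ x. ennreal ((cmod (f (Complex x y)))\<^sup>2) \<partial>lborel"

lemma bounded_half_plane_square_le:
  assumes cont: "continuous_on {z. Im z \<ge> 0} g" and hol: "g holomorphic_on {z. Im z > 0}"
    and bound: "\<And>z. Im z \<ge> 0 \<Longrightarrow> cmod (g z) \<le> B" and z: "Im z > 0"
  shows "ennreal ((cmod (g z))\<^sup>2) \<le>
     (\<integral>\<^sup>+ s. ennreal (poisson_kernel z s) * ennreal ((cmod (g (Complex s 0)))\<^sup>2) \<partial>lborel)"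
proof -
  have g[measurable]: "(\<lambda>s. g (Complex s 0)) \<in> borel_measurable borel"
    by (rule borel_measurable_on_real_line[OF cont]) simp
  have B: "cmod (g (Complex s 0)) \<le> B" for s by (rule bound) simp
  note J = weighted_mean_square_le[OF poisson_kernel_integral(1)[OF z] poisson_kernel_nonneg[OF z]
      poisson_kernel_integral(2)[OF z], of "\<lambda>s. cmod (g (Complex s 0))" B]
  have B': "\<bar>cmod (g (Complex s 0))\<bar> \<le> B" for s using B[of s] by simp
  have i1: "integrable lborel (\<lambda>s. poisson_kernel z s * cmod (g (Complex s 0)))"
    and i2: "integrable lborel (\<lambda>s. poisson_kernel z s * (cmod (g (Complex s 0)))\<^sup>2)"
    and i3: "(LINT s|lborel. poisson_kernel z s * cmod (g (Complex s 0)))\<^sup>2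
       \<le> (LINT s|lborel. poisson_kernel z s * (cmod (g (Complex s 0)))\<^sup>2)"
    using J B' by auto
  have "cmod (g z) \<le> (LINT s|lborel. poisson_kernel z s * cmod (g (Complex s 0)))"
  proof (rule LIMSEQ_le_const2)
    show "(\<lambda>n. cmod (truncated_poisson g z (real n)))
           \<longlonglongrightarrow> cmod (g z)"
      by (intro tendsto_norm bounded_half_plane_poisson_limit[OF cont hol bound z])
    have "cmod (truncated_poisson g z (real n))
        \<le> (LINT s|lborel. poisson_kernel z s * cmod (g (Complex s 0)))" for n
    proof -
      let ?h = "\<lambda>s. of_real (poisson_kernel z s) * g (Complex s 0)"
      have co: "continuous_on {-real n..real n} (\<lambda>s. g (Complex s 0))"
        by (rule continuous_on_compose2[OF cont]) (auto intro!: continuous_intros)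
      have "continuous_on {-real n..real n} ?h"
        by (intro continuous_intros continuous_poisson_kernel z co)
      then have si: "set_integrable lborel {-real n..real n} ?h"
        by (rule borel_integrable_atLeastAtMost')
      then have "integral {-real n..real n} ?h = (LINT s|lborel. indicator {-real n..real n} s *\<^sub>R ?h s)"
        using set_borel_integral_eq_integral(2)[OF si] by (simp add: set_lebesgue_integral_def)
      also have "cmod \<dots> \<le> (LINT s|lborel. poisson_kernel z s * cmod (g (Complex s 0)))"
        by (rule Bochner_Integration.integral_norm_bound_integral)
          (use i1 si poisson_kernel_nonneg[OF z] in \<open>auto simp: set_integrable_def norm_mult indicator_def\<close>)
      finally show ?thesis by (simp add: complex_of_real_def)
    qed
    then show "\<exists>N. \<forall>n\<ge>N. cmod (truncated_poisson g z (real n))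
        \<le> (LINT s|lborel. poisson_kernel z s * cmod (g (Complex s 0)))" by blast
  qed
  then have "(cmod (g z))\<^sup>2 \<le> (LINT s|lborel. poisson_kernel z s * (cmod (g (Complex s 0)))\<^sup>2)"
    using i3 by (meson norm_ge_zero order_trans power_mono)
  then have "ennreal ((cmod (g z))\<^sup>2) \<le> ennreal (LINT s|lborel. poisson_kernel z s * (cmod (g (Complex s 0)))\<^sup>2)"
    by (rule ennreal_leI)
  also have "\<dots> = (\<integral>\<^sup>+ s. ennreal (poisson_kernel z s * (cmod (g (Complex s 0)))\<^sup>2) \<partial>lborel)"
    using i2 poisson_kernel_nonneg[OF z] by (intro nn_integral_eq_integral[symmetric]) auto
  finally show ?thesis using poisson_kernel_nonneg[OF z] by (simp add: ennreal_mult)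
qed

lemma nn_integral_poisson_kernel:
  assumes "y > 0"
  shows "(\<integral>\<^sup>+ x. ennreal (poisson_kernel (Complex x y) s) \<partial>lborel) = 1"
proof -
  have "(\<integral>\<^sup>+ x. ennreal (poisson_kernel (Complex x y) s) \<partial>lborel)
     = (\<integral>\<^sup>+ x. ennreal (poisson_kernel (Complex s y) x) \<partial>lborel)"
    by (simp add: poisson_kernel_def power2_commute)
  also have "\<dots> = ennreal (LINT x|lborel. poisson_kernel (Complex s y) x)"
    using poisson_kernel_integral(1)[of "Complex s y"] poisson_kernel_nonneg[of "Complex s y"] assms
    by (intro nn_integral_eq_integral) auto
  finally show ?thesis using poisson_kernel_integral(2)[of "Complex s y"] assms by simp
qed

text \<open>
  Both estimates follow from the Poisson bound for the square of the modulus: the first by integrating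
  over \<open>x\<close>, because the kernel is symmetric in \<open>x\<close> and \<open>s\<close> and has total mass \<open>1\<close>, the second because the
  kernel is at most \<open>1 / (pi y)\<close>.
\<close>

lemma bounded_half_plane_L2:
  assumes cont: "continuous_on {z. Im z \<ge> 0} g" and hol: "g holomorphic_on {z. Im z > 0}"
    and bound: "\<And>z. Im z \<ge> 0 \<Longrightarrow> cmod (g z) \<le> B" and y: "y > 0"
  shows "line_energy g y
           \<le> line_energy g 0"
    and "ennreal ((cmod (g (Complex x y)))\<^sup>2) \<le> ennreal (1 / (pi * y)) *
           line_energy g 0"
proof -
  let ?R = "line_energy g 0"
  have [measurable]: "(\<lambda>s. g (Complex s 0)) \<in> borel_measurable borel"
    by (rule borel_measurable_on_real_line[OF cont]) simp
  have sq: "ennreal ((cmod (g (Complex x y)))\<^sup>2) \<le>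
     (\<integral>\<^sup>+ s. ennreal (poisson_kernel (Complex x y) s) * ennreal ((cmod (g (Complex s 0)))\<^sup>2) \<partial>lborel)" for x
    using bounded_half_plane_square_le[OF cont hol bound, of "Complex x y"] y by simp
  have "line_energy g y
     \<le> (\<integral>\<^sup>+ x. (\<integral>\<^sup>+ s. ennreal (poisson_kernel (Complex x y) s) * ennreal ((cmod (g (Complex s 0)))\<^sup>2) \<partial>lborel) \<partial>lborel)"
    by (intro nn_integral_mono sq)
  also have "\<dots> = (\<integral>\<^sup>+ s. (\<integral>\<^sup>+ x. ennreal (poisson_kernel (Complex x y) s) * ennreal ((cmod (g (Complex s 0)))\<^sup>2) \<partial>lborel) \<partial>lborel)"
    unfolding poisson_kernel_def by (rule lborel_pair.Fubini') simp
  also have "\<dots> = ?R"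
    using nn_integral_poisson_kernel[OF y] by (simp add: nn_integral_multc poisson_kernel_def)
  finally show "line_energy g y \<le> ?R" .
  have K: "poisson_kernel (Complex x y) s \<le> 1 / (pi * y)" for s
  proof -
    have "y * y \<le> (s - x)\<^sup>2 + y\<^sup>2" by (simp add: power2_eq_square)
    then have "y / (pi * ((s - x)\<^sup>2 + y\<^sup>2)) \<le> y / (pi * (y * y))"
      using y by (intro divide_left_mono mult_left_mono mult_pos_pos) (auto intro: add_nonneg_pos)
    then show ?thesis using y by (simp add: poisson_kernel_def field_simps)
  qed
  have "ennreal ((cmod (g (Complex x y)))\<^sup>2) \<le>
     (\<integral>\<^sup>+ s. ennreal (1 / (pi * y)) * ennreal ((cmod (g (Complex s 0)))\<^sup>2) \<partial>lborel)"
    using K by (intro order_trans[OF sq] nn_integral_mono mult_right_mono ennreal_leI) auto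
  also have "\<dots> = ennreal (1 / (pi * y)) * ?R" by (rule nn_integral_cmult) simp
  finally show "ennreal ((cmod (g (Complex x y)))\<^sup>2) \<le> ennreal (1 / (pi * y)) * ?R" .
qed

section \<open>Hardy space functions with continuous boundary values\<close>

text \<open>
  A function in the Hardy space may be unbounded near the real line, so the Poisson formula for bounded
  functions is applied to its averages over horizontal segments of length \<open>h\<close>. These are bounded by the
  Cauchy-Schwarz inequality, and they converge to the function as \<open>h\<close> tends to zero.
\<close>

definition horizontal_mean :: "real \<Rightarrow> (complex \<Rightarrow> complex) \<Rightarrow> complex \<Rightarrow> complex" where
  "horizontal_mean h f z = integral {0..1} (\<lambda>s. f (z + of_real (h * s)))"

lemma continuous_horizontal_mean:
  assumes cont: "continuous_on {z. Im z \<ge> 0} f"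
  shows "continuous_on {z. Im z \<ge> 0} (horizontal_mean h f)"
proof -
  have "continuous_on ({z. Im z \<ge> 0} \<times> cbox 0 1) (\<lambda>(z, s). f (z + of_real (h * s)))"
    unfolding case_prod_unfold
    by (rule continuous_on_compose2[OF cont]) (auto intro!: continuous_intros)
  from integral_continuous_on_param[OF this] show ?thesis
    by (simp add: horizontal_mean_def[abs_def] cbox_interval)
qed

lemma horizontal_mean_tendsto:
  assumes cont: "continuous_on {z. Im z \<ge> 0} f" and z: "Im z \<ge> 0"
  shows "(\<lambda>n. horizontal_mean (1 / real (Suc n)) f z) \<longlonglongrightarrow> f z"
proof -
  have "continuous_on ({0..1} \<times> cbox 0 1) (\<lambda>(h, s). f (z + of_real (h * s)))"
    unfolding case_prod_unfold
    by (rule continuous_on_compose2[OF cont]) (use z in \<open>auto intro!: continuous_intros\<close>)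
  from integral_continuous_on_param[OF this]
  have c: "continuous_on {0..1} (\<lambda>h. horizontal_mean h f z)"
    by (simp add: horizontal_mean_def[abs_def] cbox_interval)
  have "(\<lambda>n. horizontal_mean (1 / real (Suc n)) f z) \<longlonglongrightarrow> horizontal_mean 0 f z"
    by (rule continuous_on_tendsto_compose[OF c LIMSEQ_Suc[OF lim_1_over_n]]) auto
  moreover have "horizontal_mean 0 f z = f z" by (simp add: horizontal_mean_def)
  ultimately show ?thesis by simp
qed

text \<open>
  On the half-plane the function has a primitive, and the mean is a difference quotient of it.
\<close>

lemma holomorphic_horizontal_mean:
  assumes hol: "f holomorphic_on {z. Im z > 0}" and h: "h > 0"
  shows "horizontal_mean h f holomorphic_on {z. Im z > 0}"
proof -
  let ?H = "{z. Im z > 0}"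
  have op: "open ?H" using open_halfspace_Im_gt[of 0] by simp
  have "convex ?H" using convex_halfspace_Im_gt[of 0] by simp
  from holomorphic_convex_primitive'[OF this op hol] obtain G where
    G: "\<And>z. z \<in> ?H \<Longrightarrow> (G has_field_derivative f z) (at z within ?H)" by blast
  have G': "(G has_field_derivative f z) (at z)" if "z \<in> ?H" for z
    using G[OF that] at_within_open[OF that op] by simp
  have holG: "G holomorphic_on ?H" using G unfolding holomorphic_on_def field_differentiable_def by blast
  have eq: "horizontal_mean h f z = (G (z + of_real h) - G z) / of_real h" if z: "z \<in> ?H" for z
  proof -
    have "((\<lambda>s. of_real h * f (z + of_real (h * s))) has_integral (G (z + of_real (h * 1)) - G (z + of_real (h * 0)))) {0..1}"
    proof (rule fundamental_theorem_of_calculus)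
      fix s :: real
      have "z + of_real (h * s) \<in> ?H" using z by simp
      note G'[OF this]
      moreover have "((\<lambda>s. z + of_real (h * s)) has_vector_derivative of_real h) (at s within {0..1})"
        by (auto intro!: derivative_eq_intros simp: has_vector_derivative_def scaleR_conv_of_real algebra_simps)
      ultimately show "((\<lambda>s. G (z + of_real (h * s))) has_vector_derivative of_real h * f (z + of_real (h * s))) (at s within {0..1})"
        using field_vector_diff_chain_within[of "\<lambda>s. z + of_real (h * s)" "of_real h" s "{0..1}" G "f (z + of_real (h * s))"]
        by (simp add: o_def has_field_derivative_at_within)
    qed simp
    from integral_unique[OF this]
    have "integral {0..1} (\<lambda>s. of_real h * f (z + of_real (h * s))) = G (z + of_real h) - G z"
      by (simp del: of_real_mult integral_mult_right)
    then show ?thesis using h by (simp add: horizontal_mean_def field_simps)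
  qed
  have "(G \<circ> (\<lambda>z. z + of_real h)) holomorphic_on ?H"
    by (rule holomorphic_on_compose_gen[OF _ holG]) (auto intro!: holomorphic_intros)
  then have "(\<lambda>z. (G (z + of_real h) - G z) / of_real h) holomorphic_on ?H"
    using h by (intro holomorphic_intros holG) (auto simp: o_def)
  then show ?thesis by (rule holomorphic_transform) (use eq in auto)
qed

lemma horizontal_mean_square_le:
  assumes cont: "continuous_on {z. Im z \<ge> 0} f" and z: "Im z \<ge> 0"
  shows "ennreal ((cmod (horizontal_mean h f z))\<^sup>2) \<le>
     (\<integral>\<^sup>+ s. indicator {0..1} s * ennreal ((cmod (f (z + of_real (h * s))))\<^sup>2) \<partial>lborel)"
proof -
  let ?\<phi> = "\<lambda>s. indicator {0..1} s * cmod (f (z + of_real (h * s)))"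
  have c: "continuous_on {0..1} (\<lambda>s. f (z + of_real (h * s)))"
    by (rule continuous_on_compose2[OF cont]) (use z in \<open>auto intro!: continuous_intros\<close>)
  then have "bounded ((\<lambda>s. f (z + of_real (h * s))) ` {0..1})"
    using compact_continuous_image compact_imp_bounded by blast
  then obtain B where B: "\<And>s. s \<in> {0..1} \<Longrightarrow> cmod (f (z + of_real (h * s))) \<le> B" and "B > 0"
    unfolding bounded_pos by (metis imageI)
  have [measurable]: "(\<lambda>s. f (z + of_real (h * s))) \<in> borel_measurable borel"
    by (rule borel_measurable_continuous_onI, rule continuous_on_compose2[OF cont])
       (use z in \<open>auto intro!: continuous_intros\<close>)
  have si: "set_integrable lborel {0..1} (\<lambda>s. f (z + of_real (h * s)))"
    by (rule borel_integrable_atLeastAtMost'[OF c])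
  have i0: "integrable lborel (indicator {0..1::real} :: real \<Rightarrow> real)"
    by (rule integrable_real_indicator) auto
  have n0: "indicator {0..1} s \<ge> (0::real)" for s :: real by simp
  have one: "(LINT s|lborel. indicator {0..1::real} s) = (1::real)" by simp
  have m0: "?\<phi> \<in> borel_measurable lborel" by measurable
  have b0: "\<bar>?\<phi> s\<bar> \<le> B" for s using B[of s] \<open>B > 0\<close> by (cases "s \<in> {0..1}") auto
  have i1: "integrable lborel (\<lambda>s. indicator {0..1} s * ?\<phi> s)"
    and i2: "integrable lborel (\<lambda>s. indicator {0..1} s * (?\<phi> s)\<^sup>2)"
    and i3: "(LINT s|lborel. indicator {0..1} s * ?\<phi> s)\<^sup>2 \<le> (LINT s|lborel. indicator {0..1} s * (?\<phi> s)\<^sup>2)"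
    by (rule weighted_mean_square_le[OF i0 n0 one m0 b0])+
  have "horizontal_mean h f z = (LINT s|lborel. indicator {0..1} s *\<^sub>R f (z + of_real (h * s)))"
    using set_borel_integral_eq_integral(2)[OF si] by (simp add: horizontal_mean_def set_lebesgue_integral_def)
  also have "cmod \<dots> \<le> (LINT s|lborel. indicator {0..1} s * ?\<phi> s)"
    by (rule Bochner_Integration.integral_norm_bound_integral)
       (use i1 si in \<open>auto simp: set_integrable_def indicator_def\<close>)
  finally have "(cmod (horizontal_mean h f z))\<^sup>2 \<le> (LINT s|lborel. indicator {0..1} s * (?\<phi> s)\<^sup>2)"
    using i3 by (meson norm_ge_zero order_trans power_mono)
  then have "ennreal ((cmod (horizontal_mean h f z))\<^sup>2) \<le> ennreal (LINT s|lborel. indicator {0..1} s * (?\<phi> s)\<^sup>2)"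
    by (rule ennreal_leI)
  also have "\<dots> = (\<integral>\<^sup>+ s. ennreal (indicator {0..1} s * (?\<phi> s)\<^sup>2) \<partial>lborel)"
    using i2 by (intro nn_integral_eq_integral[symmetric]) auto
  also have "\<dots> = (\<integral>\<^sup>+ s. indicator {0..1} s * ennreal ((cmod (f (z + of_real (h * s))))\<^sup>2) \<partial>lborel)"
    by (intro nn_integral_cong) (auto simp: indicator_def)
  finally show ?thesis .
qed

text \<open>
  By Fatou's lemma the line norms pass to the real line. The means of length \<open>h\<close> are bounded by
  \<open>sqrt (N / h)\<close> on the closed half-plane, where \<open>N\<close> bounds the line energies of \<open>f\<close>, and their energy on the
  real line is at most that of \<open>f\<close>. So the estimates for bounded functions hold for the means with the energy
  of \<open>f\<close> on the right, and they survive the limit \<open>h \<rightarrow> 0\<close>.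
\<close>

lemma hardy_half_plane:
  assumes cont: "continuous_on {z. Im z \<ge> 0} f" and hardy: "f \<in> hardy_space2"
  shows "line_energy f 0 < \<infinity>"
    and "y > 0 \<Longrightarrow> line_energy f y \<le> line_energy f 0"
    and "y > 0 \<Longrightarrow> ennreal ((cmod (f (Complex x y)))\<^sup>2) \<le> ennreal (1 / (pi * y)) *
           line_energy f 0"
proof -
  let ?R = "line_energy f 0"
  let ?L = "\<lambda>f y. line_energy f y"
  have hol: "f holomorphic_on {z. Im z > 0}" and fin: "(SUP y\<in>{0<..}. ?L f y) < \<infinity>"
    using hardy by (auto simp: hardy_space2_def)
  then obtain N where "(SUP y\<in>{0<..}. ?L f y) = ennreal N" and N0: "N \<ge> 0"
    by (cases "(SUP y\<in>{0<..}. ?L f y)") (auto simp: top_unique)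
  then have N: "?L f y \<le> ennreal N" if "y > 0" for y
    using SUP_upper[of y "{0<..}" "?L f"] that by auto
  have meas[measurable]: "(\<lambda>x. f (Complex x y)) \<in> borel_measurable borel" if "y \<ge> 0" for y
    by (rule borel_measurable_on_real_line[OF cont that])
  have R: "?R \<le> ennreal N"
  proof -
    have "(\<lambda>n. f (Complex x (1 / real (Suc n)))) \<longlonglongrightarrow> f (Complex x 0)" for x
    proof (rule continuous_on_tendsto_compose[OF cont])
      show "(\<lambda>n. Complex x (1 / real (Suc n))) \<longlonglongrightarrow> Complex x 0"
        by (intro tendsto_intros LIMSEQ_Suc[OF lim_1_over_n])
    qed auto
    then have "(\<lambda>n. ennreal ((cmod (f (Complex x (1 / real (Suc n)))))\<^sup>2)) \<longlonglongrightarrow> ennreal ((cmod (f (Complex x 0)))\<^sup>2)" for x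
      by (intro tendsto_ennrealI tendsto_intros)
    then have "?R = (\<integral>\<^sup>+ x. liminf (\<lambda>n. ennreal ((cmod (f (Complex x (1 / real (Suc n)))))\<^sup>2)) \<partial>lborel)"
      by (intro nn_integral_cong lim_imp_Liminf[symmetric]) auto
    also have "\<dots> \<le> liminf (\<lambda>n. ?L f (1 / real (Suc n)))"
      by (rule nn_integral_liminf) (use meas in auto)
    also have "\<dots> \<le> liminf (\<lambda>n. ennreal N)"
      by (intro Liminf_mono always_eventually allI N) auto
    finally show ?thesis by (simp add: Liminf_const)
  qed
  then show fin: "?R < \<infinity>" by (simp add: ennreal_less_top order_le_less_trans)
  have N': "?L f y \<le> ennreal N" if "y \<ge> 0" for y
    using N[of y] R that by (cases "y = 0") auto
  define g where "g n = horizontal_mean (1 / real (Suc n)) f" for n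
  have contg: "continuous_on {z. Im z \<ge> 0} (g n)" for n
    unfolding g_def by (rule continuous_horizontal_mean[OF cont])
  have holg: "g n holomorphic_on {z. Im z > 0}" for n
    unfolding g_def by (rule holomorphic_horizontal_mean[OF hol]) simp
  have boundg: "cmod (g n z) \<le> sqrt (real (Suc n) * N)" if z: "Im z \<ge> 0" for n z
  proof -
    let ?h = "1 / real (Suc n)"
    have e: "z + of_real (?h * s) = Complex (Re z + ?h * s) (Im z)" for s
      by (simp add: complex_eq_iff)
    have "ennreal ((cmod (g n z))\<^sup>2) \<le> (\<integral>\<^sup>+ s. indicator {0..1} s * ennreal ((cmod (f (z + of_real (?h * s))))\<^sup>2) \<partial>lborel)"
      unfolding g_def by (rule horizontal_mean_square_le[OF cont z])
    also have "\<dots> \<le> (\<integral>\<^sup>+ s. ennreal ((cmod (f (Complex (Re z + ?h * s) (Im z))))\<^sup>2) \<partial>lborel)"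
      unfolding e by (intro nn_integral_mono) (auto simp: indicator_def)
    also have "\<dots> = ennreal (real (Suc n)) * (ennreal \<bar>?h\<bar> * (\<integral>\<^sup>+ s. ennreal ((cmod (f (Complex (Re z + ?h * s) (Im z))))\<^sup>2) \<partial>lborel))"
      by (subst mult.assoc[symmetric], subst ennreal_mult[symmetric]) auto
    also have "ennreal \<bar>?h\<bar> * (\<integral>\<^sup>+ s. ennreal ((cmod (f (Complex (Re z + ?h * s) (Im z))))\<^sup>2) \<partial>lborel) = ?L f (Im z)"
      by (rule nn_integral_real_affine[symmetric, where c = ?h and t = "Re z"]) (use z meas in auto)
    also have "ennreal (real (Suc n)) * ?L f (Im z) \<le> ennreal (real (Suc n)) * ennreal N"
      by (intro mult_left_mono N' z) auto
    also have "\<dots> = ennreal (real (Suc n) * N)" using N0 by (simp add: ennreal_mult)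
    finally have "(cmod (g n z))\<^sup>2 \<le> real (Suc n) * N" using N0 by (simp add: ennreal_le_iff)
    then show ?thesis using real_le_rsqrt by blast
  qed
  have L2g: "?L (g n) 0 \<le> ?R" for n
  proof -
    let ?h = "1 / real (Suc n)"
    have e: "Complex x 0 + of_real (?h * s) = Complex (?h * s + 1 * x) 0" for x s
      by (simp add: complex_eq_iff)
    have "?L (g n) 0 \<le> (\<integral>\<^sup>+ x. \<integral>\<^sup>+ s. indicator {0..1} s * ennreal ((cmod (f (Complex (?h * s + 1 * x) 0)))\<^sup>2) \<partial>lborel \<partial>lborel)"
    proof (rule nn_integral_mono)
      fix x
      show "ennreal ((cmod (g n (Complex x 0)))\<^sup>2) \<le> (\<integral>\<^sup>+ s. indicator {0..1} s * ennreal ((cmod (f (Complex (?h * s + 1 * x) 0)))\<^sup>2) \<partial>lborel)"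
        unfolding g_def e[symmetric] by (rule horizontal_mean_square_le[OF cont]) simp
    qed
    also have "\<dots> = (\<integral>\<^sup>+ s. \<integral>\<^sup>+ x. indicator {0..1} s * ennreal ((cmod (f (Complex (?h * s + 1 * x) 0)))\<^sup>2) \<partial>lborel \<partial>lborel)"
    proof (rule lborel_pair.Fubini')
      have "continuous_on UNIV (\<lambda>w::real \<times> real. f (Complex (?h * fst w + 1 * snd w) 0))"
        by (rule continuous_on_compose2[OF cont]) (auto intro!: continuous_intros)
      then have m: "(\<lambda>w::real \<times> real. f (Complex (?h * fst w + 1 * snd w) 0)) \<in> borel_measurable (lborel \<Otimes>\<^sub>M lborel)"
        by (simp add: lborel_prod borel_measurable_continuous_onI)
      then have "(\<lambda>w::real \<times> real. indicator {0..1} (fst w) * ennreal ((cmod (f (Complex (?h * fst w + 1 * snd w) 0)))\<^sup>2)) \<in> borel_measurable (lborel \<Otimes>\<^sub>M lborel)"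
        by measurable
      then show "(\<lambda>(s, x). indicator {0..1} s * ennreal ((cmod (f (Complex (?h * s + 1 * x) 0)))\<^sup>2)) \<in> borel_measurable (lborel \<Otimes>\<^sub>M lborel)"
        by (simp add: case_prod_unfold)
    qed
    also have "\<dots> = (\<integral>\<^sup>+ s. indicator {0..1::real} s * ?R \<partial>lborel)"
    proof (rule nn_integral_cong)
      fix s :: real
      have mm: "(\<lambda>x. f (Complex (?h * s + 1 * x) 0)) \<in> borel_measurable borel"
        by (rule borel_measurable_continuous_onI, rule continuous_on_compose2[OF cont]) (auto intro!: continuous_intros)
      have "(\<integral>\<^sup>+ x. indicator {0..1} s * ennreal ((cmod (f (Complex (?h * s + 1 * x) 0)))\<^sup>2) \<partial>lborel)
         = indicator {0..1} s * (\<integral>\<^sup>+ x. ennreal ((cmod (f (Complex (?h * s + 1 * x) 0)))\<^sup>2) \<partial>lborel)"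
        using mm by (intro nn_integral_cmult) measurable
      also have "(\<integral>\<^sup>+ x. ennreal ((cmod (f (Complex (?h * s + 1 * x) 0)))\<^sup>2) \<partial>lborel) = ?R"
        using nn_integral_real_affine[of "\<lambda>x. ennreal ((cmod (f (Complex x 0)))\<^sup>2)" 1 "?h * s"] meas[of 0] by simp
      finally show "(\<integral>\<^sup>+ x. indicator {0..1} s * ennreal ((cmod (f (Complex (?h * s + 1 * x) 0)))\<^sup>2) \<partial>lborel) = indicator {0..1} s * ?R" .
    qed
    also have "\<dots> = ?R" by (simp add: nn_integral_multc)
    finally show ?thesis .
  qed
  have limg: "(\<lambda>n. ennreal ((cmod (g n z))\<^sup>2)) \<longlonglongrightarrow> ennreal ((cmod (f z))\<^sup>2)" if "Im z \<ge> 0" for z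
    unfolding g_def by (intro tendsto_ennrealI tendsto_intros horizontal_mean_tendsto[OF cont that])
  show "ennreal ((cmod (f (Complex x y)))\<^sup>2) \<le> ennreal (1 / (pi * y)) * ?R" if y: "y > 0"
  proof (rule LIMSEQ_le_const2[OF limg])
    show "\<exists>N. \<forall>n\<ge>N. ennreal ((cmod (g n (Complex x y)))\<^sup>2) \<le> ennreal (1 / (pi * y)) * ?R"
      using bounded_half_plane_L2(2)[OF contg holg boundg y] L2g
      by (meson mult_left_mono order_trans zero_le)
  qed (use y in auto)
  show "?L f y \<le> ?R" if y: "y > 0"
  proof -
    have [measurable]: "(\<lambda>x. g n (Complex x y)) \<in> borel_measurable borel" for n
      using y by (intro borel_measurable_on_real_line[OF contg]) auto
    have "?L f y = (\<integral>\<^sup>+ x. liminf (\<lambda>n. ennreal ((cmod (g n (Complex x y)))\<^sup>2)) \<partial>lborel)"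
      using y by (intro nn_integral_cong lim_imp_Liminf[symmetric] limg) auto
    also have "\<dots> \<le> liminf (\<lambda>n. ?L (g n) y)"
      by (rule nn_integral_liminf) auto
    also have "\<dots> \<le> liminf (\<lambda>n. ?R)"
      by (intro Liminf_mono always_eventually allI order_trans[OF bounded_half_plane_L2(1)[OF contg holg boundg y] L2g])
    finally show ?thesis by (simp add: Liminf_const)
  qed
qed

section \<open>De Branges spaces that contain the polynomials\<close>

lemma hardy_space2I:
  assumes "f holomorphic_on {z. Im z > 0}"
    and "\<And>y. y > 0 \<Longrightarrow> line_energy f y \<le> ennreal N"
  shows "f \<in> hardy_space2"
proof -
  have "(SUP y\<in>{0<..}. \<integral>\<^sup>+ x. ennreal ((cmod (f (Complex x y)))\<^sup>2) \<partial>lborel) \<le> ennreal N"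
    by (rule SUP_least) (use assms(2) in auto)
  then show ?thesis using assms(1) by (auto simp: hardy_space2_def order_le_less_trans)
qed

lemma hardy_space2D:
  assumes "f \<in> hardy_space2"
  obtains N where "N \<ge> 0"
    "\<And>y. y > 0 \<Longrightarrow> line_energy f y \<le> ennreal N"
proof -
  let ?L = "\<lambda>y. line_energy f y"
  have fin: "(SUP y\<in>{0<..}. ?L y) < \<infinity>" using assms by (simp add: hardy_space2_def)
  then obtain N where N: "(SUP y\<in>{0<..}. ?L y) = ennreal N" "N \<ge> 0"
    by (cases "(SUP y\<in>{0<..}. ?L y)") (auto simp: top_unique)
  show ?thesis
    by (rule that[of N]) (use SUP_upper[of _ "{0<..}" ?L] N in auto)
qed

lemma entire_imp_continuous: "entire F \<Longrightarrow> continuous_on S F"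
  by (meson continuous_on_subset entire_def holomorphic_on_imp_continuous_on top_greatest)

lemma entire_imp_holomorphic: "entire F \<Longrightarrow> F holomorphic_on S"
  by (meson entire_def holomorphic_on_subset top_greatest)

lemma sharp_sharp [simp]: "sharp (sharp F) = F"
  by (simp add: sharp_def fun_eq_iff)

lemma entire_sharp: "entire F \<Longrightarrow> entire (sharp F)"
proof -
  assume F: "entire F"
  have "F holomorphic_on (cnj ` UNIV)" by (rule entire_imp_holomorphic[OF F])
  then have "(cnj \<circ> F \<circ> cnj) holomorphic_on UNIV"
    by (intro holomorphic_on_compose_cnj_cnj) auto
  then show ?thesis by (simp add: entire_def sharp_def[abs_def] o_def)
qed

lemma cmod_sharp: "cmod (sharp F z) = cmod (F (cnj z))"
  by (simp add: sharp_def)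

lemma sharp_linear: "sharp (\<lambda>z. a * F z + b * G z) = (\<lambda>z. cnj a * sharp F z + cnj b * sharp G z)"
  by (simp add: sharp_def fun_eq_iff)

locale de_Branges_with_polynomials =
  fixes E :: "complex \<Rightarrow> complex"
  assumes HB: "hermite_biehler E"
    and polynomials: "poly p \<in> de_Branges_space E"
begin

abbreviation "H \<equiv> de_Branges_space E"
abbreviation "nrm \<equiv> de_Branges_norm E"
abbreviation "ip \<equiv> de_Branges_inner E"

lemma entire_E: "entire E"
  using HB by (simp add: hermite_biehler_def)

lemma entire_H: "F \<in> H \<Longrightarrow> entire F"
  by (simp add: de_Branges_space_def)

text \<open>
  In the open half-plane this is the Hermite-Biehler inequality. For real \<open>z\<close> it holds because \<open>1 / E\<close> lies in
  the Hardy space: at a real zero, \<open>|1 / E|\<^sup>2\<close> would be at least a constant times \<open>1 / y\<^sup>2\<close> on an interval of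
  length \<open>2y\<close> at height \<open>y\<close>, and the energy at height \<open>y\<close> would grow like \<open>1 / y\<close>.
\<close>

lemma E_nonzero:
  assumes "Im z \<ge> 0" shows "E z \<noteq> 0"
proof (cases "Im z > 0")
  case True
  then have "cmod (E z) > cmod (sharp E z)" using HB by (simp add: hermite_biehler_def)
  then show ?thesis by (metis norm_ge_zero norm_zero not_less)
next
  case False
  show ?thesis
  proof
    assume E0: "E z = 0"
    have zr: "Im z = 0" using False assms by simp
    have "(\<lambda>w. poly 1 w / E w) \<in> hardy_space2"
      using polynomials[of 1] by (simp add: de_Branges_space_def)
    then have "(\<lambda>w. 1 / E w) \<in> hardy_space2" by simp
    then obtain N where N: "N \<ge> 0"
      "\<And>y. y > 0 \<Longrightarrow> (\<integral>\<^sup>+ x. ennreal ((cmod (1 / E (Complex x y)))\<^sup>2) \<partial>lborel) \<le> ennreal N"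
      using hardy_space2D by blast
    have "(E has_field_derivative deriv E z) (at z)"
      using entire_E by (simp add: entire_def holomorphic_derivI)
    then have "(E has_derivative (\<lambda>w. deriv E z * w)) (at z)"
      by (simp add: has_field_derivative_def)
    then obtain d where d: "d > 0" "\<And>w. norm (w - z) < d \<Longrightarrow> norm (E w - E z - deriv E z * (w - z)) \<le> 1 * norm (w - z)"
      unfolding has_derivative_at_alt by (metis zero_less_one)
    define L where "L = cmod (deriv E z) + 1"
    have L: "L > 0" by (simp add: L_def add_nonneg_pos)
    have EL: "cmod (E w) \<le> L * cmod (w - z)" if "cmod (w - z) < d" for w
    proof -
      have "cmod (E w) \<le> cmod (E w - deriv E z * (w - z)) + cmod (deriv E z * (w - z))"
        by (metis diff_add_cancel norm_triangle_ineq)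
      also have "\<dots> \<le> cmod (w - z) + cmod (deriv E z) * cmod (w - z)"
        using d(2)[OF that] E0 by (simp add: norm_mult)
      finally show ?thesis by (simp add: L_def algebra_simps)
    qed
    \<comment> \<open>the first bound keeps the segment in the disc where E is at most L |w - z|, the second makes 1 / (L^2 y) exceed N\<close>
    define y where "y = min (d / 4) (1 / (2 * L\<^sup>2 * (N + 1)))"
    have y: "y > 0" using d L N by (simp add: y_def)
    have "ennreal (1 / (L\<^sup>2 * y)) = ennreal (1 / (2 * L\<^sup>2 * y\<^sup>2)) * ennreal (2 * y)"
      using y L by (subst ennreal_mult[symmetric]) (auto simp: power2_eq_square)
    also have "ennreal (2 * y) = emeasure lborel {Re z - y .. Re z + y}" using y by simp
    also have "ennreal (1 / (2 * L\<^sup>2 * y\<^sup>2)) * emeasure lborel {Re z - y .. Re z + y}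
      = (\<integral>\<^sup>+ x. ennreal (1 / (2 * L\<^sup>2 * y\<^sup>2)) * indicator {Re z - y .. Re z + y} x \<partial>lborel)"
      by (rule nn_integral_cmult_indicator[symmetric]) simp
    also have "\<dots> \<le> (\<integral>\<^sup>+ x. ennreal ((cmod (1 / E (Complex x y)))\<^sup>2) \<partial>lborel)"
    proof (rule nn_integral_mono)
      fix x
      show "ennreal (1 / (2 * L\<^sup>2 * y\<^sup>2)) * indicator {Re z - y .. Re z + y} x \<le> ennreal ((cmod (1 / E (Complex x y)))\<^sup>2)"
      proof (cases "x \<in> {Re z - y .. Re z + y}")
        case True
        have sq: "(cmod (Complex x y - z))\<^sup>2 \<le> 2 * y\<^sup>2"
        proof -
          have "\<bar>x - Re z\<bar> \<le> \<bar>y\<bar>" using True y by (simp add: abs_le_iff)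
          then have "(x - Re z)\<^sup>2 \<le> y\<^sup>2" by (simp add: abs_le_square_iff)
          then show ?thesis using zr by (simp add: cmod_power2)
        qed
        have "(cmod (Complex x y - z))\<^sup>2 < d\<^sup>2"
        proof -
          have "2 * y\<^sup>2 \<le> 2 * (d/4)\<^sup>2" using y by (intro mult_left_mono power_mono) (auto simp: y_def)
          also have "\<dots> < d\<^sup>2" using d by (simp add: power2_eq_square)
          finally show ?thesis using sq by simp
        qed
        then have "cmod (Complex x y - z) < d" using d power_less_imp_less_base by fastforce
        then have "cmod (E (Complex x y)) \<le> L * cmod (Complex x y - z)" by (rule EL)
        then have "(cmod (E (Complex x y)))\<^sup>2 \<le> (L * cmod (Complex x y - z))\<^sup>2" by (intro power_mono) auto
        also have "\<dots> \<le> L\<^sup>2 * (2 * y\<^sup>2)" using sq by (simp add: power_mult_distrib mult_left_mono)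
        finally have le: "(cmod (E (Complex x y)))\<^sup>2 \<le> 2 * L\<^sup>2 * y\<^sup>2" by simp
        have "cmod (E (Complex x y)) > cmod (sharp E (Complex x y))"
          using HB y by (simp add: hermite_biehler_def)
        then have "cmod (E (Complex x y)) > 0" using norm_ge_zero le_less_trans by blast
        then have "1 / (2 * L\<^sup>2 * y\<^sup>2) \<le> 1 / (cmod (E (Complex x y)))\<^sup>2"
          using le by (intro divide_left_mono) (auto intro!: mult_pos_pos simp: L y less_imp_neq[OF y] less_imp_neq[OF L, symmetric])
        then show ?thesis using True by (simp add: norm_divide power_divide ennreal_leI)
      qed simp
    qed
    also have "\<dots> \<le> ennreal N" by (rule N(2)[OF y])
    finally have "1 / (L\<^sup>2 * y) \<le> N" using N(1) by simp
    have "L\<^sup>2 * y \<le> L\<^sup>2 * (1 / (2 * L\<^sup>2 * (N + 1)))" by (intro mult_left_mono) (auto simp: y_def)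
    moreover have "L\<^sup>2 * (1 / (2 * L\<^sup>2 * (N + 1))) = 1 / (2 * (N + 1))" using L by simp
    ultimately have "L\<^sup>2 * y \<le> 1 / (2 * (N + 1))" by metis
    then have "1 / (1 / (2 * (N + 1))) \<le> 1 / (L\<^sup>2 * y)"
      using L y N(1) by (intro divide_left_mono) auto
    then have "2 * (N + 1) \<le> 1 / (L\<^sup>2 * y)" by simp
    from order_trans[OF this \<open>1 / (L\<^sup>2 * y) \<le> N\<close>] show False using N(1) by simp
  qed
qed

lemma continuous_quotient: "entire F \<Longrightarrow> continuous_on {z. Im z \<ge> 0} (\<lambda>z. F z / E z)"
  using E_nonzero by (intro continuous_intros entire_imp_continuous entire_E) auto

lemma holomorphic_quotient: "entire F \<Longrightarrow> (\<lambda>z. F z / E z) holomorphic_on {z. Im z > 0}"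
  using E_nonzero by (intro holomorphic_intros entire_imp_holomorphic entire_E) (auto simp: less_imp_le)

lemma sharp_H: assumes "F \<in> H" shows "sharp F \<in> H"
  using assms by (simp add: de_Branges_space_def entire_sharp)

definition line_norm2 :: "(complex \<Rightarrow> complex) \<Rightarrow> real \<Rightarrow> ennreal" where
  "line_norm2 F y = (\<integral>\<^sup>+ x. ennreal ((cmod (F (Complex x y) / E (Complex x y)))\<^sup>2) \<partial>lborel)"

lemma measurable_quotient:
  "entire F \<Longrightarrow> y \<ge> 0 \<Longrightarrow> (\<lambda>x. F (Complex x y) / E (Complex x y)) \<in> borel_measurable borel"
  using borel_measurable_on_real_line[OF continuous_quotient] by simp

lemma line_norm2_real:
  assumes F: "F \<in> H"
  shows "integrable lborel (\<lambda>x. (cmod (F (of_real x) / E (of_real x)))\<^sup>2)"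
    and "line_norm2 F 0 = ennreal ((nrm F)\<^sup>2)"
proof -
  have fin: "line_norm2 F 0 < \<infinity>"
    using hardy_half_plane(1)[OF continuous_quotient[OF entire_H[OF F]]] F
    by (simp add: line_norm2_def de_Branges_space_def)
  have [measurable]: "(\<lambda>x. F (Complex x 0) / E (Complex x 0)) \<in> borel_measurable borel"
    by (rule measurable_quotient[OF entire_H[OF F]]) simp
  have i: "integrable lborel (\<lambda>x. (cmod (F (Complex x 0) / E (Complex x 0)))\<^sup>2)"
  proof (rule integrableI_nonneg)
    show "(\<integral>\<^sup>+ x. ennreal ((cmod (F (Complex x 0) / E (Complex x 0)))\<^sup>2) \<partial>lborel) < \<infinity>"
      using fin by (simp add: line_norm2_def)
  qed auto
  then show i': "integrable lborel (\<lambda>x. (cmod (F (of_real x) / E (of_real x)))\<^sup>2)"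
    by (simp add: complex_of_real_def)
  have "line_norm2 F 0 = ennreal (LINT x|lborel. (cmod (F (of_real x) / E (of_real x)))\<^sup>2)"
    unfolding line_norm2_def complex_of_real_def[symmetric]
    by (rule nn_integral_eq_integral[OF i']) simp
  then show "line_norm2 F 0 = ennreal ((nrm F)\<^sup>2)"
    by (simp add: de_Branges_norm_def integral_nonneg_AE)
qed

lemma line_norm2_le:
  assumes F: "F \<in> H" and y: "y \<ge> 0"
  shows "line_norm2 F y \<le> ennreal ((nrm F)\<^sup>2)"
proof (cases "y = 0")
  case True then show ?thesis using line_norm2_real(2)[OF F] by simp
next
  case False
  then show ?thesis
    using hardy_half_plane(2)[OF continuous_quotient[OF entire_H[OF F]], of y] F y line_norm2_real(2)[OF F]
    by (simp add: line_norm2_def de_Branges_space_def)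
qed

lemma nrm_nonneg: "nrm F \<ge> 0"
  by (simp add: de_Branges_norm_def integral_nonneg_AE)

lemma nrm_sharp: "nrm (sharp F) = nrm F"
  by (simp add: de_Branges_norm_def norm_divide cmod_sharp)

lemma evaluation_upper:
  assumes F: "F \<in> H" and z: "Im z > 0"
  shows "cmod (F z) \<le> cmod (E z) / sqrt (pi * Im z) * nrm F"
proof -
  have "ennreal ((cmod (F z / E z))\<^sup>2) \<le> ennreal (1 / (pi * Im z)) * line_norm2 F 0"
    using hardy_half_plane(3)[OF continuous_quotient[OF entire_H[OF F]], of "Im z" "Re z"] F z
    by (simp add: line_norm2_def de_Branges_space_def)
  also have "\<dots> = ennreal (1 / (pi * Im z) * (nrm F)\<^sup>2)"
    using z by (simp add: line_norm2_real(2)[OF F] ennreal_mult[symmetric] del: times_divide_eq_left)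
  finally have "(cmod (F z / E z))\<^sup>2 \<le> 1 / (pi * Im z) * (nrm F)\<^sup>2"
    using z by (subst (asm) ennreal_le_iff) auto
  then have "cmod (F z / E z) \<le> sqrt (1 / (pi * Im z) * (nrm F)\<^sup>2)"
    by (rule real_le_rsqrt)
  also have "\<dots> = nrm F / sqrt (pi * Im z)"
    using nrm_nonneg[of F] by (simp add: real_sqrt_mult real_sqrt_divide)
  finally have "cmod (F z) / cmod (E z) \<le> nrm F / sqrt (pi * Im z)" by (simp add: norm_divide)
  then show ?thesis using E_nonzero[of z] z by (simp add: field_simps)
qed

text \<open>
  The Hardy space estimate degenerates like \<open>|Im z|\<close> to the power \<open>-1/2\<close> at the real line. The factor \<open>z\<^sup>2 - R\<^sup>2\<close> has
  modulus \<open>2R |Im z|\<close> on the circle \<open>|z| = R\<close> and so compensates for this there. The maximum principle for the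
  product then bounds \<open>F\<close> on the smaller disc \<open>|z| \<le> R / 2\<close>, real points included.
\<close>

lemma evaluation_bound:
  assumes r: "r > 0"
  obtains K where "K > 0" "\<And>F z. F \<in> H \<Longrightarrow> cmod z \<le> r \<Longrightarrow> cmod (F z) \<le> K * nrm F"
proof -
  define R where "R = 2 * r"
  have R: "R > 0" using r by (simp add: R_def)
  have "compact (E ` cball 0 R)"
    by (intro compact_continuous_image entire_imp_continuous[OF entire_E]) simp
  then obtain M where M0: "M > 0" and M: "\<And>z. cmod z \<le> R \<Longrightarrow> cmod (E z) \<le> M"
    using compact_imp_bounded[of "E ` cball 0 R"] unfolding bounded_pos by auto
  have off: "cmod (F z) * sqrt \<bar>Im z\<bar> \<le> M * nrm F" if F: "F \<in> H" and z: "cmod z \<le> R" "Im z \<noteq> 0" for F z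
  proof -
    have up: "cmod (F z) * sqrt (Im z) \<le> M * nrm F" if F: "F \<in> H" and z: "cmod z \<le> R" "Im z > 0" for F z
    proof -
      have "cmod (F z) * sqrt (Im z) \<le> cmod (E z) / sqrt (pi * Im z) * nrm F * sqrt (Im z)"
        using evaluation_upper[OF F z(2)] z(2) by (intro mult_right_mono) auto
      also have "\<dots> = cmod (E z) * nrm F / sqrt pi" using z by (simp add: real_sqrt_mult)
      also have "\<dots> \<le> cmod (E z) * nrm F / 1"
        using pi_gt3 nrm_nonneg[of F] by (intro divide_left_mono) auto
      also have "\<dots> \<le> M * nrm F" using M[OF z(1)] nrm_nonneg[of F] by (simp add: mult_right_mono)
      finally show ?thesis .
    qed
    show ?thesis
    proof (cases "Im z > 0")
      case True then show ?thesis using up[OF F z(1)] by simp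
    next
      case False
      then show ?thesis using up[OF sharp_H[OF F], of "cnj z"] z by (simp add: cmod_sharp nrm_sharp)
    qed
  qed
  define K where "K = 2 * R * (sqrt R * M) / (3 * r\<^sup>2)"
  have K: "K > 0" using R M0 r by (simp add: K_def)
  moreover have "cmod (F z) \<le> K * nrm F" if F: "F \<in> H" and z: "cmod z \<le> r" for F z
  proof -
    define g where "g w = F w * (w\<^sup>2 - (of_real R)\<^sup>2)" for w
    have "g holomorphic_on UNIV" unfolding g_def
      by (intro holomorphic_intros entire_imp_holomorphic[OF entire_H[OF F]])
    then have holg: "g holomorphic_on S" "continuous_on S g" for S
      by (auto intro: holomorphic_on_subset holomorphic_on_imp_continuous_on)
    have "cmod (g z) \<le> 2 * R * (sqrt R * (M * nrm F))"
    proof (rule maximum_modulus_frontier[of g "cball 0 R"])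
      fix w :: complex assume "w \<in> frontier (cball 0 R)"
      then have w: "cmod w = R" using R by (simp add: frontier_cball)
      have "w\<^sup>2 - (of_real R)\<^sup>2 = w\<^sup>2 - w * cnj w" using complex_norm_square[of w] w by simp
      also have "\<dots> = w * (2 * \<i> * of_real (Im w))" by (simp add: complex_eq_iff power2_eq_square algebra_simps)
      finally have "cmod (w\<^sup>2 - (of_real R)\<^sup>2) = 2 * R * \<bar>Im w\<bar>"
        using w by (simp add: norm_mult)
      then have eq: "cmod (g w) = 2 * R * (sqrt \<bar>Im w\<bar> * (cmod (F w) * sqrt \<bar>Im w\<bar>))"
        by (simp add: g_def norm_mult mult.commute mult.left_commute)
      have "cmod (F w) * sqrt \<bar>Im w\<bar> \<le> M * nrm F"
        using off[OF F, of w] w M0 nrm_nonneg[of F] by (cases "Im w = 0") auto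
      moreover have "sqrt \<bar>Im w\<bar> \<le> sqrt R" using abs_Im_le_cmod[of w] w by simp
      ultimately show "cmod (g w) \<le> 2 * R * (sqrt R * (M * nrm F))"
        unfolding eq using R by (intro mult_left_mono[OF mult_mono]) auto
    qed (use z r holg in \<open>auto simp: R_def\<close>)
    moreover have "cmod (z\<^sup>2 - (of_real R)\<^sup>2) \<ge> 3 * r\<^sup>2"
    proof -
      have "cmod (z\<^sup>2) \<le> r\<^sup>2" using z by (simp add: norm_power power_mono)
      moreover have "cmod ((complex_of_real R)\<^sup>2) = 4 * r\<^sup>2" using r by (simp add: R_def norm_mult power2_eq_square)
      ultimately show ?thesis
        using norm_triangle_ineq2[of "(complex_of_real R)\<^sup>2" "z\<^sup>2"] norm_minus_commute[of "(complex_of_real R)\<^sup>2" "z\<^sup>2"]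
        by linarith
    qed
    then have "cmod (F z) * (3 * r\<^sup>2) \<le> cmod (g z)"
      by (simp add: g_def norm_mult mult_left_mono)
    ultimately have "cmod (F z) * (3 * r\<^sup>2) \<le> 2 * R * (sqrt R * (M * nrm F))" by linarith
    then show ?thesis using r by (simp add: K_def field_simps)
  qed
  ultimately show ?thesis using that by blast
qed

lemma hardy_linear:
  assumes "entire F" "entire G" "(\<lambda>z. F z / E z) \<in> hardy_space2" "(\<lambda>z. G z / E z) \<in> hardy_space2"
  shows "(\<lambda>z. (a * F z + b * G z) / E z) \<in> hardy_space2"
proof -
  from hardy_space2D[OF assms(3)] obtain N where N: "N \<ge> 0"
    "\<And>y. y > 0 \<Longrightarrow> line_norm2 F y \<le> ennreal N" unfolding line_norm2_def by blast
  from hardy_space2D[OF assms(4)] obtain N' where N': "N' \<ge> 0"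
    "\<And>y. y > 0 \<Longrightarrow> line_norm2 G y \<le> ennreal N'" unfolding line_norm2_def by blast
  let ?c = "2 * (cmod a)\<^sup>2" and ?d = "2 * (cmod b)\<^sup>2"
  show ?thesis
  proof (rule hardy_space2I[where N = "?c * N + ?d * N'"])
    show "(\<lambda>z. (a * F z + b * G z) / E z) holomorphic_on {z. 0 < Im z}"
      by (rule holomorphic_quotient) (use assms in \<open>auto simp: entire_def intro!: holomorphic_intros\<close>)
    fix y :: real assume y: "y > 0"
    have [measurable]: "(\<lambda>x. F (Complex x y) / E (Complex x y)) \<in> borel_measurable borel"
      "(\<lambda>x. G (Complex x y) / E (Complex x y)) \<in> borel_measurable borel"
      using measurable_quotient assms y by auto
    have pt: "(cmod (a * u + b * v))\<^sup>2 \<le> ?c * (cmod u)\<^sup>2 + ?d * (cmod v)\<^sup>2" for u v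
    proof -
      have "(cmod (a * u + b * v))\<^sup>2 \<le> (cmod (a * u) + cmod (b * v))\<^sup>2"
        by (intro power_mono norm_triangle_ineq) auto
      also have "\<dots> \<le> 2 * (cmod (a * u))\<^sup>2 + 2 * (cmod (b * v))\<^sup>2"
        using sum_squares_bound[of "cmod (a * u)" "cmod (b * v)"] by (simp add: power2_sum)
      finally show ?thesis by (simp add: norm_mult power_mult_distrib)
    qed
    have "(\<integral>\<^sup>+ x. ennreal ((cmod ((a * F (Complex x y) + b * G (Complex x y)) / E (Complex x y)))\<^sup>2) \<partial>lborel)
      \<le> (\<integral>\<^sup>+ x. ennreal ?c * ennreal ((cmod (F (Complex x y) / E (Complex x y)))\<^sup>2)
           + ennreal ?d * ennreal ((cmod (G (Complex x y) / E (Complex x y)))\<^sup>2) \<partial>lborel)"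
    proof (rule nn_integral_mono)
      fix x
      have "(cmod ((a * F (Complex x y) + b * G (Complex x y)) / E (Complex x y)))\<^sup>2
        \<le> ?c * (cmod (F (Complex x y) / E (Complex x y)))\<^sup>2 + ?d * (cmod (G (Complex x y) / E (Complex x y)))\<^sup>2"
        using pt[of "F (Complex x y) / E (Complex x y)" "G (Complex x y) / E (Complex x y)"]
        by (simp add: add_divide_distrib)
      then show "ennreal ((cmod ((a * F (Complex x y) + b * G (Complex x y)) / E (Complex x y)))\<^sup>2)
        \<le> ennreal ?c * ennreal ((cmod (F (Complex x y) / E (Complex x y)))\<^sup>2)
           + ennreal ?d * ennreal ((cmod (G (Complex x y) / E (Complex x y)))\<^sup>2)"
        by (simp add: ennreal_mult'[symmetric] ennreal_plus[symmetric] ennreal_leI del: ennreal_plus)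
    qed
    also have "\<dots> = ennreal ?c * line_norm2 F y + ennreal ?d * line_norm2 G y"
      by (simp add: nn_integral_add nn_integral_cmult line_norm2_def)
    also have "\<dots> \<le> ennreal ?c * ennreal N + ennreal ?d * ennreal N'"
      using N(2) N'(2) y by (intro add_mono mult_left_mono) auto
    also have "\<dots> = ennreal (?c * N + ?d * N')"
      using N(1) N'(1) by (simp add: ennreal_mult'[symmetric] ennreal_plus[symmetric] del: ennreal_plus)
    finally show "(\<integral>\<^sup>+ x. ennreal ((cmod ((a * F (Complex x y) + b * G (Complex x y)) / E (Complex x y)))\<^sup>2) \<partial>lborel)
       \<le> ennreal (?c * N + ?d * N')" .
  qed
qed

lemma H_linear:
  assumes F: "F \<in> H" and G: "G \<in> H"
  shows "(\<lambda>z. a * F z + b * G z) \<in> H"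
  unfolding de_Branges_space_def mem_Collect_eq
proof (intro conjI)
  show "entire (\<lambda>z. a * F z + b * G z)"
    using F G by (auto simp: de_Branges_space_def entire_def intro!: holomorphic_intros)
  show "(\<lambda>z. (a * F z + b * G z) / E z) \<in> hardy_space2"
    using F G by (intro hardy_linear) (auto simp: de_Branges_space_def)
  have "(\<lambda>z. (cnj a * sharp F z + cnj b * sharp G z) / E z) \<in> hardy_space2"
    using F G by (intro hardy_linear) (auto simp: de_Branges_space_def entire_sharp)
  then show "(\<lambda>z. sharp (\<lambda>z. a * F z + b * G z) z / E z) \<in> hardy_space2"
    by (simp add: sharp_linear)
qed

lemma H_diff: "F \<in> H \<Longrightarrow> G \<in> H \<Longrightarrow> (\<lambda>z. F z - G z) \<in> H"
  using H_linear[of F G 1 "-1"] by simp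

lemma H_zero: "(\<lambda>z. 0) \<in> H"
  using polynomials[of 0] by (simp add: poly_0[abs_def])

lemma H_sum:
  assumes "\<And>n. n \<in> J \<Longrightarrow> e n \<in> H"
  shows "(\<lambda>z. \<Sum>n\<in>J. c n * e n z) \<in> H"
  using assms
proof (induction J rule: infinite_finite_induct)
  case (insert n J)
  then have "(\<lambda>z. c n * e n z + 1 * (\<Sum>n\<in>J. c n * e n z)) \<in> H"
    by (intro H_linear) auto
  then show ?case using insert by simp
qed (auto simp: H_zero)

text \<open>
  Fatou's lemma on each horizontal line. This takes the place of completeness in what follows.
\<close>

lemma H_closed_under_bounded_limits:
  assumes P: "\<And>n. P n \<in> H" and bd: "\<And>n. nrm (P n) \<le> C" and G: "entire G"
    and lim: "\<And>z. (\<lambda>n. P n z) \<longlonglongrightarrow> G z"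
  shows "G \<in> H" and "nrm G \<le> C"
proof -
  have C0: "C \<ge> 0" using bd[of 0] nrm_nonneg[of "P 0"] by linarith
  have fatou: "line_norm2 G y \<le> ennreal (C\<^sup>2)"
    if P: "\<And>n. P n \<in> H" and bd: "\<And>n. nrm (P n) \<le> C" and G: "entire G"
    and lim: "\<And>z. (\<lambda>n. P n z) \<longlonglongrightarrow> G z" and y: "y \<ge> 0" for P G y
  proof -
    have [measurable]: "(\<lambda>x. P n (Complex x y) / E (Complex x y)) \<in> borel_measurable borel" for n
      using measurable_quotient[OF entire_H[OF P] y] .
    have "(\<lambda>n. ennreal ((cmod (P n z / E z))\<^sup>2)) \<longlonglongrightarrow> ennreal ((cmod (G z / E z))\<^sup>2)" if "Im z \<ge> 0" for z
      using E_nonzero[OF that] by (intro tendsto_ennrealI tendsto_intros lim)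
    then have "line_norm2 G y = (\<integral>\<^sup>+ x. liminf (\<lambda>n. ennreal ((cmod (P n (Complex x y) / E (Complex x y)))\<^sup>2)) \<partial>lborel)"
      unfolding line_norm2_def using y by (intro nn_integral_cong lim_imp_Liminf[symmetric]) auto
    also have "\<dots> \<le> liminf (\<lambda>n. line_norm2 (P n) y)"
      unfolding line_norm2_def by (rule nn_integral_liminf) auto
    also have "\<dots> \<le> liminf (\<lambda>n. ennreal (C\<^sup>2))"
    proof (intro Liminf_mono always_eventually allI)
      fix n
      have "line_norm2 (P n) y \<le> ennreal ((nrm (P n))\<^sup>2)" by (rule line_norm2_le[OF P y])
      also have "\<dots> \<le> ennreal (C\<^sup>2)" using bd[of n] nrm_nonneg by (intro ennreal_leI power_mono) auto
      finally show "line_norm2 (P n) y \<le> ennreal (C\<^sup>2)" .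
    qed
    finally show ?thesis by (simp add: Liminf_const)
  qed
  have lim': "(\<lambda>n. sharp (P n) z) \<longlonglongrightarrow> sharp G z" for z
    unfolding sharp_def by (intro tendsto_intros lim)
  have 1: "line_norm2 G y \<le> ennreal (C\<^sup>2)" if "y \<ge> 0" for y
    by (rule fatou[OF P bd G lim that])
  have 2: "line_norm2 (sharp G) y \<le> ennreal (C\<^sup>2)" if "y \<ge> 0" for y
    by (rule fatou[OF sharp_H[OF P] _ entire_sharp[OF G] lim' that]) (use bd in \<open>simp add: nrm_sharp\<close>)
  have h1: "(\<lambda>z. G z / E z) \<in> hardy_space2"
    by (rule hardy_space2I[OF holomorphic_quotient[OF G], where N = "C\<^sup>2"]) (use 1 in \<open>auto simp: line_norm2_def\<close>)
  have h2: "(\<lambda>z. sharp G z / E z) \<in> hardy_space2"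
    by (rule hardy_space2I[OF holomorphic_quotient[OF entire_sharp[OF G]], where N = "C\<^sup>2"]) (use 2 in \<open>auto simp: line_norm2_def\<close>)
  show GH: "G \<in> H" using G h1 h2 by (simp add: de_Branges_space_def)
  have "ennreal ((nrm G)\<^sup>2) \<le> ennreal (C\<^sup>2)"
    using 1[of 0] line_norm2_real(2)[OF GH] by simp
  then have "(nrm G)\<^sup>2 \<le> C\<^sup>2" by simp
  then show "nrm G \<le> C" using C0 by (rule power2_le_imp_le)
qed

lemma integrable_inner:
  assumes F: "F \<in> H" and G: "G \<in> H"
  shows "integrable lborel (\<lambda>x. F (of_real x) / E (of_real x) * cnj (G (of_real x) / E (of_real x)))"
proof (rule Bochner_Integration.integrable_bound)
  show "integrable lborel (\<lambda>x. (cmod (F (of_real x) / E (of_real x)))\<^sup>2 + (cmod (G (of_real x) / E (of_real x)))\<^sup>2)"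
    by (intro Bochner_Integration.integrable_add line_norm2_real F G)
  have [measurable]: "(\<lambda>x. F (of_real x) / E (of_real x)) \<in> borel_measurable borel"
     "(\<lambda>x. G (of_real x) / E (of_real x)) \<in> borel_measurable borel"
    using measurable_quotient[OF entire_H[OF F], of 0] measurable_quotient[OF entire_H[OF G], of 0]
    by (simp_all add: complex_of_real_def)
  show "(\<lambda>x. F (of_real x) / E (of_real x) * cnj (G (of_real x) / E (of_real x))) \<in> borel_measurable lborel"
    unfolding measurable_lborel1
    by (intro borel_measurable_times borel_measurable_continuous_on[OF continuous_on_cnj[OF continuous_on_id]]) measurable
  have "a * b \<le> a\<^sup>2 + b\<^sup>2" if "a \<ge> 0" "b \<ge> 0" for a b :: real
    using sum_squares_bound[of a b] that zero_le_mult_iff[of a b] by linarith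
  then show "AE x in lborel. norm (F (of_real x) / E (of_real x) * cnj (G (of_real x) / E (of_real x)))
     \<le> norm ((cmod (F (of_real x) / E (of_real x)))\<^sup>2 + (cmod (G (of_real x) / E (of_real x)))\<^sup>2)"
    by (intro AE_I2) (simp only: norm_mult complex_mod_cnj real_norm_def abs_of_nonneg[OF add_nonneg_nonneg[OF zero_le_power2 zero_le_power2]] norm_ge_zero)
qed

lemma ip_diff_scale:
  assumes "F \<in> H" "e \<in> H" "e' \<in> H"
  shows "ip (\<lambda>z. F z - c * e z) e' = ip F e' - c * ip e e'"
proof -
  have "ip (\<lambda>z. F z - c * e z) e' = (LINT x|lborel. F (of_real x) / E (of_real x) * cnj (e' (of_real x) / E (of_real x))
       - c * (e (of_real x) / E (of_real x) * cnj (e' (of_real x) / E (of_real x))))"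
    unfolding de_Branges_inner_def by (intro Bochner_Integration.integral_cong) (auto simp: diff_divide_distrib algebra_simps)
  also have "\<dots> = ip F e' - c * ip e e'"
    unfolding de_Branges_inner_def
    by (subst Bochner_Integration.integral_diff)
       (auto intro!: integrable_mult_right integrable_inner assms simp del: complex_cnj_divide times_divide_eq_left times_divide_eq_right)
  finally show ?thesis .
qed

lemma nrm2_diff_scale:
  assumes F: "F \<in> H" and e: "e \<in> H" "ip e e = 1"
  shows "(nrm (\<lambda>z. F z - c * e z))\<^sup>2 = (nrm F)\<^sup>2 - (cmod (ip F e))\<^sup>2 + (cmod (ip F e - c))\<^sup>2"
proof -
  let ?f = "\<lambda>x. F (complex_of_real x) / E (of_real x)" and ?g = "\<lambda>x. e (complex_of_real x) / E (of_real x)"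
  have i1: "integrable lborel (\<lambda>x. (cmod (?f x))\<^sup>2)" and i2: "integrable lborel (\<lambda>x. (cmod (?g x))\<^sup>2)"
    by (intro line_norm2_real F e)+
  have i3: "integrable lborel (\<lambda>x. ?f x * cnj (?g x))" by (intro integrable_inner F e)
  have n2: "(nrm G)\<^sup>2 = (LINT x|lborel. (cmod (G (of_real x) / E (of_real x)))\<^sup>2)" for G
    by (simp add: de_Branges_norm_def integral_nonneg_AE)
  have "complex_of_real (LINT x|lborel. (cmod (?g x))\<^sup>2) = ip e e"
    unfolding de_Branges_inner_def integral_complex_of_real[symmetric] by (simp only: complex_norm_square)
  then have one: "(LINT x|lborel. (cmod (?g x))\<^sup>2) = 1" using e(2) by simp
  have pt: "(cmod (u - c * v))\<^sup>2 = (cmod u)\<^sup>2 - 2 * Re (cnj c * (u * cnj v)) + (cmod c)\<^sup>2 * (cmod v)\<^sup>2" for u v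
    unfolding cmod_power2 by (simp add: power2_eq_square algebra_simps)
  have "(nrm (\<lambda>z. F z - c * e z))\<^sup>2 = (LINT x|lborel. (cmod (?f x - c * ?g x))\<^sup>2)"
    unfolding n2 by (simp add: diff_divide_distrib)
  also have "\<dots> = (LINT x|lborel. (cmod (?f x))\<^sup>2 - 2 * Re (cnj c * (?f x * cnj (?g x))) + (cmod c)\<^sup>2 * (cmod (?g x))\<^sup>2)"
    by (simp only: pt)
  also have "\<dots> = (LINT x|lborel. (cmod (?f x))\<^sup>2) - 2 * (LINT x|lborel. Re (cnj c * (?f x * cnj (?g x)))) + (cmod c)\<^sup>2 * (LINT x|lborel. (cmod (?g x))\<^sup>2)"
    using i1 i2 integrable_Re[OF integrable_mult_right[of "cnj c", OF i3]]
    by (simp only: Bochner_Integration.integral_add Bochner_Integration.integral_diff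
        integrable_mult_right Bochner_Integration.integrable_diff integral_mult_right_zero)
  also have "(LINT x|lborel. Re (cnj c * (?f x * cnj (?g x)))) = Re (cnj c * ip F e)"
    unfolding de_Branges_inner_def
    by (simp only: integral_Re[OF integrable_mult_right[of "cnj c", OF i3]] integral_mult_right_zero)
  also have "(LINT x|lborel. (cmod (?f x))\<^sup>2) = (nrm F)\<^sup>2" by (simp only: n2)
  also have "(nrm F)\<^sup>2 - 2 * Re (cnj c * ip F e) + (cmod c)\<^sup>2 * (LINT x|lborel. (cmod (?g x))\<^sup>2)
     = (nrm F)\<^sup>2 - (cmod (ip F e))\<^sup>2 + (cmod (ip F e - c))\<^sup>2"
    unfolding one unfolding cmod_power2 by (simp add: power2_eq_square algebra_simps)
  finally show ?thesis .
qed

end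

section \<open>Expansions in an orthonormal basis\<close>

locale de_Branges_basis = de_Branges_with_polynomials +
  fixes e :: "nat \<Rightarrow> complex \<Rightarrow> complex"
  assumes e_H: "e n \<in> H"
    and orthonormal: "ip (e m) (e n) = (if m = n then 1 else 0)"
    and dense: "F \<in> H \<Longrightarrow> \<epsilon> > 0 \<Longrightarrow> \<exists>J c. finite J \<and> nrm (\<lambda>z. F z - (\<Sum>n\<in>J. c n * e n z)) < \<epsilon>"
begin

lemma partial_H: "F \<in> H \<Longrightarrow> (\<lambda>z. F z - (\<Sum>n\<in>J. c n * e n z)) \<in> H"
  by (intro H_diff H_sum e_H)

lemma ip_partial:
  assumes F: "F \<in> H" and "finite J"
  shows "ip (\<lambda>z. F z - (\<Sum>n\<in>J. c n * e n z)) (e m) = ip F (e m) - (if m \<in> J then c m else 0)"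
  using \<open>finite J\<close>
proof (induction J)
  case (insert n J)
  have "ip (\<lambda>z. F z - (\<Sum>k\<in>insert n J. c k * e k z)) (e m)
      = ip (\<lambda>z. (F z - (\<Sum>k\<in>J. c k * e k z)) - c n * e n z) (e m)"
    using insert by (simp add: algebra_simps)
  also have "\<dots> = ip F (e m) - (if m \<in> J then c m else 0) - c n * (if n = m then 1 else 0)"
    using ip_diff_scale[OF partial_H[OF F] e_H e_H] insert by (simp add: orthonormal)
  finally show ?case using insert by auto
qed simp

text \<open>
  Completing the square, one basis function at a time; the formula shows that the choice \<open>c n = ip F (e n)\<close>
  gives the best approximation.
\<close>

lemma nrm2_partial:
  assumes F: "F \<in> H" and "finite J"
  shows "(nrm (\<lambda>z. F z - (\<Sum>n\<in>J. c n * e n z)))\<^sup>2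
    = (nrm F)\<^sup>2 - (\<Sum>n\<in>J. (cmod (ip F (e n)))\<^sup>2) + (\<Sum>n\<in>J. (cmod (ip F (e n) - c n))\<^sup>2)"
  using \<open>finite J\<close>
proof (induction J)
  case (insert n J)
  have "(nrm (\<lambda>z. F z - (\<Sum>k\<in>insert n J. c k * e k z)))\<^sup>2
      = (nrm (\<lambda>z. (F z - (\<Sum>k\<in>J. c k * e k z)) - c n * e n z))\<^sup>2"
    using insert by (simp add: algebra_simps)
  also have "\<dots> = (nrm (\<lambda>z. F z - (\<Sum>k\<in>J. c k * e k z)))\<^sup>2 - (cmod (ip F (e n)))\<^sup>2 + (cmod (ip F (e n) - c n))\<^sup>2"
    using nrm2_diff_scale[OF partial_H[OF F, where c = c and J = J] e_H[of n], where c = "c n"] ip_partial[OF F insert(1), of c n] insert(2)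
    by (simp add: orthonormal)
  finally show ?case using insert by simp
qed simp

lemma bessel:
  assumes F: "F \<in> H" and J: "finite J"
  shows "(\<Sum>n\<in>J. (cmod (ip F (e n)))\<^sup>2) \<le> (nrm F)\<^sup>2"
proof -
  have "0 \<le> (nrm (\<lambda>z. F z - (\<Sum>n\<in>J. ip F (e n) * e n z)))\<^sup>2" by simp
  then show ?thesis unfolding nrm2_partial[OF F J, of "\<lambda>n. ip F (e n)"] by simp
qed

lemma parseval:
  assumes F: "F \<in> H"
  shows "(\<lambda>n. (cmod (ip F (e n)))\<^sup>2) sums (nrm F)\<^sup>2"
proof -
  let ?a = "\<lambda>n. (cmod (ip F (e n)))\<^sup>2"
  have summ: "summable ?a"
    by (rule summableI_nonneg_bounded[where x = "(nrm F)\<^sup>2"]) (use bessel[OF F] in auto)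
  have "suminf ?a \<le> (nrm F)\<^sup>2"
    by (rule suminf_le_const[OF summ]) (use bessel[OF F] in auto)
  moreover have "(nrm F)\<^sup>2 \<le> suminf ?a + \<epsilon>" if eps: "\<epsilon> > 0" for \<epsilon>
  proof -
    obtain J c where J: "finite J" "nrm (\<lambda>z. F z - (\<Sum>n\<in>J. c n * e n z)) < sqrt \<epsilon>"
      using dense[OF F real_sqrt_gt_zero[OF eps]] by blast
    have "(nrm (\<lambda>z. F z - (\<Sum>n\<in>J. c n * e n z)))\<^sup>2 \<le> (sqrt \<epsilon>)\<^sup>2"
      using J(2) nrm_nonneg by (intro power_mono) (auto simp: less_imp_le)
    then have "(nrm F)\<^sup>2 - (\<Sum>n\<in>J. ?a n) + (\<Sum>n\<in>J. (cmod (ip F (e n) - c n))\<^sup>2) \<le> \<epsilon>"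
      using eps unfolding nrm2_partial[OF F J(1)] by simp
    moreover have "(\<Sum>n\<in>J. (cmod (ip F (e n) - c n))\<^sup>2) \<ge> 0" by (intro sum_nonneg) auto
    moreover have "(\<Sum>n\<in>J. ?a n) \<le> suminf ?a" by (rule sum_le_suminf[OF summ J(1)]) auto
    ultimately show ?thesis by linarith
  qed
  then have "(nrm F)\<^sup>2 \<le> suminf ?a" by (rule field_le_epsilon)
  ultimately show ?thesis using summable_sums[OF summ] by simp
qed

lemma expansion_converges:
  assumes F: "F \<in> H"
  shows "(\<lambda>N. nrm (\<lambda>z. F z - (\<Sum>n<N. ip F (e n) * e n z))) \<longlonglongrightarrow> 0"
proof -
  have "(\<lambda>N. (nrm F)\<^sup>2 - (\<Sum>n<N. (cmod (ip F (e n)))\<^sup>2)) \<longlonglongrightarrow> (nrm F)\<^sup>2 - (nrm F)\<^sup>2"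
    using parseval[OF F] unfolding sums_def by (intro tendsto_intros)
  then have "(\<lambda>N. (nrm (\<lambda>z. F z - (\<Sum>n<N. ip F (e n) * e n z)))\<^sup>2) \<longlonglongrightarrow> 0"
    using nrm2_partial[OF F, of "{..<_}" "\<lambda>n. ip F (e n)"] by simp
  from tendsto_real_sqrt[OF this] show ?thesis using nrm_nonneg by simp
qed

text \<open>
  Norm convergence of the partial sums implies pointwise convergence, because point evaluations are
  continuous.
\<close>

lemma expansion:
  assumes F: "F \<in> H"
  shows "(\<lambda>n. ip F (e n) * e n z) sums F z"
proof -
  have z1: "cmod z + 1 > 0" by (simp add: add_nonneg_pos)
  obtain K where K: "K > 0" "\<And>F w. F \<in> H \<Longrightarrow> cmod w \<le> cmod z + 1 \<Longrightarrow> cmod (F w) \<le> K * nrm F"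
    using evaluation_bound[OF z1] by blast
  have le: "cmod (F z - (\<Sum>n<N. ip F (e n) * e n z)) \<le> K * nrm (\<lambda>z. F z - (\<Sum>n<N. ip F (e n) * e n z))" for N
    by (rule K(2)[OF partial_H[OF F]]) simp
  have "(\<lambda>N. F z - (\<Sum>n<N. ip F (e n) * e n z)) \<longlonglongrightarrow> 0"
  proof (rule Lim_null_comparison)
    show "\<forall>\<^sub>F N in sequentially. cmod (F z - (\<Sum>n<N. ip F (e n) * e n z))
       \<le> K * nrm (\<lambda>z. F z - (\<Sum>n<N. ip F (e n) * e n z))"
      using le by (intro always_eventually allI)
    show "(\<lambda>N. K * nrm (\<lambda>z. F z - (\<Sum>n<N. ip F (e n) * e n z))) \<longlonglongrightarrow> 0"
      using tendsto_mult_left[OF expansion_converges[OF F], of K] by simp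
  qed
  from tendsto_diff[OF tendsto_const[of "F z"] this] show ?thesis by (simp add: sums_def)
qed

end

section \<open>Geometric growth of regular points and masses\<close>

text \<open>
  The points \<open>s i\<close> are the spectral points in the order of increasing modulus and \<open>p i\<close> are their moduli,
  except that \<open>p 0\<close> may be larger than the modulus of \<open>s 0\<close>: one has to divide by it even if \<open>s 0 = 0\<close>. The
  conditions \<open>head_sum\<close> and \<open>tail_sum\<close> are the two halves of the regularity condition, the second for
  finite parts of the tail.
\<close>

locale regular_points =
  fixes s p \<nu> :: "nat \<Rightarrow> real" and c \<kappa> :: real
  assumes p_pos: "p i > 0" and p_mono: "i \<le> j \<Longrightarrow> p i \<le> p j"
    and s_le_p: "\<bar>s i\<bar> \<le> p i" and s_eq_p: "i \<ge> 1 \<Longrightarrow> \<bar>s i\<bar> = p i"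
    and \<nu>_pos: "\<nu> i > 0" and c_ge_1: "c \<ge> 1"
    and \<kappa>_pos: "\<kappa> > 0" and separated: "i < j \<Longrightarrow> \<bar>s j - s i\<bar> \<ge> \<kappa> * p j"
    and head_sum: "(\<Sum>i\<le>j. \<nu> i) \<le> c * \<nu> j"
    and tail_sum: "(\<Sum>i=Suc j..m. \<nu> i / (p i)\<^sup>2) \<le> c * (\<nu> j / (p j)\<^sup>2)"
begin

definition \<theta> :: real where "\<theta> = c / (1 + c)"

lemma \<theta>_pos: "\<theta> > 0" and \<theta>_less_1: "\<theta> < 1"
  using c_ge_1 by (auto simp: \<theta>_def)

text \<open>
  The head sums \<open>S j\<close> satisfy \<open>S (j + 1) \<le> c (S (j + 1) - S j)\<close>, so they grow at least by the factor \<open>1 / \<theta>\<close> in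
  each step, and \<open>\<nu> j\<close> is comparable to \<open>S j\<close>.
\<close>

lemma \<nu>_growth:
  assumes "i \<le> j" shows "\<nu> i \<le> (1 + c) * \<theta> ^ (j - i) * \<nu> j"
proof -
  define S where "S j = (\<Sum>i\<le>j. \<nu> i)" for j
  have S_step: "S j \<le> \<theta> * S (Suc j)" for j
  proof -
    have 1: "S (Suc j) = S j + \<nu> (Suc j)" by (simp add: S_def)
    have "S (Suc j) \<le> c * \<nu> (Suc j)" using head_sum[of "Suc j"] by (simp add: S_def)
    moreover have "S j \<le> S (Suc j)" using 1 \<nu>_pos[of "Suc j"] by linarith
    ultimately have "S j \<le> c * (S (Suc j) - S j)" using 1 by simp
    then have "(1 + c) * S j \<le> c * S (Suc j)" by (simp add: algebra_simps)
    then show ?thesis using c_ge_1 by (simp add: \<theta>_def field_simps)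
  qed
  have "S i \<le> \<theta> ^ (j - i) * S j"
    using assms
  proof (induction j rule: dec_induct)
    case (step j)
    have "S i \<le> \<theta> ^ (j - i) * S j" by fact
    also have "\<dots> \<le> \<theta> ^ (j - i) * (\<theta> * S (Suc j))"
      using S_step \<theta>_pos by (intro mult_left_mono) auto
    also have "\<dots> = \<theta> ^ (Suc j - i) * S (Suc j)" using step by (simp add: Suc_diff_le)
    finally show ?case .
  qed simp
  moreover have "\<nu> i \<le> S i" unfolding S_def using \<nu>_pos by (intro member_le_sum) (auto simp: less_imp_le)
  moreover have "\<theta> ^ (j - i) * S j \<le> \<theta> ^ (j - i) * (c * \<nu> j)"
    using head_sum[of j] \<theta>_pos by (intro mult_left_mono) (auto simp: S_def)
  moreover have "\<theta> ^ (j - i) * (c * \<nu> j) \<le> \<theta> ^ (j - i) * ((1 + c) * \<nu> j)"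
    using \<theta>_pos \<nu>_pos[of j] by (intro mult_left_mono) auto
  ultimately have "\<nu> i \<le> \<theta> ^ (j - i) * ((1 + c) * \<nu> j)" by linarith
  then show ?thesis by (simp add: mult.commute mult.left_commute)
qed

definition \<beta> :: "nat \<Rightarrow> real" where "\<beta> i = \<nu> i / (p i)\<^sup>2"

lemma \<beta>_tail_sum: "(\<Sum>i=Suc j..m. \<beta> i) \<le> c * \<beta> j"
  using tail_sum by (simp only: \<beta>_def)

lemma \<beta>_pos: "\<beta> i > 0" using \<nu>_pos[of i] p_pos[of i] by (simp add: \<beta>_def)

text \<open>
  The tails \<open>T k\<close> satisfy \<open>T (k + 1) \<le> c (T k - T (k + 1))\<close>, so they shrink at least by the factor \<open>\<theta>\<close> in each
  step, and \<open>\<beta> k\<close> is comparable to \<open>T k\<close>.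
\<close>

lemma \<beta>_decay:
  assumes "i \<le> j" shows "\<beta> j \<le> (1 + c) * \<theta> ^ (j - i) * \<beta> i"
proof -
  define T where "T k = (\<Sum>l=k..j. \<beta> l)" for k
  have T_step: "T (Suc k) \<le> \<theta> * T k" if "k \<le> j" for k
  proof -
    have 1: "T k = \<beta> k + T (Suc k)" using that by (simp add: T_def sum.atLeast_Suc_atMost)
    have "T (Suc k) \<le> c * \<beta> k" using \<beta>_tail_sum[where j = k and m = j] by (simp add: T_def)
    then have "(1 + c) * T (Suc k) \<le> c * T k" unfolding 1 by (simp add: algebra_simps)
    then show ?thesis using c_ge_1 by (simp add: \<theta>_def field_simps)
  qed
  have "T k \<le> \<theta> ^ (k - i) * T i" if "i \<le> k" "k \<le> j" for k
    using that
  proof (induction k rule: dec_induct)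
    case (step k)
    have "T (Suc k) \<le> \<theta> * T k" using T_step step by simp
    also have "\<dots> \<le> \<theta> * (\<theta> ^ (k - i) * T i)" using step \<theta>_pos by (intro mult_left_mono) auto
    also have "\<dots> = \<theta> ^ (Suc k - i) * T i" using step by (simp add: Suc_diff_le)
    finally show ?case .
  qed simp
  from this[of j] have "\<beta> j \<le> \<theta> ^ (j - i) * T i" using assms by (simp add: T_def)
  also have "T i \<le> (1 + c) * \<beta> i"
    using \<beta>_tail_sum[where j = i and m = j] assms by (simp add: T_def sum.atLeast_Suc_atMost algebra_simps)
  then have "\<theta> ^ (j - i) * T i \<le> \<theta> ^ (j - i) * ((1 + c) * \<beta> i)" using \<theta>_pos by (intro mult_left_mono) auto
  finally show ?thesis by (simp add: mult.commute mult.left_commute)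
qed

text \<open>
  \<open>(p i)\<^sup>2\<close> is the quotient of \<open>\<nu> i\<close>, which grows, and \<open>\<beta> i\<close>, which decays.
\<close>

lemma p_growth:
  assumes "i \<le> j" shows "p i \<le> (1 + c) * \<theta> ^ (j - i) * p j"
proof -
  let ?q = "(1 + c) * \<theta> ^ (j - i)"
  have q: "?q > 0" using c_ge_1 \<theta>_pos by simp
  have "\<nu> i * \<beta> j \<le> (?q * \<nu> j) * (?q * \<beta> i)"
    using \<nu>_growth[OF assms] \<beta>_decay[OF assms] \<nu>_pos \<beta>_pos q
    by (intro mult_mono) (auto simp: less_imp_le)
  also have "\<dots> = ?q\<^sup>2 * (p j)\<^sup>2 * (\<beta> j * \<beta> i)"
    using p_pos[of j] by (simp add: \<beta>_def power2_eq_square)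
  finally have "(p i)\<^sup>2 * (\<beta> i * \<beta> j) \<le> ?q\<^sup>2 * (p j)\<^sup>2 * (\<beta> i * \<beta> j)"
    using p_pos[of i] by (simp add: \<beta>_def mult.commute)
  then have "(p i)\<^sup>2 \<le> ?q\<^sup>2 * (p j)\<^sup>2" using \<beta>_pos[of i] \<beta>_pos[of j] by (metis mult_le_cancel_right_pos mult_pos_pos)
  then have "(p i)\<^sup>2 \<le> (?q * p j)\<^sup>2" by (simp add: power_mult_distrib)
  then show ?thesis by (rule power2_le_imp_le) (use q p_pos[of j] in auto)
qed

lemma \<beta>_partial_sums: "finite J \<Longrightarrow> (\<Sum>i\<in>J. \<beta> i) \<le> (1 + c) * \<beta> 0"
proof -
  assume J: "finite J"
  then obtain m where m: "J \<subseteq> {0..m}" using finite_nat_set_iff_bounded_le by (metis atLeast0AtMost atMost_iff subsetI)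
  have "(\<Sum>i\<in>J. \<beta> i) \<le> (\<Sum>i=0..m. \<beta> i)"
    using m \<beta>_pos by (intro sum_mono2) (auto simp: less_imp_le)
  also have "\<dots> = \<beta> 0 + (\<Sum>i=Suc 0..m. \<beta> i)" by (rule sum.atLeast_Suc_atMost) simp
  also have "\<dots> \<le> (1 + c) * \<beta> 0" using \<beta>_tail_sum[where j = 0 and m = m] by (simp add: algebra_simps)
  finally show ?thesis .
qed

text \<open>
  Two consecutive points may have the same modulus, as \<open>s\<close> and \<open>-s\<close>, but if all steps from some index on had
  a ratio below \<open>q = sqrt (1 / \<theta>)\<close>, then \<open>p\<close> would grow slower than with ratio \<open>1 / \<theta>\<close>.
\<close>

lemma p_frequent_gaps:
  obtains q where "q > 1" "\<And>N. \<exists>n\<ge>N. p (Suc n) \<ge> q * p n"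
proof -
  define q where "q = sqrt (1 / \<theta>)"
  have q: "q > 1" using \<theta>_pos \<theta>_less_1 by (simp add: q_def)
  have "\<exists>n\<ge>N. p (Suc n) \<ge> q * p n" for N
  proof (rule ccontr)
    assume "\<not> ?thesis"
    then have less: "p (Suc n) < q * p n" if "n \<ge> N" for n using that by force
    have up: "p (N + k) \<le> q ^ k * p N" for k
    proof (induction k)
      case (Suc k)
      have "p (N + Suc k) \<le> q * p (N + k)" using less[of "N + k"] by simp
      also have "\<dots> \<le> q * (q ^ k * p N)" using Suc q by (intro mult_left_mono) auto
      finally show ?case by (simp add: mult.assoc)
    qed simp
    have bound: "q ^ k \<le> 1 + c" for k
    proof -
      have "p N \<le> (1 + c) * \<theta> ^ k * p (N + k)" using p_growth[of N "N + k"] by simp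
      also have "\<dots> \<le> (1 + c) * \<theta> ^ k * (q ^ k * p N)"
        using up c_ge_1 \<theta>_pos by (intro mult_left_mono) auto
      finally have "1 * p N \<le> ((1 + c) * \<theta> ^ k * q ^ k) * p N" by (simp add: mult.assoc)
      then have "1 \<le> (1 + c) * \<theta> ^ k * q ^ k" using p_pos[of N] mult_le_cancel_right_pos by blast
      moreover have "\<theta> ^ k * q ^ k * q ^ k = 1"
      proof -
        have "\<theta> * q * q = 1" using \<theta>_pos by (simp add: q_def mult.assoc)
        then show ?thesis by (metis power_mult_distrib power_one)
      qed
      ultimately have "q ^ k \<le> (1 + c) * (\<theta> ^ k * q ^ k * q ^ k)"
        using q mult_right_mono[of 1 "(1 + c) * \<theta> ^ k * q ^ k" "q ^ k"] by (simp add: mult.assoc)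
      then show ?thesis using \<open>\<theta> ^ k * q ^ k * q ^ k = 1\<close> by simp
    qed
    obtain k where "1 + c < q ^ k" using real_arch_pow[OF q] by blast
    then show False using bound[of k] by linarith
  qed
  then show ?thesis using q that by blast
qed

end

section \<open>The generating function and its partial products\<close>

text \<open>
  The function \<open>g / (2M - g)\<close>, rescaled to the unit disc, maps the disc into itself and vanishes at zero, so
  Schwarz's lemma applies to it.
\<close>

lemma borel_caratheodory:
  assumes hol: "g holomorphic_on ball 0 r" and g0: "g 0 = 0"
    and less: "\<And>z. cmod z < r \<Longrightarrow> Re (g z) < M" and M: "M > 0" and z: "cmod z < r"
  shows "cmod (g z) \<le> 2 * M * cmod z / (r - cmod z)"
proof -
  have r: "r > 0" using z norm_ge_zero[of z] by linarith
  define w where "w u = g (of_real r * u) / (2 * of_real M - g (of_real r * u))" for u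
  have in_ball: "cmod (of_real r * u) < r" if "cmod u < 1" for u
    using that r by (simp add: norm_mult)
  have ne: "2 * of_real M - g (of_real r * u) \<noteq> 0" if "cmod u < 1" for u
  proof
    assume "2 * of_real M - g (of_real r * u) = 0"
    then have "Re (g (of_real r * u)) = 2 * M" by (simp add: complex_eq_iff)
    then show False using less[OF in_ball[OF that]] M by linarith
  qed
  have "(g \<circ> (\<lambda>u. of_real r * u)) holomorphic_on ball 0 1"
    by (rule holomorphic_on_compose_gen[OF _ hol]) (use in_ball in \<open>auto intro!: holomorphic_intros\<close>)
  then have holw: "w holomorphic_on ball 0 1"
    unfolding w_def using ne by (intro holomorphic_intros) (auto simp: o_def)
  have w_less: "cmod (w u) < 1" if u: "cmod u < 1" for u
  proof -
    let ?v = "g (of_real r * u)"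
    have "(cmod ?v)\<^sup>2 < (cmod (2 * of_real M - ?v))\<^sup>2"
    proof -
      have "0 < 4 * M * (M - Re ?v)" using less[OF in_ball[OF u]] M by simp
      also have "\<dots> = (cmod (2 * of_real M - ?v))\<^sup>2 - (cmod ?v)\<^sup>2"
        unfolding cmod_power2 by (simp add: power2_eq_square algebra_simps)
      finally show ?thesis by simp
    qed
    then have "cmod ?v < cmod (2 * of_real M - ?v)" by (rule power_less_imp_less_base) simp
    then show ?thesis using ne[OF u] by (simp add: w_def norm_divide)
  qed
  define u where "u = z / of_real r"
  have u: "cmod u < 1" "of_real r * u = z" "cmod u = cmod z / r" using z r by (auto simp: u_def norm_divide)
  have "w 0 = 0" using g0 by (simp add: w_def)
  from Schwarz_Lemma(1)[OF holw this w_less u(1)] have le: "cmod (w u) \<le> cmod u" .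
  have "w u * (2 * of_real M - g z) = g z" using ne[OF u(1)] by (simp add: w_def u(2))
  then have "cmod (g z) = cmod (w u) * cmod (2 * of_real M - g z)" by (metis norm_mult)
  also have "\<dots> \<le> cmod u * (2 * M + cmod (g z))"
    using le norm_triangle_ineq4[of "2 * of_real M" "g z"] M by (intro mult_mono) (auto simp: norm_mult)
  finally have "cmod (g z) * r \<le> cmod z * (2 * M + cmod (g z))"
    using r by (simp add: u(3) field_simps)
  then have "cmod (g z) * (r - cmod z) \<le> 2 * M * cmod z" by (simp add: algebra_simps)
  then show ?thesis using z by (simp add: pos_le_divide_eq)
qed

lemma log_square_sublinear:
  fixes k L C :: real
  assumes k: "k > 0" and L: "L > 0"
  shows "((\<lambda>x. (C + (ln (k * x) / L + 1) * ln (k * x)) / x) \<longlongrightarrow> 0) at_top"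
proof -
  have lim: "((\<lambda>x::real. (ln x) ^ m / x) \<longlongrightarrow> 0) at_top" for m :: nat
  proof -
    have "((\<lambda>x. (ln x) ^ m / exp (ln x)) \<longlongrightarrow> (0::real)) at_top"
      by (rule filterlim_compose[OF tendsto_power_div_exp_0 ln_at_top])
    then show ?thesis
    proof (rule Lim_transform_eventually)
      show "\<forall>\<^sub>F x::real in at_top. ln x ^ m / exp (ln x) = ln x ^ m / x"
        using eventually_gt_at_top[of 0] by eventually_elim simp
    qed
  qed
  have "((\<lambda>x. C * (ln x ^ 0 / x) + ((ln x)\<^sup>2 / x / L + (ln x) ^ 1 / x)) \<longlongrightarrow> C * 0 + (0 / L + 0)) at_top"
    by (intro tendsto_intros lim) (use L in auto)
  then have "((\<lambda>x. (C + (ln x / L + 1) * ln x) / x) \<longlongrightarrow> 0) at_top"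
    by (simp add: add_divide_distrib distrib_right power2_eq_square mult.commute[of L])
  moreover have "filterlim (\<lambda>x. k * x) at_top at_top"
    using k by (simp add: filterlim_tendsto_pos_mult_at_top[OF tendsto_const] filterlim_ident)
  ultimately have "((\<lambda>x. (C + (ln (k * x) / L + 1) * ln (k * x)) / (k * x)) \<longlongrightarrow> 0) at_top"
    by (rule filterlim_compose)
  from tendsto_mult_left[OF this, of k] show ?thesis using k by simp
qed

locale spectral_basis = de_Branges_basis E e + regular_points s p \<nu> c \<kappa>
  for E :: "complex \<Rightarrow> complex" and e :: "nat \<Rightarrow> complex \<Rightarrow> complex"
    and s p \<nu> :: "nat \<Rightarrow> real" and c \<kappa> :: real +
  fixes A :: "complex \<Rightarrow> complex"
  assumes entire_A: "entire A" and A_zeros: "{z. A z = 0} = range (\<lambda>n. of_real (s n))"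
    and deriv_A: "deriv A (of_real (s n)) \<noteq> 0"
    and e_eq: "e n z = of_real (sqrt (\<nu> n)) *
       (if z = of_real (s n) then deriv A z else A z / (z - of_real (s n)))"
begin

lemma A_s [simp]: "A (of_real (s n)) = 0"
  using A_zeros by auto

lemma s_inj: "i \<noteq> j \<Longrightarrow> s i \<noteq> s j"
proof -
  have "s i \<noteq> s j" if "i < j" for i j
  proof -
    have "0 < \<kappa> * p j" using \<kappa>_pos p_pos by simp
    then show ?thesis using separated[OF that] by auto
  qed
  then show "i \<noteq> j \<Longrightarrow> s i \<noteq> s j" by (metis linorder_neqE_nat)
qed

text \<open>
  Dividing by \<open>p i\<close> rather than by \<open>- s i\<close> keeps the factor meaningful if \<open>s i = 0\<close>; its modulus at zero is
  \<open>1\<close> for \<open>i \<ge> 1\<close>.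
\<close>

definition fac :: "nat \<Rightarrow> complex \<Rightarrow> complex" where
  "fac i z = (z - of_real (s i)) / of_real (p i)"

lemma fac_eq_0_iff: "fac i z = 0 \<longleftrightarrow> z = of_real (s i)"
  using p_pos[of i] by (simp add: fac_def)

lemma holomorphic_fac [holomorphic_intros]: "fac i holomorphic_on S"
  unfolding fac_def using p_pos[of i] by (intro holomorphic_intros) auto

text \<open>
  What remains of \<open>A\<close> after division by the first \<open>N\<close> factors. The value at \<open>s N\<close> is the removable one.
\<close>

fun cofactor :: "nat \<Rightarrow> complex \<Rightarrow> complex" where
  "cofactor 0 = A"
| "cofactor (Suc N) = (\<lambda>z. if z = of_real (s N) then of_real (p N) * deriv (cofactor N) z
                           else cofactor N z / fac N z)"

lemma cofactor:
  shows entire_cofactor: "entire (cofactor N)" and A_factor: "A z = (\<Prod>i<N. fac i z) * cofactor N z"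
    and cofactor_step: "cofactor N z = fac N z * cofactor (Suc N) z"
proof -
  have zero: "cofactor N (of_real (s N)) = 0" if "\<And>z. A z = (\<Prod>i<N. fac i z) * cofactor N z" for N
  proof -
    have "(\<Prod>i<N. fac i (of_real (s N))) * cofactor N (of_real (s N)) = 0"
      using that[of "of_real (s N)"] by simp
    moreover have "(\<Prod>i<N. fac i (of_real (s N))) \<noteq> 0"
      using s_inj by (auto simp: fac_eq_0_iff)
    ultimately show ?thesis by simp
  qed
  have step: "cofactor N z = fac N z * cofactor (Suc N) z" if "cofactor N (of_real (s N)) = 0" for N z
    using that by (cases "z = of_real (s N)") (auto simp: fac_eq_0_iff)
  have *: "entire (cofactor N) \<and> (\<forall>z. A z = (\<Prod>i<N. fac i z) * cofactor N z)" for N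
  proof (induction N)
    case 0 then show ?case using entire_A by simp
  next
    case (Suc N)
    then have z: "cofactor N (of_real (s N)) = 0" using zero by blast
    have "(\<lambda>z. if z = of_real (s N) then deriv (cofactor N) (of_real (s N))
             else (cofactor N z - cofactor N (of_real (s N))) / (z - of_real (s N))) holomorphic_on UNIV"
      using Suc by (intro pole_lemma) (auto simp: entire_def)
    then have "(\<lambda>z. of_real (p N) * (if z = of_real (s N) then deriv (cofactor N) (of_real (s N))
             else (cofactor N z - cofactor N (of_real (s N))) / (z - of_real (s N)))) holomorphic_on UNIV"
      by (intro holomorphic_intros)
    then have "cofactor (Suc N) holomorphic_on UNIV"
      by (rule holomorphic_transform) (auto simp: z fac_def)
    moreover have "A w = (\<Prod>i<Suc N. fac i w) * cofactor (Suc N) w" for w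
      using Suc step[OF z, of w] by (metis mult.assoc prod.lessThan_Suc)
    ultimately show ?case by (metis entire_def)
  qed
  show "entire (cofactor N)" "A z = (\<Prod>i<N. fac i z) * cofactor N z" using * by auto
  show "cofactor N z = fac N z * cofactor (Suc N) z" by (rule step[OF zero]) (use * in auto)
qed

text \<open>
  Up to a constant this is the reproducing kernel of the space at the point \<open>s n\<close>.
\<close>

definition kernel :: "nat \<Rightarrow> complex \<Rightarrow> complex" where
  "kernel n z = (if z = of_real (s n) then deriv A z else A z / (z - of_real (s n)))"

lemma e_kernel: "e n z = of_real (sqrt (\<nu> n)) * kernel n z"
  by (simp add: e_eq kernel_def)

lemma kernel_factor:
  assumes "n < N"
  shows "kernel n z = (\<Prod>i\<in>{..<N} - {n}. fac i z) * cofactor N z / of_real (p n)"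
proof -
  define X where "X z = (\<Prod>i\<in>{..<N} - {n}. fac i z) * cofactor N z / of_real (p n)" for z
  have AX: "A z = (z - of_real (s n)) * X z" for z
  proof -
    have "(\<Prod>i<N. fac i z) = fac n z * (\<Prod>i\<in>{..<N} - {n}. fac i z)"
      using assms by (intro prod.remove) auto
    then show ?thesis using A_factor[of z N] by (simp add: X_def fac_def)
  qed
  show ?thesis
  proof (cases "z = of_real (s n)")
    case True
    have "X holomorphic_on UNIV" unfolding X_def
      by (intro holomorphic_intros entire_imp_holomorphic entire_cofactor) (use p_pos[of n] in auto)
    then have "(X has_field_derivative deriv X z) (at z)" by (simp add: holomorphic_derivI)
    then have "((\<lambda>z. (z - of_real (s n)) * X z) has_field_derivative X z) (at z)"
      by (auto intro!: derivative_eq_intros simp: True)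
    moreover have "(\<lambda>z. (z - of_real (s n)) * X z) = A" using AX by auto
    ultimately have "(A has_field_derivative X z) (at z)" by simp
    then have "deriv A z = X z" by (rule DERIV_imp_deriv)
    then show ?thesis using True by (simp add: kernel_def X_def)
  next
    case False
    then show ?thesis using AX[of z] by (simp add: kernel_def X_def)
  qed
qed

text \<open>
  The zeros of \<open>A\<close> are simple, so each of the first \<open>N\<close> factors uses up its zero completely.
\<close>

lemma cofactor_nonzero:
  assumes "\<And>n. n \<ge> N \<Longrightarrow> z \<noteq> of_real (s n)" shows "cofactor N z \<noteq> 0"
proof
  assume 0: "cofactor N z = 0"
  then have "A z = 0" using A_factor[of z N] by simp
  then obtain n where n: "z = of_real (s n)" using A_zeros by auto
  then have "n < N" using assms[of n] by (meson not_less)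
  from kernel_factor[OF this, of z] have "kernel n z = 0" using 0 by simp
  then show False using deriv_A n by (simp add: kernel_def)
qed

definition a\<^sub>0 :: real where "a\<^sub>0 = cmod (cofactor 1 0)"

lemma s_ne_0: "n \<ge> 1 \<Longrightarrow> s n \<noteq> 0"
  using s_eq_p[of n] p_pos[of n] by auto

lemma a\<^sub>0_pos: "a\<^sub>0 > 0"
  using cofactor_nonzero[of 1 0] s_ne_0 unfolding a\<^sub>0_def by (metis of_real_0 of_real_eq_iff zero_less_norm_iff)

lemma cofactor_at_0:
  assumes "N \<ge> 1" shows "cmod (cofactor N 0) = a\<^sub>0"
  using assms
proof (induction N rule: dec_induct)
  case (step N)
  have "cmod (fac N 0) = 1" using s_eq_p[of N] step p_pos[of N] by (simp add: fac_def norm_divide)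
  then have "cmod (cofactor N 0) = cmod (cofactor (Suc N) 0)"
    using cofactor_step[of N 0] by (simp only: norm_mult mult_1)
  then show ?case using step by simp
qed (simp only: a\<^sub>0_def)

text \<open>
  The expansion of the constant function \<open>1\<close> in the basis, divided by \<open>A\<close>, represents \<open>1 / A\<close> as a sum of
  simple fractions. If \<open>|z - s n| \<ge> \<eta> p n\<close>, the Cauchy-Schwarz inequality bounds this sum by the norm of \<open>1\<close> and
  the square root of the sum of the \<open>\<beta> n\<close>.
\<close>

lemma A_lower_bound_off_zeros:
  obtains D where "D > 0"
    "\<And>z \<eta>. \<eta> > 0 \<Longrightarrow> (\<And>n. cmod (z - of_real (s n)) \<ge> \<eta> * p n) \<Longrightarrow> 1 \<le> D / \<eta> * cmod (A z)"
proof -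
  have oneH: "(\<lambda>_. 1) \<in> H" using polynomials[of 1] by (simp add: poly_1[abs_def])
  define D where "D = nrm (\<lambda>_. 1) * sqrt ((1 + c) * \<beta> 0) + 1"
  have sq0: "(1 + c) * \<beta> 0 > 0" using c_ge_1 \<beta>_pos by simp
  have D: "D > 0" using nrm_nonneg[of "\<lambda>_. 1"] sq0 by (simp add: D_def add_nonneg_pos)
  moreover have "1 \<le> D / \<eta> * cmod (A z)"
    if \<eta>: "\<eta> > 0" and far: "\<And>n. cmod (z - of_real (s n)) \<ge> \<eta> * p n" for z \<eta>
  proof -
    have e_le: "(cmod (e n z))\<^sup>2 \<le> \<beta> n * (cmod (A z) / \<eta>)\<^sup>2" for n
    proof -
      have pos: "0 < \<eta> * p n" using \<eta> p_pos by simp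
      then have "z \<noteq> of_real (s n)" using far[of n] by auto
      then have "(cmod (e n z))\<^sup>2 = \<nu> n * (cmod (A z) / cmod (z - of_real (s n)))\<^sup>2"
        using \<nu>_pos[of n] by (simp add: e_kernel kernel_def norm_mult norm_divide power_mult_distrib power_divide)
      also have "\<dots> \<le> \<nu> n * (cmod (A z) / (\<eta> * p n))\<^sup>2"
        using \<nu>_pos[of n] pos far[of n]
        by (intro mult_left_mono power_mono divide_left_mono) (auto intro!: mult_pos_pos)
      also have "\<dots> = \<beta> n * (cmod (A z) / \<eta>)\<^sup>2"
        by (simp add: \<beta>_def power_divide power_mult_distrib)
      finally show ?thesis .
    qed
    have part: "cmod (\<Sum>n<N. ip (\<lambda>_. 1) (e n) * e n z) \<le> D / \<eta> * cmod (A z)" for N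
    proof -
      let ?\<alpha> = "\<lambda>n. cmod (ip (\<lambda>_. 1) (e n))"
      have "(cmod (\<Sum>n<N. ip (\<lambda>_. 1) (e n) * e n z))\<^sup>2 \<le> (\<Sum>n<N. ?\<alpha> n * cmod (e n z))\<^sup>2"
        by (intro power_mono sum_norm_le) (auto simp: norm_mult)
      also have "\<dots> \<le> (\<Sum>n<N. (?\<alpha> n)\<^sup>2) * (\<Sum>n<N. (cmod (e n z))\<^sup>2)"
        by (rule Cauchy_Schwarz_ineq_sum)
      also have "\<dots> \<le> (nrm (\<lambda>_. 1))\<^sup>2 * (((1 + c) * \<beta> 0) * (cmod (A z) / \<eta>)\<^sup>2)"
      proof (intro mult_mono)
        show "(\<Sum>n<N. (?\<alpha> n)\<^sup>2) \<le> (nrm (\<lambda>_. 1))\<^sup>2" by (rule bessel[OF oneH]) simp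
        have "(\<Sum>n<N. (cmod (e n z))\<^sup>2) \<le> (\<Sum>n<N. \<beta> n * (cmod (A z) / \<eta>)\<^sup>2)"
          by (intro sum_mono e_le)
        also have "\<dots> \<le> ((1 + c) * \<beta> 0) * (cmod (A z) / \<eta>)\<^sup>2"
          unfolding sum_distrib_right[symmetric] by (intro mult_right_mono \<beta>_partial_sums) auto
        finally show "(\<Sum>n<N. (cmod (e n z))\<^sup>2) \<le> ((1 + c) * \<beta> 0) * (cmod (A z) / \<eta>)\<^sup>2" .
      qed (auto intro: sum_nonneg)
      also have "\<dots> = (nrm (\<lambda>_. 1) * sqrt ((1 + c) * \<beta> 0) * (cmod (A z) / \<eta>))\<^sup>2"
        using sq0 by (simp only: power_mult_distrib real_sqrt_pow2[OF less_imp_le] mult.assoc)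
      finally have "cmod (\<Sum>n<N. ip (\<lambda>_. 1) (e n) * e n z) \<le> nrm (\<lambda>_. 1) * sqrt ((1 + c) * \<beta> 0) * (cmod (A z) / \<eta>)"
        by (rule power2_le_imp_le) (use nrm_nonneg \<eta> sq0 in auto)
      also have "\<dots> \<le> D * (cmod (A z) / \<eta>)" using \<eta> by (intro mult_right_mono) (auto simp: D_def)
      finally show ?thesis by simp
    qed
    have "(\<lambda>N. cmod (\<Sum>n<N. ip (\<lambda>_. 1) (e n) * e n z)) \<longlonglongrightarrow> cmod 1"
      using expansion[OF oneH, of z] unfolding sums_def by (rule tendsto_norm)
    then have "cmod 1 \<le> D / \<eta> * cmod (A z)"
      by (rule LIMSEQ_le_const2) (use part in blast)
    then show ?thesis by simp
  qed
  ultimately show ?thesis using that by blast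
qed

lemma p_tends_to_infinity: "\<exists>N. \<forall>n\<ge>N. p n \<ge> R"
proof -
  obtain n where n: "(1 + c) * R / p 0 < (1 / \<theta>) ^ n"
    using real_arch_pow[of "1 / \<theta>" "(1 + c) * R / p 0"] \<theta>_pos \<theta>_less_1 by auto
  have "p 0 \<le> (1 + c) * \<theta> ^ n * p n" using p_growth[of 0 n] by simp
  then have "(1 / \<theta>) ^ n * p 0 \<le> (1 + c) * p n"
    using \<theta>_pos by (simp add: power_divide field_simps)
  moreover have "(1 + c) * R < (1 / \<theta>) ^ n * p 0"
    using n p_pos[of 0] by (simp only: pos_divide_less_eq)
  ultimately have "(1 + c) * R < (1 + c) * p n" by linarith
  then have "R < p n" using c_ge_1 by simp
  then show ?thesis using p_mono by (meson less_imp_le order_trans)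
qed

text \<open>
  Let \<open>r\<close> lie in the middle of a gap between \<open>p n\<close> and \<open>p N\<close>, where \<open>N = n + 1\<close>. Then the cofactor has no zeros for
  \<open>|z| \<le> r\<close>. On the circle \<open>|z| = r\<close>, \<open>1 / A\<close> is bounded by a constant, and the product of the first \<open>N\<close> factors by
  the \<open>N\<close>-th power of \<open>2r / p 0\<close>. As \<open>p\<close> grows geometrically, \<open>N\<close> is of order \<open>log r\<close>. So the logarithm of
  \<open>|cofactor N 0 / cofactor N z|\<close> is at most of order \<open>log\<^sup>2 r\<close> on the disc. This is small against \<open>r\<close>, and the
  Borel-Caratheodory inequality shows that the logarithm is small on the fixed disc \<open>|z| \<le> \<rho>\<close>.
\<close>

lemma cofactor_nearly_constant:
  assumes \<rho>: "\<rho> > 0"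
  obtains N where "N \<ge> N\<^sub>0" "N \<ge> 1" "\<And>z. cmod z \<le> \<rho> \<Longrightarrow> a\<^sub>0 / 2 \<le> cmod (cofactor N z) \<and> cmod (cofactor N z) \<le> 2 * a\<^sub>0"
proof -
  obtain q where q: "q > 1" and gaps: "\<And>N. \<exists>n\<ge>N. p (Suc n) \<ge> q * p n" using p_frequent_gaps by blast
  obtain D where D: "D > 0" and lower: "\<And>z \<eta>. \<eta> > 0 \<Longrightarrow> (\<And>n. cmod (z - of_real (s n)) \<ge> \<eta> * p n) \<Longrightarrow> 1 \<le> D / \<eta> * cmod (A z)"
    using A_lower_bound_off_zeros by blast
  define \<eta> where "\<eta> = (1 - 1 / q) / 2"
  have \<eta>: "\<eta> > 0" using q by (simp add: \<eta>_def)
  define k where "k = 2 * (1 + c) / p 0"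
  define L where "L = ln (1 / \<theta>)"
  define C where "C = ln (a\<^sub>0 * D / \<eta>) + 1"
  have k: "k > 0" using c_ge_1 p_pos[of 0] by (simp add: k_def)
  have L: "L > 0" using \<theta>_pos \<theta>_less_1 by (simp add: L_def)
  \<comment> \<open>Q r will bound the logarithm: ln (k r) / L + 1 bounds N, and ln (k r) bounds the logarithm of 2 r / p 0\<close>
  define Q where "Q x = C + (ln (k * x) / L + 1) * ln (k * x)" for x
  have "((\<lambda>x. Q x / x) \<longlongrightarrow> 0) at_top"
    unfolding Q_def by (rule log_square_sublinear[OF k L])
  then have "\<forall>\<^sub>F x in at_top. Q x / x < ln 2 / (4 * \<rho>)"
    by (rule order_tendstoD) (use \<rho> in auto)
  then have "\<forall>\<^sub>F x in at_top. Q x / x < ln 2 / (4 * \<rho>) \<and> x > 2 * \<rho>"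
    using eventually_gt_at_top eventually_conj by blast
  then obtain R where R: "\<And>x. x \<ge> R \<Longrightarrow> Q x / x < ln 2 / (4 * \<rho>) \<and> x > 2 * \<rho>"
    unfolding eventually_at_top_linorder by blast
  obtain N1 where N1: "\<And>n. n \<ge> N1 \<Longrightarrow> p n \<ge> R" using p_tends_to_infinity by blast
  obtain n where n: "n \<ge> max N\<^sub>0 N1" "p (Suc n) \<ge> q * p n" using gaps by blast
  define N where "N = Suc n"
  define r where "r = (p n + p N) / 2"
  have gap: "p N \<ge> q * p n" using n by (simp add: N_def)
  have pn_less: "p n < p N" using gap mult_strict_right_mono[OF q p_pos[of n]] by linarith
  have r: "p n < r" "r < p N" using pn_less by (auto simp: r_def)
  have "r \<ge> R" using N1[of n] n r by simp
  then have Qr: "Q r / r < ln 2 / (4 * \<rho>)" and r2: "r > 2 * \<rho>" using R by auto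
  have r0: "r > 0" using r2 \<rho> by linarith
  have far: "cmod (z - of_real (s i)) \<ge> \<eta> * p i" if z: "cmod z = r" for z i
  proof (cases "i \<le> n")
    case True
    have "\<eta> * p i \<le> \<eta> * p n" using \<eta> p_mono[OF True] by simp
    also have "\<dots> \<le> (q - 1) / 2 * p n"
      using q p_pos[of n] zero_le_square[of "q - 1"]
      by (intro mult_right_mono) (auto simp: \<eta>_def field_simps)
    also have "\<dots> = (q * p n - p n) / 2" by (simp add: algebra_simps)
    also have "\<dots> \<le> r - p n" using gap by (simp add: r_def field_simps)
    also have "\<dots> \<le> r - \<bar>s i\<bar>" using s_le_p[of i] p_mono[OF True] by linarith
    also have "\<dots> \<le> cmod (z - of_real (s i))" using norm_triangle_ineq2[of z "of_real (s i)"] z by simp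
    finally show ?thesis .
  next
    case False
    then have i: "i \<ge> N" "i \<ge> 1" by (auto simp: N_def)
    have "p n \<le> p N / q" using gap q by (simp add: field_simps)
    then have "r \<le> (p N / q + p N) / 2" unfolding r_def by (intro divide_right_mono add_right_mono) auto
    also have "\<dots> = (1 + 1 / q) / 2 * p N" by (simp add: algebra_simps add_divide_distrib)
    also have "\<dots> \<le> (1 + 1 / q) / 2 * p i" using q p_mono[OF i(1)] by (intro mult_left_mono) auto
    finally have "\<eta> * p i \<le> p i - r" by (simp add: \<eta>_def field_simps)
    also have "\<dots> = \<bar>s i\<bar> - r" using s_eq_p[OF i(2)] by simp
    also have "\<dots> \<le> cmod (z - of_real (s i))" using norm_triangle_ineq3[of z "of_real (s i)"] z by (simp add: abs_if split: if_splits)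
    finally show ?thesis .
  qed
  have nz: "cofactor N z \<noteq> 0" if "cmod z \<le> r" for z
  proof (rule cofactor_nonzero)
    fix i assume i: "i \<ge> N"
    then have "\<bar>s i\<bar> = p i" by (intro s_eq_p) (simp add: N_def)
    then have "\<bar>s i\<bar> > r" using p_mono[OF i] r by linarith
    then show "z \<noteq> of_real (s i)" using that by auto
  qed
  define h where "h z = cofactor N 0 / cofactor N z" for z
  define M where "M = ln (a\<^sub>0 * D / \<eta>) + real N * ln (2 * r / p 0) + 1"
  have p0r: "p 0 \<le> r" using p_mono[of 0 n] r by simp
  have x1: "1 \<le> 2 * r / p 0" using p0r p_pos[of 0] r0 by (simp add: field_simps)
  have on_circle: "cmod (h z) \<le> a\<^sub>0 * D / \<eta> * (2 * r / p 0) ^ N" if z: "cmod z = r" for z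
  proof -
    have 1: "1 \<le> D / \<eta> * cmod (A z)" using lower[OF \<eta> far[OF z]] .
    have "cmod (\<Prod>i<N. fac i z) = (\<Prod>i<N. cmod (fac i z))" by (simp add: prod_norm)
    also have "\<dots> \<le> (\<Prod>i<N. 2 * r / p 0)"
    proof (rule prod_mono)
      fix i assume "i \<in> {..<N}"
      then have "i \<le> n" by (simp add: N_def)
      have "cmod (z - of_real (s i)) \<le> 2 * r"
        using norm_triangle_ineq4[of z "of_real (s i)"] z s_le_p[of i] p_mono[OF \<open>i \<le> n\<close>] r by simp
      then have "cmod (z - of_real (s i)) / p i \<le> 2 * r / p 0"
        using p_mono[of 0 i] p_pos[of 0] r0 by (intro frac_le) auto
      then show "0 \<le> cmod (fac i z) \<and> cmod (fac i z) \<le> 2 * r / p 0"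
        using p_pos[of i] by (simp add: fac_def norm_divide)
    qed
    finally have 2: "cmod (\<Prod>i<N. fac i z) \<le> (2 * r / p 0) ^ N" by simp
    have "1 \<le> D / \<eta> * (cmod (\<Prod>i<N. fac i z) * cmod (cofactor N z))"
      using 1 A_factor[of z N] by (simp only: norm_mult)
    also have "\<dots> \<le> D / \<eta> * ((2 * r / p 0) ^ N * cmod (cofactor N z))"
      using 2 D \<eta> by (intro mult_left_mono mult_right_mono) auto
    finally have "1 / cmod (cofactor N z) \<le> D / \<eta> * (2 * r / p 0) ^ N"
      using nz[of z] z by (simp add: pos_divide_le_eq mult.assoc)
    then have "a\<^sub>0 * (1 / cmod (cofactor N z)) \<le> a\<^sub>0 * (D / \<eta> * (2 * r / p 0) ^ N)"
      using a\<^sub>0_pos by (intro mult_left_mono) auto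
    then show ?thesis using cofactor_at_0[of N] by (simp add: h_def norm_divide N_def del: cofactor.simps)
  qed
  have holh: "h holomorphic_on cball 0 r"
    unfolding h_def using nz by (intro holomorphic_intros entire_imp_holomorphic entire_cofactor) auto
  have inside: "cmod (h z) \<le> a\<^sub>0 * D / \<eta> * (2 * r / p 0) ^ N" if z: "cmod z \<le> r" for z
  proof (rule maximum_modulus_frontier[of h "cball 0 r"])
    show "h holomorphic_on interior (cball 0 r)" "continuous_on (closure (cball 0 r)) h"
      using holh by (auto intro: holomorphic_on_subset holomorphic_on_imp_continuous_on)
  qed (use on_circle z r0 in \<open>auto simp: frontier_cball\<close>)
  have pos: "a\<^sub>0 * D / \<eta> > 0" using a\<^sub>0_pos D \<eta> by simp
  have "a\<^sub>0 * D / \<eta> * (2 * r / p 0) ^ N = exp (ln (a\<^sub>0 * D / \<eta>) + real N * ln (2 * r / p 0))"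
    using pos x1 by (simp add: exp_add exp_of_nat_mult)
  also have "\<dots> < exp M" by (simp add: M_def)
  finally have less_M: "cmod (h z) < exp M" if "cmod z \<le> r" for z using inside[OF that] by linarith
  have h0: "h 0 = 1" using nz[of 0] r0 by (simp add: h_def)
  have h_nz: "h z \<noteq> 0" if "cmod z \<le> r" for z using nz[OF that] nz[of 0] r0 by (simp add: h_def)
  have M0: "M > 0" using less_M[of 0] h0 r0 by (simp add: one_less_exp_iff)
  obtain g where g: "g holomorphic_on ball 0 r" "\<And>z. z \<in> ball 0 r \<Longrightarrow> exp (g z) = h z"
    using holomorphic_logarithm_exists[of "ball 0 r" h 0] h_nz r0 holh
    by (auto intro: holomorphic_on_subset[OF _ ball_subset_cball])
  \<comment> \<open>g 0 is a multiple of 2 pi i, so subtracting it leaves a logarithm of h\<close>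
  define g1 where "g1 z = g z - g 0" for z
  have exp_g1: "exp (g1 z) = h z" if "cmod z < r" for z
    using g(2)[of z] g(2)[of 0] that r0 h0 by (simp add: g1_def exp_diff)
  have cmod_h: "cmod (h z) = exp (Re (g1 z))" if "cmod z < r" for z
    using exp_g1[OF that] by (metis norm_exp_eq_Re)
  have "cmod (g1 z) \<le> 2 * M * cmod z / (r - cmod z)" if "cmod z < r" for z
  proof (rule borel_caratheodory[OF _ _ _ M0 that])
    show "g1 holomorphic_on ball 0 r" unfolding g1_def by (intro holomorphic_intros g)
    show "g1 0 = 0" by (simp add: g1_def)
    show "Re (g1 z) < M" if "cmod z < r" for z
      using less_M[of z] cmod_h[OF that] that by simp
  qed
  note bc = this
  have MQ: "M \<le> Q r"
  proof -
    have "p 0 \<le> (1 + c) * \<theta> ^ n * p n" using p_growth[of 0 n] by simp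
    also have "\<dots> \<le> (1 + c) * \<theta> ^ n * r" using r c_ge_1 \<theta>_pos by (intro mult_left_mono) auto
    finally have "(1 / \<theta>) ^ n \<le> (1 + c) * r / p 0"
      using \<theta>_pos p_pos[of 0] by (simp add: power_divide field_simps)
    also have "\<dots> \<le> k * r" using r0 c_ge_1 p_pos[of 0] by (simp add: k_def field_simps)
    finally have "ln ((1 / \<theta>) ^ n) \<le> ln (k * r)" using \<theta>_pos k r0 by (subst ln_le_cancel_iff) auto
    then have "real n * L \<le> ln (k * r)" using \<theta>_pos by (simp add: L_def ln_realpow)
    then have 1: "real N \<le> ln (k * r) / L + 1" using L by (simp add: N_def field_simps)
    have "2 * r / p 0 \<le> k * r" using r0 c_ge_1 p_pos[of 0] by (simp add: k_def field_simps)
    then have 2: "ln (2 * r / p 0) \<le> ln (k * r)" using x1 k r0 by (subst ln_le_cancel_iff) auto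
    have "real N * ln (2 * r / p 0) \<le> (ln (k * r) / L + 1) * ln (k * r)"
      using 1 2 x1 by (intro mult_mono) (auto intro: order_trans[OF of_nat_0_le_iff 1])
    then show ?thesis by (simp add: M_def Q_def C_def)
  qed
  have "a\<^sub>0 / 2 \<le> cmod (cofactor N z) \<and> cmod (cofactor N z) \<le> 2 * a\<^sub>0" if z: "cmod z \<le> \<rho>" for z
  proof -
    have zr: "cmod z < r" using z r2 \<rho> by linarith
    have "M \<le> ln 2 / (4 * \<rho>) * r" using MQ Qr r0 by (simp add: field_simps)
    then have M': "2 * M * \<rho> \<le> ln 2 * (r / 2)" using \<rho> by (simp add: field_simps)
    have "cmod (g1 z) \<le> 2 * M * cmod z / (r - cmod z)" by (rule bc[OF zr])
    also have "\<dots> \<le> 2 * M * \<rho> / (r / 2)" using z r2 \<rho> M0 by (intro frac_le mult_left_mono) auto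
    also have "\<dots> \<le> ln 2" using M' r0 by (simp add: pos_divide_le_eq)
    finally have "\<bar>Re (g1 z)\<bar> \<le> ln 2" using abs_Re_le_cmod order_trans by blast
    then have "- ln 2 \<le> Re (g1 z)" "Re (g1 z) \<le> ln 2" by (auto simp: abs_le_iff)
    then have "exp (- ln 2) \<le> exp (Re (g1 z))" "exp (Re (g1 z)) \<le> exp (ln 2)" by (simp_all only: exp_le_cancel_iff)
    then have "1 / 2 \<le> cmod (h z)" "cmod (h z) \<le> 2" using cmod_h[OF zr] by (auto simp: exp_minus)
    moreover have "cmod (h z) * cmod (cofactor N z) = a\<^sub>0"
      using cofactor_at_0[of N] nz[of z] zr by (simp add: h_def norm_divide N_def del: cofactor.simps)
    ultimately show ?thesis
      using mult_right_mono[of "1/2" "cmod (h z)" "cmod (cofactor N z)"] mult_right_mono[of "cmod (h z)" 2 "cmod (cofactor N z)"]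
      by simp
  qed
  then show ?thesis using that[of N] n by (simp add: N_def del: cofactor.simps)
qed

end

section \<open>Taylor coefficients and matrices decaying off the diagonal\<close>

definition taylor :: "(complex \<Rightarrow> complex) \<Rightarrow> nat \<Rightarrow> complex" where
  "taylor F k = (deriv ^^ k) F 0 / fact k"

lemma taylor_sums: "entire F \<Longrightarrow> (\<lambda>k. taylor F k * z ^ k) sums F z"
  using holomorphic_power_series[of F 0 "cmod z + 1" z] entire_imp_holomorphic[of F]
  by (simp add: taylor_def)

lemma power_series_entire:
  assumes sums: "\<And>z. (\<lambda>k. a k * z ^ k) sums F z"
  shows "entire F" and "taylor F = a"
proof -
  define f where "f = Abs_fps a"
  have "norm z \<le> fps_conv_radius f" for z :: complex
    unfolding fps_conv_radius_def f_def
    by (rule conv_radius_geI) (use sums[of z] in \<open>auto simp: sums_iff\<close>)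
  then have "ereal B \<le> fps_conv_radius f" for B
    by (metis abs_ge_self ereal_less_eq(3) norm_of_real order_trans)
  then have rad: "fps_conv_radius f = \<infinity>" by (simp add: ereal_top)
  have ev: "eval_fps f z = F z" for z
    using sums[of z] by (simp add: eval_fps_def f_def sums_iff)
  have "eval_fps f holomorphic_on UNIV"
    by (rule holomorphic_on_eval_fps) (simp add: rad)
  then show "entire F" by (simp add: entire_def ev[abs_def])
  have "F has_fps_expansion f"
    unfolding has_fps_expansion_def using rad ev by simp
  then have "fps_expansion F 0 = f" by (rule fps_expansion_eqI)
  then have "fps_nth (fps_expansion F 0) k = a k" for k by (simp add: f_def)
  then show "taylor F = a" by (simp add: taylor_def fps_expansion_def fun_eq_iff)
qed

lemma taylor_diff_scale:
  assumes "entire F" "entire G"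
  shows "taylor (\<lambda>z. F z - c * G z) k = taylor F k - c * taylor G k"
proof -
  have "F holomorphic_on UNIV" "G holomorphic_on UNIV" using assms by (auto simp: entire_def)
  then have "(deriv ^^ k) (\<lambda>z. F z - c * G z) 0 = (deriv ^^ k) F 0 - c * (deriv ^^ k) G 0"
    by (subst higher_deriv_diff[of _ UNIV]) (auto intro!: holomorphic_intros simp: higher_deriv_cmult[of G UNIV])
  then show ?thesis by (simp add: taylor_def diff_divide_distrib)
qed

lemma taylor_bound:
  assumes F: "entire F" and r: "r > 0" and B: "\<And>z. cmod z = r \<Longrightarrow> cmod (F z) \<le> B"
  shows "cmod (taylor F k) \<le> B / r ^ k"
proof -
  have "cmod ((deriv ^^ k) F 0) \<le> fact k * B / r ^ k"
    by (rule Cauchy_inequality[OF entire_imp_holomorphic[OF F] entire_imp_continuous[OF F] r]) (use B in auto)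
  then show ?thesis by (simp add: taylor_def norm_divide field_simps)
qed

text \<open>
  The distance between two natural numbers; one of the truncated differences is zero.
\<close>

definition idist :: "nat \<Rightarrow> nat \<Rightarrow> nat" where "idist i n = (i - n) + (n - i)"

lemma idist_commute: "idist i n = idist n i" by (simp add: idist_def)

lemma sum_power_idist_le:
  fixes x :: real
  assumes x: "0 \<le> x" "x < 1" and J: "finite J"
  shows "(\<Sum>i\<in>J. x ^ idist i n) \<le> 2 / (1 - x)"
proof -
  have geo: "(\<Sum>k\<in>K. x ^ k) \<le> 1 / (1 - x)" if "finite K" for K
  proof -
    have "(\<Sum>k\<in>K. x ^ k) \<le> (\<Sum>k. x ^ k)"
      by (rule sum_le_suminf) (use x that in \<open>auto intro: summable_geometric\<close>)
    then show ?thesis using x by (simp add: suminf_geometric)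
  qed
  have "(\<Sum>i\<in>J. x ^ idist i n) = (\<Sum>i\<in>{i\<in>J. i \<le> n}. x ^ idist i n) + (\<Sum>i\<in>{i\<in>J. \<not> i \<le> n}. x ^ idist i n)"
    by (subst sum.union_disjoint[symmetric]) (use J in \<open>auto intro!: sum.cong\<close>)
  also have "(\<Sum>i\<in>{i\<in>J. i \<le> n}. x ^ idist i n) = (\<Sum>k\<in>(\<lambda>i. n - i) ` {i\<in>J. i \<le> n}. x ^ k)"
    by (subst sum.reindex) (auto simp: inj_on_def idist_def intro!: sum.cong)
  also have "(\<Sum>i\<in>{i\<in>J. \<not> i \<le> n}. x ^ idist i n) = (\<Sum>k\<in>(\<lambda>i. i - n) ` {i\<in>J. \<not> i \<le> n}. x ^ k)"
    by (subst sum.reindex) (auto simp: inj_on_def idist_def intro!: sum.cong)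
  also have "(\<Sum>k\<in>(\<lambda>i. n - i) ` {i\<in>J. i \<le> n}. x ^ k) + (\<Sum>k\<in>(\<lambda>i. i - n) ` {i\<in>J. \<not> i \<le> n}. x ^ k)
     \<le> 1 / (1 - x) + 1 / (1 - x)"
    by (intro add_mono geo) (use J in auto)
  finally show ?thesis by simp
qed

text \<open>
  Schur's test for the matrix with entries \<open>x ^ idist k n\<close>: the sum of each row and of each column is at most
  \<open>2 / (1 - x)\<close>, and the Cauchy-Schwarz inequality with the matrix entries as weights gives the bound.
\<close>

lemma schur_test:
  fixes x :: real and u :: "nat \<Rightarrow> real"
  assumes x: "0 \<le> x" "x < 1" and J: "finite J" and K: "finite K"
  shows "(\<Sum>k\<in>K. (\<Sum>n\<in>J. x ^ idist k n * u n)\<^sup>2) \<le> (2 / (1 - x))\<^sup>2 * (\<Sum>n\<in>J. (u n)\<^sup>2)"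
proof -
  let ?S = "2 / (1 - x)"
  have S0: "?S \<ge> 0" using x by simp
  have row: "(\<Sum>n\<in>J. x ^ idist k n * u n)\<^sup>2 \<le> ?S * (\<Sum>n\<in>J. x ^ idist k n * (u n)\<^sup>2)" for k
  proof -
    have "(\<Sum>n\<in>J. x ^ idist k n * u n) = (\<Sum>n\<in>J. sqrt (x ^ idist k n) * (sqrt (x ^ idist k n) * u n))"
      using x by (intro sum.cong) (auto simp flip: mult.assoc)
    then have "(\<Sum>n\<in>J. x ^ idist k n * u n)\<^sup>2
       \<le> (\<Sum>n\<in>J. (sqrt (x ^ idist k n))\<^sup>2) * (\<Sum>n\<in>J. (sqrt (x ^ idist k n) * u n)\<^sup>2)"
      using Cauchy_Schwarz_ineq_sum[of "\<lambda>n. sqrt (x ^ idist k n)" "\<lambda>n. sqrt (x ^ idist k n) * u n" J] by simp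
    also have "\<dots> = (\<Sum>n\<in>J. x ^ idist n k) * (\<Sum>n\<in>J. x ^ idist k n * (u n)\<^sup>2)"
      using x by (simp add: power_mult_distrib idist_commute[of k])
    also have "\<dots> \<le> ?S * (\<Sum>n\<in>J. x ^ idist k n * (u n)\<^sup>2)"
      using x J by (intro mult_right_mono sum_power_idist_le sum_nonneg) auto
    finally show ?thesis .
  qed
  have "(\<Sum>k\<in>K. (\<Sum>n\<in>J. x ^ idist k n * u n)\<^sup>2) \<le> (\<Sum>k\<in>K. ?S * (\<Sum>n\<in>J. x ^ idist k n * (u n)\<^sup>2))"
    by (intro sum_mono row)
  also have "\<dots> = ?S * (\<Sum>n\<in>J. (\<Sum>k\<in>K. x ^ idist k n) * (u n)\<^sup>2)"
    unfolding sum_distrib_left[symmetric] sum_distrib_right by (subst sum.swap) simp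
  also have "\<dots> \<le> ?S * (\<Sum>n\<in>J. ?S * (u n)\<^sup>2)"
    using S0 x K by (intro mult_left_mono sum_mono mult_right_mono sum_power_idist_le) auto
  also have "\<dots> = ?S\<^sup>2 * (\<Sum>n\<in>J. (u n)\<^sup>2)"
    by (simp only: sum_distrib_left[symmetric] power2_eq_square mult.assoc)
  finally show ?thesis .
qed

text \<open>
  This turns a lower bound for a factor \<open>|1 - s i / s n|\<close>, where the points are separated by \<open>\<kappa>\<close> and \<open>u\<close> bounds the
  ratio of their moduli, into a form that can be multiplied over all \<open>i\<close>. If \<open>u \<le> 1/2\<close>, then \<open>1 - u \<ge> exp (-2u)\<close>;
  otherwise \<open>\<kappa> = exp (ln \<kappa>)\<close> is large enough.
\<close>

lemma exp_lower_bound: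
  fixes \<kappa> u v :: real
  assumes "\<kappa> > 0" "u \<ge> 0" "v \<ge> \<kappa>" "v \<ge> 1 - u"
  shows "v \<ge> exp (- (2 + 2 * \<bar>ln \<kappa>\<bar>) * u)"
proof (cases "u \<le> 1 / 2")
  case True
  have "1 \<le> (1 - u) * (1 + 2 * u)" using True assms mult_nonneg_nonneg[of u "1 - 2 * u"] by (simp add: algebra_simps)
  also have "\<dots> \<le> (1 - u) * exp (2 * u)" using True by (intro mult_left_mono exp_ge_add_one_self) auto
  finally have "exp (- (2 * u)) \<le> 1 - u" by (simp add: exp_minus field_simps)
  moreover have "exp (- (2 + 2 * \<bar>ln \<kappa>\<bar>) * u) \<le> exp (- (2 * u))" using assms by (simp add: algebra_simps)
  ultimately show ?thesis using assms by linarith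
next
  case False
  have "- (2 + 2 * \<bar>ln \<kappa>\<bar>) * u \<le> - (2 + 2 * \<bar>ln \<kappa>\<bar>) * (1 / 2)" using False by (intro mult_left_mono_neg) auto
  also have "\<dots> \<le> ln \<kappa>" by (simp add: algebra_simps)
  finally have "exp (- (2 + 2 * \<bar>ln \<kappa>\<bar>) * u) \<le> exp (ln \<kappa>)" by simp
  then show ?thesis using assms by simp
qed

context spectral_basis
begin

definition \<pi> :: "nat \<Rightarrow> real" where "\<pi> n = (\<Prod>i<n. p i)"

lemma \<pi>_pos: "\<pi> n > 0" unfolding \<pi>_def using p_pos by (intro prod_pos) auto

lemma \<pi>_Suc: "\<pi> (Suc n) = \<pi> n * p n" by (simp add: \<pi>_def)

lemma \<pi>_upper: "k \<le> m \<Longrightarrow> m \<le> n \<Longrightarrow> \<pi> m \<le> \<pi> k * p n ^ (m - k)"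
proof (induction m rule: dec_induct)
  case (step m)
  have "\<pi> m * p m \<le> (\<pi> k * p n ^ (m - k)) * p n"
    using step p_mono[of m n] p_pos[of m] p_pos[of n] \<pi>_pos[of k] by (intro mult_mono) auto
  also have "\<dots> = \<pi> k * p n ^ (Suc m - k)" using step by (simp add: Suc_diff_le)
  finally show ?case by (simp only: \<pi>_Suc)
qed simp

lemma \<pi>_lower: "n \<le> k \<Longrightarrow> \<pi> n * p n ^ (k - n) \<le> \<pi> k"
proof (induction k rule: dec_induct)
  case (step m)
  have "\<pi> n * p n ^ (Suc m - n) = \<pi> n * p n ^ (m - n) * p n" using step by (simp add: Suc_diff_le)
  also have "\<dots> \<le> \<pi> m * p m"
    using step p_mono[of n m] p_pos[of n] \<pi>_pos[of m] by (intro mult_mono) auto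
  finally show ?case by (simp only: \<pi>_Suc)
qed simp

lemma ratio_le_idist: "min (p i) (p n) / max (p i) (p n) \<le> (1 + c) * \<theta> ^ idist i n"
proof -
  have *: "p i / p n \<le> (1 + c) * \<theta> ^ idist i n" if "i \<le> n" for i n
    using p_growth[OF that] p_pos[of n] that by (simp add: idist_def pos_divide_le_eq)
  show ?thesis
  proof (cases "i \<le> n")
    case True
    then show ?thesis using *[OF True] p_mono[OF True] by (simp add: min_def max_def)
  next
    case False
    then have "n \<le> i" by simp
    then show ?thesis using *[of n i] p_mono[of n i] by (auto simp: min_def max_def idist_commute)
  qed
qed

lemma prod_below:
  assumes "n < N"
  shows "(\<Prod>i\<in>{..<N} - {n}. if i < n then y / p i else 1) = y ^ n / \<pi> n"
proof -
  have "(\<Prod>i\<in>{..<N} - {n}. if i < n then y / p i else 1) = (\<Prod>i<n. if i < n then y / p i else 1)"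
    by (rule prod.mono_neutral_right) (use assms in auto)
  also have "\<dots> = (\<Prod>i<n. y / p i)" by (intro prod.cong) auto
  finally show ?thesis by (simp add: \<pi>_def prod_dividef)
qed

text \<open>
  In the product for the derivative of \<open>A\<close> at \<open>s n\<close>, the factors with \<open>i < n\<close> are comparable to \<open>p n / p i\<close> and
  those with \<open>i > n\<close> to \<open>1\<close>. The errors are \<open>exp (- B \<theta>\<^sup>d)\<close> with \<open>d = idist i n\<close>, and their product is
  bounded below because the exponents form a geometric series.
\<close>

lemma kernel_lower_bound:
  obtains C where "C > 0" "\<And>n. C * p n ^ n \<le> cmod (deriv A (of_real (s n))) * p n * \<pi> n"
proof -
  define B where "B = (2 + 2 * \<bar>ln \<kappa>\<bar>) * (1 + c)"
  have B: "B > 0" using c_ge_1 by (simp add: B_def)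
  define C where "C = a\<^sub>0 / 2 * exp (- B * (2 / (1 - \<theta>)))"
  have "C > 0" using a\<^sub>0_pos by (simp add: C_def)
  moreover have "C * p n ^ n \<le> cmod (deriv A (of_real (s n))) * p n * \<pi> n" for n
  proof -
    let ?z = "complex_of_real (s n)"
    obtain N where N: "N \<ge> Suc n" and cof: "a\<^sub>0 / 2 \<le> cmod (cofactor N ?z)"
      using cofactor_nearly_constant[OF p_pos[of n], of "Suc n"] s_le_p[of n] by (metis norm_of_real)
    let ?J = "{..<N} - {n}"
    have fac_ge: "(if i < n then p n / p i else 1) * exp (- B * \<theta> ^ idist i n) \<le> cmod (fac i ?z)" if "i \<noteq> n" for i
    proof -
      define m M where "m = min i n" and "M = max i n"
      have mM: "m < M" "M \<ge> 1" using that by (auto simp: m_def M_def)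
      have dist: "\<bar>s n - s i\<bar> = \<bar>s M - s m\<bar>"
        using that by (auto simp: m_def M_def min_def max_def abs_minus_commute)
      have "\<bar>s M - s m\<bar> / p M \<ge> \<kappa>" using separated[OF mM(1)] p_pos[of M] by (simp add: pos_le_divide_eq)
      moreover have "\<bar>s M - s m\<bar> \<ge> p M - p m" using s_eq_p[OF mM(2)] s_le_p[of m] by linarith
      then have "\<bar>s M - s m\<bar> / p M \<ge> (p M - p m) / p M" using p_pos[of M] by (intro divide_right_mono) auto
      then have "\<bar>s M - s m\<bar> / p M \<ge> 1 - p m / p M" using p_pos[of M] by (simp add: diff_divide_distrib)
      ultimately have "exp (- (2 + 2 * \<bar>ln \<kappa>\<bar>) * (p m / p M)) \<le> \<bar>s M - s m\<bar> / p M"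
        using exp_lower_bound[OF \<kappa>_pos, of "p m / p M" "\<bar>s M - s m\<bar> / p M"] p_pos[of m] p_pos[of M] by simp
      moreover have "p m / p M \<le> (1 + c) * \<theta> ^ idist i n"
        using p_growth[of m M] mM p_pos[of M]
        by (auto simp: m_def M_def idist_def min_def max_def pos_divide_le_eq split: if_splits)
      then have "exp (- B * \<theta> ^ idist i n) \<le> exp (- (2 + 2 * \<bar>ln \<kappa>\<bar>) * (p m / p M))"
        unfolding B_def minus_mult_left[symmetric] exp_le_cancel_iff neg_le_iff_le mult.assoc
        by (intro mult_left_mono) auto
      ultimately have le: "exp (- B * \<theta> ^ idist i n) \<le> \<bar>s n - s i\<bar> / p M"
        unfolding dist by (rule order_trans[rotated])
      have fac: "cmod (fac i ?z) = \<bar>s n - s i\<bar> / p i"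
        using p_pos[of i] by (simp add: fac_def norm_divide flip: of_real_diff)
      show ?thesis
      proof (cases "i < n")
        case True
        then have "M = n" by (simp add: M_def)
        have "p n / p i * exp (- B * \<theta> ^ idist i n) \<le> p n / p i * (\<bar>s n - s i\<bar> / p n)"
          using le \<open>M = n\<close> p_pos[of n] p_pos[of i] by (intro mult_left_mono) auto
        then show ?thesis using True fac p_pos[of n] by simp
      next
        case False
        then have "M = i" using that by (simp add: M_def)
        then show ?thesis using le False fac by simp
      qed
    qed
    have "p n ^ n / \<pi> n * exp (- B * (2 / (1 - \<theta>)))
       \<le> p n ^ n / \<pi> n * exp (- B * (\<Sum>i\<in>?J. \<theta> ^ idist i n))"
    proof (rule mult_left_mono)
      have "B * (\<Sum>i\<in>?J. \<theta> ^ idist i n) \<le> B * (2 / (1 - \<theta>))"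
        by (intro mult_left_mono sum_power_idist_le) (use \<theta>_pos \<theta>_less_1 B in auto)
      then show "exp (- B * (2 / (1 - \<theta>))) \<le> exp (- B * (\<Sum>i\<in>?J. \<theta> ^ idist i n))"
        by (simp only: exp_le_cancel_iff minus_mult_left[symmetric] neg_le_iff_le)
    qed (use \<pi>_pos[of n] p_pos[of n] in auto)
    also have "\<dots> = (\<Prod>i\<in>?J. (if i < n then p n / p i else 1) * exp (- B * \<theta> ^ idist i n))"
      using prod_below[of n N "p n"] N by (simp add: prod.distrib exp_sum sum_distrib_left)
    also have "\<dots> \<le> (\<Prod>i\<in>?J. cmod (fac i ?z))"
      by (rule prod_mono) (use fac_ge p_pos in \<open>auto simp: less_imp_le\<close>)
    finally have prod_ge: "p n ^ n / \<pi> n * exp (- B * (2 / (1 - \<theta>))) \<le> (\<Prod>i\<in>?J. cmod (fac i ?z))" .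
    have "deriv A ?z = kernel n ?z" by (simp add: kernel_def)
    also have "\<dots> = (\<Prod>i\<in>?J. fac i ?z) * cofactor N ?z / of_real (p n)"
      by (rule kernel_factor) (use N in simp)
    finally have "cmod (deriv A ?z) * p n = (\<Prod>i\<in>?J. cmod (fac i ?z)) * cmod (cofactor N ?z)"
      using p_pos[of n] by (simp add: norm_divide norm_mult prod_norm)
    also have "\<dots> \<ge> (p n ^ n / \<pi> n * exp (- B * (2 / (1 - \<theta>)))) * (a\<^sub>0 / 2)"
      using prod_ge cof a\<^sub>0_pos p_pos[of n] \<pi>_pos[of n] by (intro mult_mono) (auto intro: prod_nonneg)
    finally have "(p n ^ n / \<pi> n * exp (- B * (2 / (1 - \<theta>)))) * (a\<^sub>0 / 2) * \<pi> n \<le> cmod (deriv A ?z) * p n * \<pi> n"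
      using \<pi>_pos[of n] by (intro mult_right_mono) auto
    moreover have "(p n ^ n / \<pi> n * exp (- B * (2 / (1 - \<theta>)))) * (a\<^sub>0 / 2) * \<pi> n = C * p n ^ n"
      using \<pi>_pos[of n] by (simp add: C_def)
    ultimately show ?thesis by simp
  qed
  ultimately show ?thesis using that by blast
qed

lemma entire_kernel: "entire (kernel n)"
proof -
  have "(\<lambda>z. (\<Prod>i\<in>{..<Suc n} - {n}. fac i z) * cofactor (Suc n) z / of_real (p n)) holomorphic_on UNIV"
    by (intro holomorphic_intros entire_imp_holomorphic entire_cofactor) (use p_pos[of n] in auto)
  then show ?thesis unfolding entire_def
    by (rule holomorphic_transform) (use kernel_factor[of n "Suc n"] in auto)
qed

text \<open>
  Cauchy's estimate on the circle \<open>|z| = p k\<close>. There the factors with \<open>i < k\<close> are comparable to \<open>p k / p i\<close> and the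
  others to \<open>1\<close>, with geometrically decaying errors as before. The missing factor with index \<open>n\<close> accounts for
  \<open>p (max n k)\<close>.
\<close>

lemma taylor_kernel_bound:
  obtains C where "C > 0" "\<And>n k. cmod (taylor (kernel n) k) \<le> C / (\<pi> k * p (max n k))"
proof -
  define C where "C = 2 * a\<^sub>0 * exp ((1 + c) * (2 / (1 - \<theta>)))"
  have "C > 0" using a\<^sub>0_pos by (simp add: C_def)
  moreover have "cmod (taylor (kernel n) k) \<le> C / (\<pi> k * p (max n k))" for n k
  proof -
    have "cmod (kernel n z) \<le> C * p k ^ k / (\<pi> k * p (max n k))" if z: "cmod z = p k" for z
    proof -
      obtain N where N: "N \<ge> Suc (max n k)" and cof: "cmod (cofactor N z) \<le> 2 * a\<^sub>0"
        using cofactor_nearly_constant[OF p_pos[of k], of "Suc (max n k)"] z by (metis order_refl)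
      let ?J = "{..<N} - {n}"
      define l where "l i = (if i < k then p k / p i else 1)" for i
      have l_pos: "l i > 0" for i using p_pos by (simp add: l_def)
      have fac_le: "cmod (fac i z) \<le> l i * exp ((1 + c) * \<theta> ^ idist i k)" for i
      proof -
        have "cmod (z - of_real (s i)) \<le> p k + p i"
          using norm_triangle_ineq4[of z "of_real (s i)"] z s_le_p[of i] by simp
        then have "cmod (fac i z) \<le> (p k + p i) / p i"
          using p_pos[of i] by (simp add: fac_def norm_divide divide_right_mono)
        also have "\<dots> \<le> l i * (1 + min (p i) (p k) / max (p i) (p k))"
        proof (cases "i < k")
          case True
          then have "p i \<le> p k" using p_mono by simp
          then show ?thesis using True p_pos[of i] p_pos[of k] by (simp add: l_def min_def max_def field_simps)
        next
          case False
          then have "p k \<le> p i" using p_mono by simp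
          then show ?thesis using False p_pos[of i] p_pos[of k] by (auto simp: l_def min_def max_def field_simps)
        qed
        also have "\<dots> \<le> l i * exp ((1 + c) * \<theta> ^ idist i k)"
          using ratio_le_idist[of i k] exp_ge_add_one_self[of "(1 + c) * \<theta> ^ idist i k"]
          by (intro mult_left_mono less_imp_le[OF l_pos]) linarith
        finally show ?thesis .
      qed
      have "cmod (\<Prod>i\<in>?J. fac i z) = (\<Prod>i\<in>?J. cmod (fac i z))" by (simp add: prod_norm)
      also have "\<dots> \<le> (\<Prod>i\<in>?J. l i * exp ((1 + c) * \<theta> ^ idist i k))"
        by (rule prod_mono) (use fac_le in auto)
      also have "\<dots> = (\<Prod>i\<in>?J. l i) * exp ((1 + c) * (\<Sum>i\<in>?J. \<theta> ^ idist i k))"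
        by (simp add: prod.distrib exp_sum sum_distrib_left)
      also have "\<dots> \<le> (\<Prod>i\<in>?J. l i) * exp ((1 + c) * (2 / (1 - \<theta>)))"
      proof (rule mult_left_mono)
        have "(1 + c) * (\<Sum>i\<in>?J. \<theta> ^ idist i k) \<le> (1 + c) * (2 / (1 - \<theta>))"
          by (intro mult_left_mono sum_power_idist_le) (use \<theta>_pos \<theta>_less_1 c_ge_1 in auto)
        then show "exp ((1 + c) * (\<Sum>i\<in>?J. \<theta> ^ idist i k)) \<le> exp ((1 + c) * (2 / (1 - \<theta>)))"
          by (simp only: exp_le_cancel_iff)
      qed (use l_pos in \<open>auto intro: prod_nonneg less_imp_le\<close>)
      also have "(\<Prod>i\<in>?J. l i) = p k ^ k / \<pi> k * (p n / p (max n k))"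
      proof -
        have "(\<Prod>i<N. l i) = p k ^ k / \<pi> k"
        proof -
          have "(\<Prod>i<N. l i) = l k * (\<Prod>i\<in>{..<N} - {k}. l i)" using N by (intro prod.remove) auto
          then show ?thesis using prod_below[of k N "p k"] N by (simp add: l_def)
        qed
        moreover have "(\<Prod>i<N. l i) = l n * (\<Prod>i\<in>?J. l i)" using N by (intro prod.remove) auto
        moreover have "l n * (p n / p (max n k)) = 1"
          using p_pos[of n] p_pos[of k] by (auto simp: l_def max_def)
        moreover have "l n * (\<Prod>i\<in>?J. l i) * (p n / p (max n k)) = (\<Prod>i\<in>?J. l i) * (l n * (p n / p (max n k)))"
          by (simp only: mult_ac)
        ultimately have "p k ^ k / \<pi> k * (p n / p (max n k)) = (\<Prod>i\<in>?J. l i) * (l n * (p n / p (max n k)))"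
          by metis
        with \<open>l n * (p n / p (max n k)) = 1\<close> show ?thesis by (simp only: mult_1_right)
      qed
      finally have P: "cmod (\<Prod>i\<in>?J. fac i z) \<le> p k ^ k / \<pi> k * (p n / p (max n k)) * exp ((1 + c) * (2 / (1 - \<theta>)))" .
      have "cmod (kernel n z) = cmod (\<Prod>i\<in>?J. fac i z) * cmod (cofactor N z) / p n"
        using kernel_factor[of n N z] N p_pos[of n] by (simp add: norm_divide norm_mult)
      also have "\<dots> \<le> (p k ^ k / \<pi> k * (p n / p (max n k)) * exp ((1 + c) * (2 / (1 - \<theta>)))) * (2 * a\<^sub>0) / p n"
        using p_pos[of n]
        by (intro divide_right_mono mult_mono[OF P cof order_trans[OF norm_ge_zero P]]) auto
      also have "\<dots> = C * p k ^ k / (\<pi> k * p (max n k))"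
        using p_pos[of n] by (simp add: C_def)
      finally show ?thesis .
    qed
    from taylor_bound[OF entire_kernel p_pos[of k] this, of k]
    show ?thesis using p_pos[of k] by simp
  qed
  ultimately show ?thesis using that by blast
qed

text \<open>
  Comparable to the norm of the monomial \<open>z\<^sup>k\<close>, as \<open>monomials_riesz_basis\<close> shows.
\<close>

definition \<omega> :: "nat \<Rightarrow> real" where "\<omega> k = \<pi> k * p k / sqrt (\<nu> k)"

lemma \<omega>_pos: "\<omega> k > 0"
  using \<pi>_pos p_pos \<nu>_pos by (simp add: \<omega>_def)

lemma sqrt_bounds:
  assumes "i \<le> j"
  shows "sqrt (\<nu> i) \<le> sqrt (1 + c) * sqrt \<theta> ^ (j - i) * sqrt (\<nu> j)"
    and "sqrt (\<nu> j) / p j \<le> sqrt (1 + c) * sqrt \<theta> ^ (j - i) * (sqrt (\<nu> i) / p i)"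
proof -
  have "sqrt (\<nu> i) \<le> sqrt ((1 + c) * \<theta> ^ (j - i) * \<nu> j)" using \<nu>_growth[OF assms] by simp
  then show "sqrt (\<nu> i) \<le> sqrt (1 + c) * sqrt \<theta> ^ (j - i) * sqrt (\<nu> j)"
    by (simp add: real_sqrt_mult real_sqrt_power)
  have sb: "sqrt (\<beta> k) = sqrt (\<nu> k) / p k" for k
    using p_pos[of k] by (simp add: \<beta>_def real_sqrt_divide)
  have "sqrt (\<beta> j) \<le> sqrt ((1 + c) * \<theta> ^ (j - i) * \<beta> i)" using \<beta>_decay[OF assms] by simp
  then show "sqrt (\<nu> j) / p j \<le> sqrt (1 + c) * sqrt \<theta> ^ (j - i) * (sqrt (\<nu> i) / p i)"
    unfolding sb[symmetric] by (simp add: real_sqrt_mult real_sqrt_power)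
qed

text \<open>
  For \<open>n \<le> k\<close> the decay comes from the growth of \<open>\<nu>\<close>, for \<open>n > k\<close> from the decay of \<open>\<beta>\<close>.
\<close>

lemma basis_taylor_decay:
  obtains C where "C > 0" "\<And>n k. \<omega> k * cmod (taylor (e n) k) \<le> C * sqrt \<theta> ^ idist k n"
proof -
  obtain C where C: "C > 0" "\<And>n k. cmod (taylor (kernel n) k) \<le> C / (\<pi> k * p (max n k))"
    using taylor_kernel_bound by blast
  have "\<omega> k * cmod (taylor (e n) k) \<le> C * sqrt (1 + c) * sqrt \<theta> ^ idist k n" for n k
  proof -
    have "e n = (\<lambda>z. 0 - (- of_real (sqrt (\<nu> n))) * kernel n z)" by (simp add: fun_eq_iff e_kernel)
    then have "taylor (e n) k = taylor (\<lambda>_. 0) k - (- of_real (sqrt (\<nu> n))) * taylor (kernel n) k"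
      using taylor_diff_scale[of "\<lambda>_. 0" "kernel n" "- of_real (sqrt (\<nu> n))" k] entire_kernel by (simp add: entire_def)
    then have "cmod (taylor (e n) k) = sqrt (\<nu> n) * cmod (taylor (kernel n) k)"
      using \<nu>_pos[of n] by (simp add: taylor_def norm_mult norm_divide)
    then have "\<omega> k * cmod (taylor (e n) k) \<le> \<omega> k * (sqrt (\<nu> n) * (C / (\<pi> k * p (max n k))))"
      using C(2)[of n k] \<omega>_pos[of k] \<nu>_pos[of n] by (simp only:) (intro mult_left_mono, auto)
    also have "\<dots> = C * (p k / p (max n k) * sqrt (\<nu> n) / sqrt (\<nu> k))"
      using \<pi>_pos[of k] by (simp add: \<omega>_def mult_ac)
    also have "\<dots> \<le> C * (sqrt (1 + c) * sqrt \<theta> ^ idist k n)"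
    proof (intro mult_left_mono)
      have nk: "sqrt (\<nu> k) > 0" using \<nu>_pos[of k] by simp
      show "p k / p (max n k) * sqrt (\<nu> n) / sqrt (\<nu> k) \<le> sqrt (1 + c) * sqrt \<theta> ^ idist k n"
      proof (cases "n \<le> k")
        case True
        then have "p k / p (max n k) * sqrt (\<nu> n) / sqrt (\<nu> k) = sqrt (\<nu> n) / sqrt (\<nu> k)"
          using p_pos[of k] by (simp add: max_def)
        also have "\<dots> \<le> sqrt (1 + c) * sqrt \<theta> ^ idist k n"
          using sqrt_bounds(1)[OF True] nk True by (simp add: idist_def pos_divide_le_eq)
        finally show ?thesis .
      next
        case False
        then have kn: "k \<le> n" by simp
        then have "p k / p (max n k) * sqrt (\<nu> n) / sqrt (\<nu> k) = (sqrt (\<nu> n) / p n) * (p k / sqrt (\<nu> k))"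
          by (simp add: max_def)
        also have "\<dots> \<le> (sqrt (1 + c) * sqrt \<theta> ^ (n - k) * (sqrt (\<nu> k) / p k)) * (p k / sqrt (\<nu> k))"
          using sqrt_bounds(2)[OF kn] nk p_pos[of k] by (intro mult_right_mono) auto
        also have "\<dots> = sqrt (1 + c) * sqrt \<theta> ^ idist k n"
          using nk p_pos[of k] kn \<nu>_pos[of k] by (simp add: idist_def)
        finally show ?thesis .
      qed
    qed (use C in simp)
    finally show ?thesis by (simp add: mult.assoc)
  qed
  moreover have "C * sqrt (1 + c) > 0" using C c_ge_1 by simp
  ultimately show ?thesis using that by blast
qed

lemma e_at_s: "e n (of_real (s m)) = (if n = m then of_real (sqrt (\<nu> n)) * deriv A (of_real (s n)) else 0)"
  using s_inj[of n m] by (cases "n = m") (auto simp: e_eq)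

text \<open>
  At the point \<open>s n\<close> all basis functions but \<open>e n\<close> vanish, so evaluating the expansion there isolates the
  coefficient.
\<close>

lemma coefficient_eq:
  assumes F: "F \<in> H"
  shows "ip F (e n) = F (of_real (s n)) / (of_real (sqrt (\<nu> n)) * deriv A (of_real (s n)))"
proof -
  have "(\<lambda>m. ip F (e m) * e m (of_real (s n))) sums F (of_real (s n))" by (rule expansion[OF F])
  moreover have "(\<lambda>m. ip F (e m) * e m (of_real (s n))) = (\<lambda>m. if m = n then ip F (e n) * e n (of_real (s n)) else 0)"
    by (auto simp: e_at_s)
  ultimately have "F (of_real (s n)) = ip F (e n) * e n (of_real (s n))"
    using sums_unique2[OF _ sums_single[of n "\<lambda>m. ip F (e n) * e n (of_real (s n))"]] by metis
  then show ?thesis using deriv_A[of n] \<nu>_pos[of n] by (simp add: e_at_s)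
qed

text \<open>
  By \<open>coefficient_eq\<close> the quotient on the left is the coefficient of \<open>z\<^sup>k\<close> with respect to \<open>e n\<close>. After inserting the
  lower bound for \<open>deriv A\<close>, monotonicity of \<open>p\<close> cancels the powers, and the rest decays as in
  \<open>basis_taylor_decay\<close>.
\<close>

lemma monomial_coefficient_decay:
  obtains C where "C > 0"
    "\<And>n k. cmod (of_real (s n) ^ k / (of_real (sqrt (\<nu> n)) * deriv A (of_real (s n)))) \<le> C * sqrt \<theta> ^ idist n k * \<omega> k"
proof -
  obtain C where C: "C > 0" "\<And>n. C * p n ^ n \<le> cmod (deriv A (of_real (s n))) * p n * \<pi> n"
    using kernel_lower_bound by blast
  define D where "D = sqrt (1 + c) / C"
  have "D > 0" using C c_ge_1 by (simp add: D_def)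
  moreover have "cmod (of_real (s n) ^ k / (of_real (sqrt (\<nu> n)) * deriv A (of_real (s n)))) \<le> D * sqrt \<theta> ^ idist n k * \<omega> k" for n k
  proof -
    let ?d = "cmod (deriv A (of_real (s n)))"
    have d: "?d > 0" using deriv_A[of n] by simp
    have n0: "sqrt (\<nu> n) > 0" "sqrt (\<nu> k) > 0" using \<nu>_pos by auto
    have pn: "p n > 0" "\<pi> n > 0" "p k > 0" "\<pi> k > 0" using p_pos \<pi>_pos by auto
    have "cmod (of_real (s n) ^ k / (of_real (sqrt (\<nu> n)) * deriv A (of_real (s n)))) = \<bar>s n\<bar> ^ k / (sqrt (\<nu> n) * ?d)"
      using n0 by (simp add: norm_divide norm_mult norm_power)
    also have "\<dots> \<le> p n ^ k / (sqrt (\<nu> n) * ?d)"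
      using s_le_p[of n] d n0 by (intro divide_right_mono power_mono) auto
    also have "\<dots> \<le> p n ^ k / (sqrt (\<nu> n) * (C * p n ^ n / (p n * \<pi> n)))"
    proof (intro divide_left_mono mult_left_mono)
      show "C * p n ^ n / (p n * \<pi> n) \<le> ?d" using C(2)[of n] pn by (simp add: pos_divide_le_eq mult.assoc)
    qed (use d n0 pn C in auto)
    also have "\<dots> = (p n ^ k * p n * \<pi> n / p n ^ n) / (C * sqrt (\<nu> n))"
      using C pn n0 by (simp add: field_simps)
    also have "\<dots> \<le> (C * D * sqrt \<theta> ^ idist n k * \<omega> k * sqrt (\<nu> n)) / (C * sqrt (\<nu> n))"
    proof (intro divide_right_mono)
      have CD: "C * D = sqrt (1 + c)" using C by (simp add: D_def)
      show "p n ^ k * p n * \<pi> n / p n ^ n \<le> C * D * sqrt \<theta> ^ idist n k * \<omega> k * sqrt (\<nu> n)"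
      proof (cases "k \<le> n")
        case True
        have "p n ^ k * p n * \<pi> n / p n ^ n \<le> \<pi> k * p k"
        proof (cases "k = n")
          case False
          then have kn: "k < n" using True by simp
          have "p n ^ k * p n * \<pi> n \<le> p n ^ k * p n * (\<pi> k * p k * p n ^ (n - Suc k))"
            using \<pi>_upper[of "Suc k" n n] kn pn by (intro mult_left_mono) (auto simp: \<pi>_Suc)
          also have "\<dots> = \<pi> k * p k * p n ^ (k + Suc (n - Suc k))" by (simp add: power_add)
          also have "k + Suc (n - Suc k) = n" using kn by simp
          finally show ?thesis using pn by (simp add: pos_divide_le_eq)
        qed (use pn in simp)
        also have "\<dots> = \<omega> k * sqrt (\<nu> k)" using n0 by (simp add: \<omega>_def)
        also have "\<dots> \<le> \<omega> k * (sqrt (1 + c) * sqrt \<theta> ^ (n - k) * sqrt (\<nu> n))"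
          using sqrt_bounds(1)[OF True] \<omega>_pos[of k] by (intro mult_left_mono) auto
        finally show ?thesis using True unfolding CD by (simp add: idist_def mult.commute mult.left_commute)
      next
        case False
        then have nk: "n \<le> k" by simp
        have "p n * (\<pi> n * p n ^ (k - n)) \<le> p n * \<pi> k" using pn \<pi>_lower[OF nk] by simp
        moreover have "p n ^ k = p n ^ n * p n ^ (k - n)" using nk by (simp flip: power_add)
        ultimately have "p n ^ k * p n * \<pi> n / p n ^ n \<le> p n * \<pi> k" using pn by (simp add: mult.commute mult.left_commute)
        also have "\<dots> = \<omega> k * (p n * (sqrt (\<nu> k) / p k))" using n0 pn by (simp add: \<omega>_def)
        also have "\<dots> \<le> \<omega> k * (p n * (sqrt (1 + c) * sqrt \<theta> ^ (k - n) * (sqrt (\<nu> n) / p n)))"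
          using sqrt_bounds(2)[OF nk] \<omega>_pos[of k] pn by (intro mult_left_mono) auto
        also have "\<dots> = \<omega> k * sqrt (1 + c) * sqrt \<theta> ^ (k - n) * sqrt (\<nu> n)" using pn by simp
        finally show ?thesis using nk unfolding CD by (simp add: idist_def mult.commute mult.left_commute)
      qed
    qed (use C n0 in auto)
    also have "\<dots> = D * sqrt \<theta> ^ idist n k * \<omega> k" using C n0 \<nu>_pos[of n] by simp
    finally show ?thesis .
  qed
  ultimately show ?thesis using that by blast
qed

end

section \<open>The monomials as a Riesz basis\<close>

context spectral_basis
begin

lemma taylor_evaluation_bound:
  obtains K where "K > 0" "\<And>F k. F \<in> H \<Longrightarrow> cmod (taylor F k) \<le> K * nrm F"
proof -
  obtain K where K: "K > 0" "\<And>F z. F \<in> H \<Longrightarrow> cmod z \<le> 1 \<Longrightarrow> cmod (F z) \<le> K * nrm F"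
    using evaluation_bound[of 1] by auto
  have "cmod (taylor F k) \<le> K * nrm F" if "F \<in> H" for F k
    using taylor_bound[OF entire_H[OF that], of 1 "K * nrm F" k] K(2)[OF that] by simp
  then show ?thesis using that K(1) by blast
qed

lemma taylor_partial:
  assumes F: "F \<in> H" and "finite J"
  shows "taylor (\<lambda>z. F z - (\<Sum>n\<in>J. b n * e n z)) k = taylor F k - (\<Sum>n\<in>J. b n * taylor (e n) k)"
  using \<open>finite J\<close>
proof (induction J)
  case (insert n J)
  have "taylor (\<lambda>z. F z - (\<Sum>m\<in>insert n J. b m * e m z)) k
      = taylor (\<lambda>z. (F z - (\<Sum>m\<in>J. b m * e m z)) - b n * e n z) k"
    using insert by (simp add: algebra_simps)
  also have "\<dots> = taylor (\<lambda>z. F z - (\<Sum>m\<in>J. b m * e m z)) k - b n * taylor (e n) k"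
    by (rule taylor_diff_scale[OF entire_H[OF partial_H[OF F]] entire_H[OF e_H]])
  finally show ?case using insert by (simp add: algebra_simps)
qed simp

lemma taylor_expansion:
  assumes F: "F \<in> H"
  shows "(\<lambda>N. \<Sum>n<N. ip F (e n) * taylor (e n) k) \<longlonglongrightarrow> taylor F k"
proof -
  obtain K where K: "K > 0" "\<And>F k. F \<in> H \<Longrightarrow> cmod (taylor F k) \<le> K * nrm F"
    using taylor_evaluation_bound by blast
  have le: "cmod (taylor F k - (\<Sum>n<N. ip F (e n) * taylor (e n) k))
      \<le> K * nrm (\<lambda>z. F z - (\<Sum>n<N. ip F (e n) * e n z))" for N
    using K(2)[OF partial_H[OF F, where J = "{..<N}" and c = "\<lambda>n. ip F (e n)"], of k]
    by (simp add: taylor_partial[OF F])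
  have "(\<lambda>N. taylor F k - (\<Sum>n<N. ip F (e n) * taylor (e n) k)) \<longlonglongrightarrow> 0"
  proof (rule Lim_null_comparison)
    show "(\<lambda>N. K * nrm (\<lambda>z. F z - (\<Sum>n<N. ip F (e n) * e n z))) \<longlonglongrightarrow> 0"
      using tendsto_mult_left[OF expansion_converges[OF F], of K] by simp
  qed (use le in \<open>intro always_eventually allI\<close>)
  from tendsto_diff[OF tendsto_const[of "taylor F k"] this] show ?thesis by simp
qed

abbreviation "schur_bound \<equiv> 2 / (1 - sqrt \<theta>)"

lemma sqrt_\<theta>: "0 \<le> sqrt \<theta>" "sqrt \<theta> < 1"
  using \<theta>_pos \<theta>_less_1 by auto

text \<open>
  By \<open>monomials_riesz_basis\<close> below, the supremum of these sums over \<open>K\<close> is comparable to the square of the norm.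
\<close>

abbreviation coeff_energy :: "(complex \<Rightarrow> complex) \<Rightarrow> nat \<Rightarrow> real" where
  "coeff_energy F K \<equiv> \<Sum>k<K. (\<omega> k * cmod (taylor F k))\<^sup>2"

lemma taylor_coefficients_bounded:
  obtains C where "C > 0"
    "\<And>F K. F \<in> H \<Longrightarrow> coeff_energy F K \<le> C * (nrm F)\<^sup>2"
proof -
  obtain D where D: "D > 0" "\<And>n k. \<omega> k * cmod (taylor (e n) k) \<le> D * sqrt \<theta> ^ idist k n"
    using basis_taylor_decay by blast
  have "coeff_energy F K \<le> (D\<^sup>2 * schur_bound\<^sup>2 + 1) * (nrm F)\<^sup>2" if F: "F \<in> H" for F K
  proof -
    let ?\<alpha> = "\<lambda>n. cmod (ip F (e n))"
    have part: "(\<Sum>k<K. (\<omega> k * cmod (\<Sum>n<N. ip F (e n) * taylor (e n) k))\<^sup>2) \<le> D\<^sup>2 * schur_bound\<^sup>2 * (nrm F)\<^sup>2" for N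
    proof -
      have "(\<Sum>k<K. (\<omega> k * cmod (\<Sum>n<N. ip F (e n) * taylor (e n) k))\<^sup>2)
         \<le> (\<Sum>k<K. D\<^sup>2 * (\<Sum>n<N. sqrt \<theta> ^ idist k n * ?\<alpha> n)\<^sup>2)"
      proof (intro sum_mono)
        fix k
        have "\<omega> k * cmod (\<Sum>n<N. ip F (e n) * taylor (e n) k) \<le> \<omega> k * (\<Sum>n<N. ?\<alpha> n * cmod (taylor (e n) k))"
          using \<omega>_pos[of k] by (intro mult_left_mono sum_norm_le) (auto simp: norm_mult)
        also have "\<dots> = (\<Sum>n<N. ?\<alpha> n * (\<omega> k * cmod (taylor (e n) k)))"
          by (simp add: sum_distrib_left mult_ac)
        also have "\<dots> \<le> (\<Sum>n<N. ?\<alpha> n * (D * sqrt \<theta> ^ idist k n))"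
          by (intro sum_mono mult_left_mono D) auto
        also have "\<dots> = D * (\<Sum>n<N. sqrt \<theta> ^ idist k n * ?\<alpha> n)"
          by (simp add: sum_distrib_left mult_ac)
        finally have "(\<omega> k * cmod (\<Sum>n<N. ip F (e n) * taylor (e n) k))\<^sup>2 \<le> (D * (\<Sum>n<N. sqrt \<theta> ^ idist k n * ?\<alpha> n))\<^sup>2"
          using \<omega>_pos[of k] by (intro power_mono) auto
        then show "(\<omega> k * cmod (\<Sum>n<N. ip F (e n) * taylor (e n) k))\<^sup>2 \<le> D\<^sup>2 * (\<Sum>n<N. sqrt \<theta> ^ idist k n * ?\<alpha> n)\<^sup>2"
          by (simp add: power_mult_distrib)
      qed
      also have "\<dots> = D\<^sup>2 * (\<Sum>k<K. (\<Sum>n<N. sqrt \<theta> ^ idist k n * ?\<alpha> n)\<^sup>2)" by (simp add: sum_distrib_left)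
      also have "\<dots> \<le> D\<^sup>2 * (schur_bound\<^sup>2 * (\<Sum>n<N. (?\<alpha> n)\<^sup>2))"
        by (intro mult_left_mono schur_test sqrt_\<theta>) auto
      also have "\<dots> \<le> D\<^sup>2 * (schur_bound\<^sup>2 * (nrm F)\<^sup>2)"
        by (intro mult_left_mono bessel[OF F]) auto
      finally show ?thesis by (simp add: mult.assoc)
    qed
    have "(\<lambda>N. \<Sum>k<K. (\<omega> k * cmod (\<Sum>n<N. ip F (e n) * taylor (e n) k))\<^sup>2)
       \<longlonglongrightarrow> coeff_energy F K"
      by (intro tendsto_intros taylor_expansion[OF F])
    then have "coeff_energy F K \<le> D\<^sup>2 * schur_bound\<^sup>2 * (nrm F)\<^sup>2"
      by (rule LIMSEQ_le_const2) (use part in blast)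
    also have "\<dots> \<le> (D\<^sup>2 * schur_bound\<^sup>2 + 1) * (nrm F)\<^sup>2" by (intro mult_right_mono) auto
    finally show ?thesis .
  qed
  moreover have "D\<^sup>2 * schur_bound\<^sup>2 + 1 > 0" by (intro add_nonneg_pos mult_nonneg_nonneg) auto
  ultimately show ?thesis using that by blast
qed

lemma polynomial_eq: "(\<lambda>z::complex. \<Sum>k<K. b k * z ^ k) = poly (\<Sum>k<K. monom (b k) k)"
  by (simp add: fun_eq_iff poly_sum poly_monom)

lemma polynomial_norm_bounded:
  obtains C where "C > 0"
    "\<And>b K. (nrm (\<lambda>z. \<Sum>k<K. b k * z ^ k))\<^sup>2 \<le> C * (\<Sum>k<K. (\<omega> k * cmod (b k))\<^sup>2)"
proof -
  obtain D where D: "D > 0"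
    "\<And>n k. cmod (of_real (s n) ^ k / (of_real (sqrt (\<nu> n)) * deriv A (of_real (s n)))) \<le> D * sqrt \<theta> ^ idist n k * \<omega> k"
    using monomial_coefficient_decay by blast
  have "(nrm (\<lambda>z. \<Sum>k<K. b k * z ^ k))\<^sup>2 \<le> (D\<^sup>2 * schur_bound\<^sup>2 + 1) * (\<Sum>k<K. (\<omega> k * cmod (b k))\<^sup>2)" for b K
  proof -
    let ?P = "\<lambda>z. \<Sum>k<K. b k * z ^ k" and ?B = "\<Sum>k<K. (\<omega> k * cmod (b k))\<^sup>2"
    let ?d = "\<lambda>n. of_real (sqrt (\<nu> n)) * deriv A (of_real (s n))"
    have P: "?P \<in> H" unfolding polynomial_eq by (rule polynomials)
    have co: "cmod (ip ?P (e n)) \<le> D * (\<Sum>k<K. sqrt \<theta> ^ idist n k * (\<omega> k * cmod (b k)))" for n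
    proof -
      have "ip ?P (e n) = (\<Sum>k<K. b k * (of_real (s n) ^ k / ?d n))"
        unfolding coefficient_eq[OF P] by (simp add: sum_divide_distrib)
      also have "cmod \<dots> \<le> (\<Sum>k<K. cmod (b k) * (D * sqrt \<theta> ^ idist n k * \<omega> k))"
        unfolding norm_mult[symmetric]
        by (intro sum_norm_le) (use D(2) in \<open>auto simp only: norm_mult intro!: mult_left_mono norm_ge_zero\<close>)
      finally show ?thesis by (simp add: sum_distrib_left mult_ac)
    qed
    have "(\<Sum>n<N. (cmod (ip ?P (e n)))\<^sup>2) \<le> D\<^sup>2 * schur_bound\<^sup>2 * ?B" for N
    proof -
      have "(\<Sum>n<N. (cmod (ip ?P (e n)))\<^sup>2) \<le> (\<Sum>n<N. (D * (\<Sum>k<K. sqrt \<theta> ^ idist n k * (\<omega> k * cmod (b k))))\<^sup>2)"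
        by (intro sum_mono power_mono co) auto
      also have "\<dots> = D\<^sup>2 * (\<Sum>n<N. (\<Sum>k<K. sqrt \<theta> ^ idist n k * (\<omega> k * cmod (b k)))\<^sup>2)"
        by (simp only: power_mult_distrib sum_distrib_left[symmetric])
      also have "\<dots> \<le> D\<^sup>2 * (schur_bound\<^sup>2 * ?B)"
        by (intro mult_left_mono schur_test sqrt_\<theta>) auto
      finally show ?thesis by (simp add: mult.assoc)
    qed
    then have "(nrm ?P)\<^sup>2 \<le> D\<^sup>2 * schur_bound\<^sup>2 * ?B"
      using parseval[OF P] unfolding sums_def by (meson LIMSEQ_le_const2)
    also have "\<dots> \<le> (D\<^sup>2 * schur_bound\<^sup>2 + 1) * ?B" by (intro mult_right_mono sum_nonneg) auto
    finally show ?thesis .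
  qed
  moreover have "D\<^sup>2 * schur_bound\<^sup>2 + 1 > 0" by (intro add_nonneg_pos mult_nonneg_nonneg) auto
  ultimately show ?thesis using that by blast
qed

text \<open>
  The Taylor polynomials belong to the space and have bounded norms, and they converge pointwise.
\<close>

lemma power_series_membership:
  obtains C where "C > 0"
    "\<And>G B. entire G \<Longrightarrow> (\<And>K. coeff_energy G K \<le> B) \<Longrightarrow> G \<in> H \<and> (nrm G)\<^sup>2 \<le> C * B"
proof -
  obtain C where C: "C > 0"
    "\<And>b K. (nrm (\<lambda>z. \<Sum>k<K. b k * z ^ k))\<^sup>2 \<le> C * (\<Sum>k<K. (\<omega> k * cmod (b k))\<^sup>2)"
    using polynomial_norm_bounded by blast
  have "G \<in> H \<and> (nrm G)\<^sup>2 \<le> C * B"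
    if G: "entire G" and B: "\<And>K. coeff_energy G K \<le> B" for G B
  proof -
    have B0: "B \<ge> 0" using B[of 0] by simp
    have bd: "nrm (\<lambda>z. \<Sum>k<K. taylor G k * z ^ k) \<le> sqrt (C * B)" for K
    proof (rule real_le_rsqrt)
      have "(nrm (\<lambda>z. \<Sum>k<K. taylor G k * z ^ k))\<^sup>2 \<le> C * coeff_energy G K" by (rule C)
      also have "\<dots> \<le> C * B" using C(1) B by (intro mult_left_mono) auto
      finally show "(nrm (\<lambda>z. \<Sum>k<K. taylor G k * z ^ k))\<^sup>2 \<le> C * B" .
    qed
    have lim: "(\<lambda>K. \<Sum>k<K. taylor G k * z ^ k) \<longlonglongrightarrow> G z" for z
      using taylor_sums[OF G] by (simp add: sums_def)
    have mem: "(\<lambda>z. \<Sum>k<K. taylor G k * z ^ k) \<in> H" for K unfolding polynomial_eq by (rule polynomials)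
    have "G \<in> H" "nrm G \<le> sqrt (C * B)"
      using H_closed_under_bounded_limits[OF mem bd G lim] by auto
    moreover have "(nrm G)\<^sup>2 \<le> (sqrt (C * B))\<^sup>2" using \<open>nrm G \<le> sqrt (C * B)\<close> nrm_nonneg by (intro power_mono) auto
    ultimately show ?thesis using C(1) B0 by simp
  qed
  then show ?thesis using that C(1) by blast
qed

text \<open>
  The ratio of consecutive weights is at least \<open>p k / sqrt (1 + c)\<close>, which tends to infinity.
\<close>

lemma summable_over_\<omega>: "summable (\<lambda>k. r ^ k / \<omega> k)" if r: "r > 0" for r :: real
proof -
  have ratio: "\<omega> k * p k / sqrt (1 + c) \<le> \<omega> (Suc k)" for k
  proof -
    have n0: "sqrt (\<nu> k) > 0" "sqrt (\<nu> (Suc k)) > 0" using \<nu>_pos by auto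
    have "\<beta> (Suc k) \<le> (1 + c) * \<theta> ^ (Suc k - k) * \<beta> k" by (rule \<beta>_decay) simp
    also have "\<dots> \<le> (1 + c) * 1 * \<beta> k" using \<theta>_less_1 \<theta>_pos c_ge_1 \<beta>_pos[of k]
      by (intro mult_right_mono mult_left_mono) auto
    finally have "sqrt (\<beta> (Suc k)) \<le> sqrt ((1 + c) * \<beta> k)" by simp
    then have "sqrt (\<nu> (Suc k)) / p (Suc k) \<le> sqrt (1 + c) * (sqrt (\<nu> k) / p k)"
      using p_pos[of k] p_pos[of "Suc k"] by (simp add: \<beta>_def real_sqrt_divide real_sqrt_mult)
    then have "sqrt (\<nu> (Suc k)) * p k \<le> sqrt (1 + c) * sqrt (\<nu> k) * p (Suc k)"
      using p_pos[of k] p_pos[of "Suc k"] by (simp add: field_simps)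
    then have "(\<pi> k * p k) * (sqrt (\<nu> (Suc k)) * p k) \<le> (\<pi> k * p k) * (sqrt (1 + c) * sqrt (\<nu> k) * p (Suc k))"
      using \<pi>_pos[of k] p_pos[of k] by (intro mult_left_mono) auto
    then show ?thesis using n0 c_ge_1 by (simp add: \<omega>_def \<pi>_Suc field_simps)
  qed
  obtain N where N: "\<And>n. n \<ge> N \<Longrightarrow> p n \<ge> 2 * r * sqrt (1 + c)" using p_tends_to_infinity by blast
  show ?thesis
  proof (rule summable_ratio_test[where c = "1/2" and N = N])
    fix k assume "k \<ge> N"
    have sc: "sqrt (1 + c) > 0" using c_ge_1 by simp
    have "2 * r \<le> p k / sqrt (1 + c)" using N[OF \<open>k \<ge> N\<close>] sc by (simp add: pos_le_divide_eq)
    then have "\<omega> k * (2 * r) \<le> \<omega> k * (p k / sqrt (1 + c))" using \<omega>_pos[of k] by (intro mult_left_mono) auto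
    then have "\<omega> k * (2 * r) \<le> \<omega> (Suc k)" using ratio[of k] by simp
    then have "r / \<omega> (Suc k) \<le> 1 / 2 * (1 / \<omega> k)"
      using \<omega>_pos[of k] \<omega>_pos[of "Suc k"] r by (simp add: field_simps)
    then have "r ^ k * (r / \<omega> (Suc k)) \<le> r ^ k * (1 / 2 * (1 / \<omega> k))" using r by (intro mult_left_mono) auto
    then show "norm (r ^ Suc k / \<omega> (Suc k)) \<le> 1 / 2 * norm (r ^ k / \<omega> k)"
      using r \<omega>_pos[of k] \<omega>_pos[of "Suc k"] by (simp add: mult_ac)
  qed simp
qed

theorem monomials_riesz_basis:
  obtains C where "C > 0"
    and "\<And>F K. F \<in> H \<Longrightarrow> coeff_energy F K \<le> C * (nrm F)\<^sup>2"
    and "\<And>G B. entire G \<Longrightarrow> (\<forall>K. coeff_energy G K \<le> B) \<Longrightarrow> G \<in> H"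
    and "\<And>G B. entire G \<Longrightarrow> (\<forall>K. coeff_energy G K \<le> B) \<Longrightarrow> (nrm G)\<^sup>2 \<le> C * B"
proof -
  obtain C1 where C1: "C1 > 0"
    "\<And>F K. F \<in> H \<Longrightarrow> coeff_energy F K \<le> C1 * (nrm F)\<^sup>2"
    using taylor_coefficients_bounded by blast
  obtain C2 where C2: "C2 > 0"
    "\<And>G B. entire G \<Longrightarrow> (\<And>K. coeff_energy G K \<le> B) \<Longrightarrow> G \<in> H \<and> (nrm G)\<^sup>2 \<le> C2 * B"
    using power_series_membership by blast
  show ?thesis
  proof (rule that[of "C1 + C2"])
    show "coeff_energy F K \<le> (C1 + C2) * (nrm F)\<^sup>2" if "F \<in> H" for F K
      using C1(2)[OF that, of K] C2(1) mult_right_mono[of C1 "C1 + C2" "(nrm F)\<^sup>2"] by simp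
    fix G B assume G: "entire G" and B: "\<forall>K. coeff_energy G K \<le> B"
    show "G \<in> H" using C2(2)[OF G B[rule_format]] by simp
    have "C2 * B \<le> (C1 + C2) * B" using B[rule_format, of 0] C1(1) by (intro mult_right_mono) auto
    then show "(nrm G)\<^sup>2 \<le> (C1 + C2) * B" using C2(2)[OF G B[rule_format]] by linarith
  qed (use C1 C2 in auto)
qed

end

section \<open>Enumeration of the spectral data by modulus\<close>

text \<open>
  Greedy choice: in each step a remaining element of least size is picked. No element is left over, since
  otherwise infinitely many elements would be at most as large as that element.
\<close>

lemma enumeration_by_size:
  fixes f :: "'a \<Rightarrow> real"
  assumes inf: "infinite I" and fin: "\<And>R. finite {k\<in>I. f k \<le> R}"
  obtains \<sigma> :: "nat \<Rightarrow> 'a" where "bij_betw \<sigma> UNIV I" "\<And>i j. i \<le> j \<Longrightarrow> f (\<sigma> i) \<le> f (\<sigma> j)"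
proof -
  have "\<exists>a. a \<in> I - X \<and> (\<forall>b\<in>I - X. f a \<le> f b)" if X: "finite X" for X
  proof -
    obtain b0 where b0: "b0 \<in> I - X" using inf X by (metis Diff_infinite_finite ex_in_conv finite.emptyI)
    let ?B = "{k\<in>I - X. f k \<le> f b0}"
    have B: "finite ?B" by (rule finite_subset[OF _ fin[of "f b0"]]) auto
    have "Min (f ` ?B) \<in> f ` ?B" using B b0 by (intro Min_in) auto
    then obtain a where a: "a \<in> ?B" "f a = Min (f ` ?B)" by auto
    have "f a \<le> f b" if "b \<in> I - X" for b
    proof (cases "f b \<le> f b0")
      case True then show ?thesis using a B that by auto
    next
      case False then show ?thesis using a(1) by auto
    qed
    then show ?thesis using a by blast
  qed
  then obtain pick where pick: "\<And>X. finite X \<Longrightarrow> pick X \<in> I - X \<and> (\<forall>b\<in>I - X. f (pick X) \<le> f b)" by metis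
  define X where "X = rec_nat {} (\<lambda>_ X. insert (pick X) X)"
  define \<sigma> where "\<sigma> n = pick (X n)" for n
  have X_simps: "X 0 = {}" "X (Suc n) = insert (\<sigma> n) (X n)" for n by (auto simp: X_def \<sigma>_def)
  have finX: "finite (X n)" for n by (induction n) (auto simp: X_simps)
  have X_eq: "X n = \<sigma> ` {..<n}" for n by (induction n) (auto simp: X_simps lessThan_Suc)
  have "\<sigma> n \<in> I - \<sigma> ` {..<n} \<and> (\<forall>b\<in>I - \<sigma> ` {..<n}. f (\<sigma> n) \<le> f b)" for n
    using pick[OF finX[of n]] unfolding \<sigma>_def[symmetric] unfolding X_eq .
  then have \<sigma>: "\<sigma> n \<in> I - \<sigma> ` {..<n}" "\<And>b. b \<in> I - \<sigma> ` {..<n} \<Longrightarrow> f (\<sigma> n) \<le> f b" for n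
    by blast+
  have mono: "f (\<sigma> i) \<le> f (\<sigma> j)" if "i \<le> j" for i j
    by (rule \<sigma>(2)) (use \<sigma>(1)[of j] that in auto)
  have inj: "inj \<sigma>"
  proof (rule linorder_injI)
    fix i j :: nat assume "i < j"
    then have "\<sigma> i \<in> \<sigma> ` {..<j}" by simp
    then show "\<sigma> i \<noteq> \<sigma> j" using \<sigma>(1)[of j] by (metis DiffD2)
  qed
  have "k \<in> range \<sigma>" if k: "k \<in> I" for k
  proof (rule ccontr)
    assume "k \<notin> range \<sigma>"
    then have "range \<sigma> \<subseteq> {l\<in>I. f l \<le> f k}" using \<sigma> k by blast
    then have "finite (range \<sigma>)" using fin finite_subset by blast
    then show False using inj range_inj_infinite by blast
  qed
  then have "bij_betw \<sigma> UNIV I" using inj \<sigma>(1) by (auto simp: bij_betw_def)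
  then show ?thesis using that mono by blast
qed

text \<open>
  Lacunarity only compares neighbours and only with the modulus of the left one. By monotonicity it extends
  to all pairs; for positive points the gap is measured against the larger right point, which costs the
  factor \<open>1 / (1 + \<kappa>)\<close>, and points of different sign are separated by the sum of their moduli.
\<close>

lemma lacunary_separation:
  fixes I :: "int set" and t :: "int \<Rightarrow> real"
  assumes conv: "\<forall>a\<in>I. \<forall>b\<in>I. {a..b} \<subseteq> I" and mono: "strict_mono_on I t" and \<kappa>: "\<kappa> > 0"
    and lac: "\<forall>n. n \<in> I \<longrightarrow> n + 1 \<in> I \<longrightarrow> t (n + 1) - t n \<ge> \<kappa> * \<bar>t n\<bar>"
    and mn: "m \<in> I" "n \<in> I" "m \<noteq> n"
  shows "\<bar>t m - t n\<bar> \<ge> \<kappa> / (1 + \<kappa>) * \<bar>t n\<bar>"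
proof -
  have *: "t b - t a \<ge> \<kappa> / (1 + \<kappa>) * \<bar>t a\<bar> \<and> t b - t a \<ge> \<kappa> / (1 + \<kappa>) * \<bar>t b\<bar>"
    if ab: "a \<in> I" "b \<in> I" "a < b" for a b
  proof -
    have lt: "t a < t b" using strict_mono_onD[OF mono] ab by auto
    have "a + 1 \<in> {a..b}" using ab by simp
    then have a1: "a + 1 \<in> I" using conv ab by blast
    have le: "t (a + 1) \<le> t b" using strict_mono_onD[OF mono a1 ab(2)] ab(3) by (cases "a + 1 = b") auto
    have step: "t b - t a \<ge> \<kappa> * \<bar>t a\<bar>" using lac ab a1 le by force
    have k1: "\<kappa> / (1 + \<kappa>) \<le> 1" "\<kappa> / (1 + \<kappa>) \<le> \<kappa>" "\<kappa> / (1 + \<kappa>) \<ge> 0" using \<kappa> by (auto simp: field_simps)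
    have first: "\<kappa> / (1 + \<kappa>) * \<bar>t a\<bar> \<le> t b - t a"
      using mult_right_mono[OF k1(2), of "\<bar>t a\<bar>"] step by linarith
    consider "0 \<le> t a" | "t a < 0" "0 < t b" | "t b \<le> 0" by linarith
    then have "\<kappa> / (1 + \<kappa>) * \<bar>t b\<bar> \<le> t b - t a"
    proof cases
      case 1
      then have "\<kappa> * t b \<le> (1 + \<kappa>) * (t b - t a)" using step by (simp add: algebra_simps)
      then show ?thesis using 1 lt \<kappa> by (simp add: field_simps)
    next
      case 2
      then show ?thesis using mult_right_mono[OF k1(1), of "t b"] by simp
    next
      case 3
      then show ?thesis using first lt mult_left_mono[OF _ k1(3), of "\<bar>t b\<bar>" "\<bar>t a\<bar>"] by linarith
    qed
    then show ?thesis using first by simp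
  qed
  show ?thesis using *[of m n] *[of n m] mn by (cases m n rule: linorder_cases) (auto simp: abs_if)
qed

lemma deriv_nonzero_at_simple_zero:
  assumes A: "entire A" and z: "A z = 0" "zorder A z = 1" and w: "A w \<noteq> 0"
  shows "deriv A z \<noteq> 0"
proof -
  have "A holomorphic_on UNIV" using A by (simp add: entire_def)
  from zorder_exist_zero[OF this open_UNIV connected_UNIV UNIV_I, of z] w
  have "\<exists>r>0. zor_poly A z holomorphic_on cball z r \<and>
     (\<forall>u\<in>cball z r. A u = zor_poly A z u * (u - z) ^ nat (zorder A z) \<and> zor_poly A z u \<noteq> 0)"
    by auto
  then obtain r where r: "r > 0" "zor_poly A z holomorphic_on cball z r"
    "\<And>u. u \<in> cball z r \<Longrightarrow> A u = zor_poly A z u * (u - z) ^ nat (zorder A z) \<and> zor_poly A z u \<noteq> 0"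
    by blast
  have "zor_poly A z holomorphic_on ball z r" using r(2) ball_subset_cball holomorphic_on_subset by blast
  then have "(zor_poly A z has_field_derivative deriv (zor_poly A z) z) (at z)"
    using r(1) by (simp add: holomorphic_derivI[where S = "ball z r"])
  then have "((\<lambda>u. zor_poly A z u * (u - z)) has_field_derivative zor_poly A z z) (at z)"
    by (auto intro!: derivative_eq_intros)
  then have "(A has_field_derivative zor_poly A z z) (at z)"
    by (rule has_field_derivative_transform_within[OF _ r(1)]) (use r(3) z in \<open>auto simp: dist_commute\<close>)
  then show ?thesis using r(1,3) by (metis DERIV_imp_deriv centre_in_cball less_imp_le)
qed

context de_Branges_with_polynomials
begin

lemma finite_sublevels:
  assumes "spectral_data E I t \<nu>" shows "finite {k\<in>I. \<bar>t k\<bar> \<le> R}"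
proof (rule ccontr)
  assume inf: "infinite {k\<in>I. \<bar>t k\<bar> \<le> R}"
  have mono: "strict_mono_on I t" and acc: "\<forall>x. \<not> x islimpt t ` I"
    using assms by (auto simp: spectral_data_def)
  have "inj_on t {k\<in>I. \<bar>t k\<bar> \<le> R}"
    using strict_mono_on_imp_inj_on[OF mono] by (rule inj_on_subset) auto
  then have "infinite (t ` {k\<in>I. \<bar>t k\<bar> \<le> R})" using inf finite_imageD by blast
  moreover have "t ` {k\<in>I. \<bar>t k\<bar> \<le> R} \<subseteq> {-R..R}" by (auto simp: abs_le_iff)
  ultimately obtain x where "x islimpt t ` {k\<in>I. \<bar>t k\<bar> \<le> R}"
    using Heine_Borel_imp_Bolzano_Weierstrass[OF compact_Icc] by blast
  then have "x islimpt t ` I" by (rule islimpt_subset) auto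
  then show False using acc by blast
qed

text \<open>
  If there were only finitely many points, the polynomial with exactly these zeros would be approximated by
  combinations of basis functions whose coefficients tend to zero, so it would vanish identically.
\<close>

lemma infinite_index_set:
  assumes basis: "orthonormal_basis E I (\<lambda>n z. of_real (sqrt (\<nu> n)) *
       (if z = of_real (t n) then deriv A z else A z / (z - of_real (t n))))"
    and A: "\<And>n. n \<in> I \<Longrightarrow> A (of_real (t n)) = 0" "\<And>n. n \<in> I \<Longrightarrow> deriv A (of_real (t n)) \<noteq> 0"
    and \<nu>: "\<And>n. n \<in> I \<Longrightarrow> \<nu> n > 0" and inj: "inj_on t I"
  shows "infinite I"
proof
  assume fin: "finite I"
  define e where "e n z = of_real (sqrt (\<nu> n)) *
       (if z = of_real (t n) then deriv A z else A z / (z - of_real (t n)))" for n z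
  define F where "F = poly (\<Prod>n\<in>I. [:- complex_of_real (t n), 1:])"
  have F: "F \<in> H" unfolding F_def by (rule polynomials)
  have F0: "F (of_real (t n)) = 0" if "n \<in> I" for n
    using that fin by (auto simp: F_def poly_prod)
  have e_same: "e n (of_real (t n)) \<noteq> 0" if "n \<in> I" for n using A(2)[OF that] \<nu>[OF that] by (simp add: e_def)
  have e_other: "e m (of_real (t n)) = 0" if "n \<in> I" "m \<in> I" "m \<noteq> n" for m n
    using that A(1) inj by (auto simp: e_def inj_on_def)
  define r where "r = 1 + (\<Sum>n\<in>I. \<bar>t n\<bar>)"
  have r: "r > 0" unfolding r_def by (intro add_pos_nonneg sum_nonneg) auto
  obtain K where K: "K > 0" "\<And>F z. F \<in> H \<Longrightarrow> cmod z \<le> r \<Longrightarrow> cmod (F z) \<le> K * nrm F"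
    using evaluation_bound[OF r] by blast
  have tr: "cmod (of_real (t n)) \<le> r" if "n \<in> I" for n
    using member_le_sum[of n I "\<lambda>n. \<bar>t n\<bar>"] that fin by (simp add: r_def)
  have ir: "cmod \<i> \<le> r" unfolding r_def by (simp add: sum_nonneg)
  define M where "M = K + (\<Sum>n\<in>I. K / cmod (e n (of_real (t n))) * cmod (e n \<i>))"
  have M: "M \<ge> 0" unfolding M_def using K by (intro add_nonneg_nonneg sum_nonneg) auto
  have small: "cmod (F \<i>) \<le> \<epsilon> * M" if eps: "\<epsilon> > 0" for \<epsilon>
  proof -
    have eH: "e n \<in> H" if "n \<in> I" for n
      using basis that unfolding orthonormal_basis_def e_def[abs_def] by blast
    have dense: "\<forall>F\<in>H. \<forall>\<epsilon>>0. \<exists>J c. finite J \<and> J \<subseteq> I \<and> nrm (\<lambda>z. F z - (\<Sum>n\<in>J. c n * e n z)) < \<epsilon>"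
      using basis unfolding orthonormal_basis_def e_def[abs_def] by blast
    obtain J c where J: "finite J" "J \<subseteq> I" "nrm (\<lambda>z. F z - (\<Sum>n\<in>J. c n * e n z)) < \<epsilon>"
      using dense[rule_format, OF F eps] by (elim exE conjE) (rule that)
    let ?D = "\<lambda>z. F z - (\<Sum>n\<in>J. c n * e n z)"
    have D: "?D \<in> H" using J eH by (intro H_diff F H_sum) auto
    have D_le: "cmod (?D z) \<le> K * \<epsilon>" if "cmod z \<le> r" for z
      using K(2)[OF D that] J(3) mult_left_mono[of "nrm ?D" \<epsilon> K] K(1) by linarith
    have c_le: "cmod (c n) \<le> K * \<epsilon> / cmod (e n (of_real (t n)))" if n: "n \<in> J" for n
    proof -
      have "(\<Sum>m\<in>J. c m * e m (of_real (t n))) = (\<Sum>m\<in>{n}. c m * e m (of_real (t n)))"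
        by (rule sum.mono_neutral_right) (use J n e_other in auto)
      then have "cmod (c n * e n (of_real (t n))) \<le> K * \<epsilon>"
        using D_le[OF tr[of n]] F0[of n] J n by auto
      then show ?thesis using e_same[of n] J n by (auto simp: norm_mult pos_le_divide_eq)
    qed
    have term_le: "cmod (c n * e n \<i>) \<le> K * \<epsilon> / cmod (e n (of_real (t n))) * cmod (e n \<i>)" if "n \<in> J" for n
      unfolding norm_mult by (intro mult_right_mono c_le that) simp
    have "cmod (F \<i>) \<le> cmod (?D \<i>) + cmod (\<Sum>n\<in>J. c n * e n \<i>)"
      using norm_triangle_ineq[of "?D \<i>" "\<Sum>n\<in>J. c n * e n \<i>"] by simp
    also have "\<dots> \<le> K * \<epsilon> + (\<Sum>n\<in>J. K * \<epsilon> / cmod (e n (of_real (t n))) * cmod (e n \<i>))"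
      by (intro add_mono D_le ir sum_norm_le term_le)
    also have "\<dots> \<le> K * \<epsilon> + (\<Sum>n\<in>I. K * \<epsilon> / cmod (e n (of_real (t n))) * cmod (e n \<i>))"
      using J fin K(1) eps by (intro add_left_mono sum_mono2) auto
    also have "\<dots> = \<epsilon> * M" by (simp add: M_def algebra_simps sum_distrib_left)
    finally show ?thesis .
  qed
  have "F \<i> \<noteq> 0"
  proof -
    have "\<i> \<noteq> complex_of_real x" for x by (simp add: complex_eq_iff)
    then show ?thesis using fin by (simp add: F_def poly_prod)
  qed
  then have pos: "cmod (F \<i>) > 0" by simp
  then have "cmod (F \<i>) / (2 * (M + 1)) > 0" using M by simp
  from small[OF this] have "cmod (F \<i>) \<le> cmod (F \<i>) * (M / (2 * (M + 1)))" by simp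
  also have "\<dots> < cmod (F \<i>) * 1" using pos M by (intro mult_strict_left_mono) auto
  finally show False by simp
qed

text \<open>
  The head condition carries over directly. In the tail condition, points of the same modulus as \<open>s j\<close> may come
  after \<open>s j\<close> in the enumeration; they are bounded by the head condition, which doubles the constant. If
  \<open>s 0 = 0\<close>, regularity at this point says nothing about the tail, because of the factor \<open>(t n)\<^sup>2\<close>, and the
  constant is enlarged so as to cover the finite sum over all other points.
\<close>

theorem regular_lacunary_data_give_spectral_basis:
  assumes sd: "spectral_data E I t \<nu>" and reg: "regular_spectral_data I t \<nu>" and lac: "lacunary I t"
  obtains e s p \<nu>' c \<kappa> A where "spectral_basis E e s p \<nu>' c \<kappa> A"
proof -
  have conv: "\<forall>a\<in>I. \<forall>b\<in>I. {a..b} \<subseteq> I" and mono: "strict_mono_on I t"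
    and \<nu>_pos: "\<And>n. n \<in> I \<Longrightarrow> \<nu> n > 0" and summ: "(\<lambda>n. \<nu> n / (1 + (t n)\<^sup>2)) summable_on I"
    using sd by (auto simp: spectral_data_def)
  obtain A where A: "entire A" and zeros: "{z. A z = 0} = (\<lambda>n. of_real (t n)) ` I"
    and zord': "\<forall>n\<in>I. zorder A (of_real (t n)) = 1"
    and basis: "orthonormal_basis E I (\<lambda>n z. of_real (sqrt (\<nu> n)) *
       (if z = of_real (t n) then deriv A z else A z / (z - of_real (t n))))"
    using sd unfolding spectral_data_def by (elim exE conjE) (rule that)
  have zord: "\<And>n. n \<in> I \<Longrightarrow> zorder A (of_real (t n)) = 1" using zord' by blast
  have inj: "inj_on t I" by (rule strict_mono_on_imp_inj_on[OF mono])
  have A0: "A (of_real (t n)) = 0" if "n \<in> I" for n using zeros that by auto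
  have "A \<i> \<noteq> 0"
  proof
    assume "A \<i> = 0"
    then obtain n where "\<i> = complex_of_real (t n)" using zeros by auto
    then show False by (simp add: complex_eq_iff)
  qed
  then have dA: "deriv A (of_real (t n)) \<noteq> 0" if "n \<in> I" for n
    using deriv_nonzero_at_simple_zero[OF A A0[OF that] zord[OF that]] by blast
  have "infinite I" by (rule infinite_index_set[OF basis A0 dA \<nu>_pos inj])
  from enumeration_by_size[OF this finite_sublevels[OF sd]]
  obtain \<sigma> :: "nat \<Rightarrow> int" where \<sigma>: "bij_betw \<sigma> UNIV I" "\<And>i j. i \<le> j \<Longrightarrow> \<bar>t (\<sigma> i)\<bar> \<le> \<bar>t (\<sigma> j)\<bar>" by blast
  have \<sigma>I: "\<sigma> i \<in> I" for i using \<sigma>(1) by (auto simp: bij_betw_def)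
  have \<sigma>_inj: "inj \<sigma>" using \<sigma>(1) by (simp add: bij_betw_def)
  have \<sigma>_range: "\<sigma> ` UNIV = I" using \<sigma>(1) by (simp add: bij_betw_def)
  define s where "s i = t (\<sigma> i)" for i
  have s_mono: "\<bar>s i\<bar> \<le> \<bar>s j\<bar>" if "i \<le> j" for i j using \<sigma>(2)[OF that] by (simp add: s_def)
  have s_inj: "s i \<noteq> s j" if "i \<noteq> j" for i j
    using inj \<sigma>I \<sigma>_inj that unfolding s_def inj_on_def by blast
  have s_ne0: "s i \<noteq> 0" if "i \<ge> 1" for i
  proof
    assume "s i = 0"
    then have "s 0 = 0" using s_mono[of 0 i] by simp
    then show False using s_inj[of 0 i] \<open>s i = 0\<close> that by simp
  qed
  define p where "p i = (if s i = 0 then \<bar>s 1\<bar> else \<bar>s i\<bar>)" for i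
  have p_pos: "p i > 0" for i using s_ne0[of 1] by (simp add: p_def)
  have p_eq: "\<bar>s i\<bar> = p i" if "s i \<noteq> 0" for i using that by (simp add: p_def)
  have s_0: "s i = 0 \<Longrightarrow> i = 0" for i using s_ne0[of i] by (cases i) auto
  have p_mono: "p i \<le> p j" if ij: "i \<le> j" for i j
  proof (cases "s i = 0")
    case True
    then have i: "i = 0" by (rule s_0)
    show ?thesis
    proof (cases "j = 0")
      case False
      then show ?thesis using True s_ne0[of j] s_mono[of 1 j] by (simp add: p_def)
    qed (use i in simp)
  next
    case False
    then have "s j \<noteq> 0" using s_mono[OF ij] by auto
    then show ?thesis using False s_mono[OF ij] by (simp add: p_def)
  qed
  obtain c where c: "c > 0" and cn: "\<And>n. n \<in> I \<Longrightarrow>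
        (\<Sum>\<^sub>\<infinity>k\<in>{k\<in>I. \<bar>t k\<bar> \<le> \<bar>t n\<bar>}. \<nu> k)
        + (t n)\<^sup>2 * (\<Sum>\<^sub>\<infinity>k\<in>{k\<in>I. \<bar>t k\<bar> > \<bar>t n\<bar>}. \<nu> k / (t k)\<^sup>2) \<le> c * \<nu> n"
    using reg unfolding regular_spectral_data_def by blast
  have summ2: "(\<lambda>k. \<nu> k / (t k)\<^sup>2) summable_on {k\<in>I. \<bar>t k\<bar> > x}" if x: "x \<ge> 0" for x
  proof (rule summable_on_comparison_test)
    have "(\<lambda>k. (1 + 1 / (p 0)\<^sup>2) * (\<nu> k / (1 + (t k)\<^sup>2))) summable_on I" by (intro summable_on_cmult_right summ)
    then show "(\<lambda>k. (1 + 1 / (p 0)\<^sup>2) * (\<nu> k / (1 + (t k)\<^sup>2))) summable_on {k\<in>I. \<bar>t k\<bar> > x}"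
      by (rule summable_on_subset) auto
    fix k assume k: "k \<in> {k\<in>I. \<bar>t k\<bar> > x}"
    then obtain i where i: "k = \<sigma> i" using \<sigma>_range by auto
    have "t k \<noteq> 0" using k x by auto
    then have "p 0 \<le> \<bar>t k\<bar>" using p_mono[of 0 i] p_eq[of i] by (simp add: i s_def)
    then have sq: "(p 0)\<^sup>2 \<le> (t k)\<^sup>2" using p_pos[of 0] abs_le_square_iff[of "p 0" "t k"] by simp
    have "\<nu> k / (t k)\<^sup>2 = (1 + 1 / (t k)\<^sup>2) * (\<nu> k / (1 + (t k)\<^sup>2))"
    proof -
      have "1 + (t k)\<^sup>2 > 0" by (simp add: add_pos_nonneg)
      moreover have "1 + 1 / (t k)\<^sup>2 = (1 + (t k)\<^sup>2) / (t k)\<^sup>2" using \<open>t k \<noteq> 0\<close> by (simp add: add_divide_distrib)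
      ultimately show ?thesis by simp
    qed
    also have "\<dots> \<le> (1 + 1 / (p 0)\<^sup>2) * (\<nu> k / (1 + (t k)\<^sup>2))"
      using sq p_pos[of 0] \<nu>_pos[of k] k \<open>t k \<noteq> 0\<close>
      by (intro mult_right_mono add_left_mono divide_left_mono) (auto simp: add_nonneg_nonneg)
    finally show "\<nu> k / (t k)\<^sup>2 \<le> (1 + 1 / (p 0)\<^sup>2) * (\<nu> k / (1 + (t k)\<^sup>2))" .
    show "0 \<le> \<nu> k / (t k)\<^sup>2" using \<nu>_pos[of k] k by simp
  qed
  define T where "T n = (\<Sum>\<^sub>\<infinity>k\<in>{k\<in>I. \<bar>t k\<bar> > \<bar>t n\<bar>}. \<nu> k / (t k)\<^sup>2)" for n
  have T0: "T n \<ge> 0" for n unfolding T_def using \<nu>_pos by (intro infsum_nonneg) (auto simp: less_imp_le)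
  have T_ge: "(\<Sum>k\<in>K. \<nu> k / (t k)\<^sup>2) \<le> T n" if "finite K" "K \<subseteq> {k\<in>I. \<bar>t k\<bar> > \<bar>t n\<bar>}" for K n
    unfolding T_def using that \<nu>_pos by (intro finite_sum_le_infsum summ2) (auto simp: less_imp_le)
  have head: "(\<Sum>k\<in>K. \<nu> k) \<le> c * \<nu> n" if n: "n \<in> I" and K: "K \<subseteq> {k\<in>I. \<bar>t k\<bar> \<le> \<bar>t n\<bar>}" for K n
  proof -
    have fin: "finite {k\<in>I. \<bar>t k\<bar> \<le> \<bar>t n\<bar>}" by (rule finite_sublevels[OF sd])
    have "(\<Sum>k\<in>K. \<nu> k) \<le> (\<Sum>k\<in>{k\<in>I. \<bar>t k\<bar> \<le> \<bar>t n\<bar>}. \<nu> k)"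
      using K \<nu>_pos by (intro sum_mono2 fin) (auto simp: less_imp_le)
    also have "\<dots> \<le> c * \<nu> n"
      using cn[OF n] fin mult_nonneg_nonneg[OF zero_le_power2 T0[of n], of "t n"] by (simp add: T_def)
    finally show ?thesis .
  qed
  have tail: "(t n)\<^sup>2 * T n \<le> c * \<nu> n" if n: "n \<in> I" for n
  proof -
    have "(\<Sum>\<^sub>\<infinity>k\<in>{k\<in>I. \<bar>t k\<bar> \<le> \<bar>t n\<bar>}. \<nu> k) \<ge> 0" using \<nu>_pos by (intro infsum_nonneg) (auto simp: less_imp_le)
    then show ?thesis using cn[OF n] by (simp add: T_def)
  qed
  define c' where "c' = 1 + 2 * c + T (\<sigma> 0) * (p 0)\<^sup>2 / \<nu> (\<sigma> 0)"
  have nu': "\<nu> (\<sigma> i) > 0" for i by (rule \<nu>_pos[OF \<sigma>I])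
  have extra: "T (\<sigma> 0) * (p 0)\<^sup>2 / \<nu> (\<sigma> 0) \<ge> 0" using T0 nu'[of 0] by simp
  have c'_ge: "c' \<ge> 1" "c' \<ge> 2 * c" "c' \<ge> c" "c' \<ge> T (\<sigma> 0) * (p 0)\<^sup>2 / \<nu> (\<sigma> 0)"
    using c extra by (auto simp: c'_def)
  obtain \<kappa> where \<kappa>: "\<kappa> > 0" "\<forall>n. n \<in> I \<longrightarrow> n + 1 \<in> I \<longrightarrow> t (n + 1) - t n \<ge> \<kappa> * \<bar>t n\<bar>"
    using lac unfolding lacunary_def by blast
  define e where "e i z = of_real (sqrt (\<nu> (\<sigma> i))) *
       (if z = of_real (s i) then deriv A z else A z / (z - of_real (s i)))" for i z
  have points: "regular_points s p (\<lambda>i. \<nu> (\<sigma> i)) c' (\<kappa> / (1 + \<kappa>))"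
  proof
    show "p i > 0" for i by (rule p_pos)
    show "p i \<le> p j" if "i \<le> j" for i j using that by (rule p_mono)
    show "\<bar>s i\<bar> \<le> p i" for i by (simp add: p_def)
    show "\<bar>s i\<bar> = p i" if "i \<ge> 1" for i using p_eq[OF s_ne0[OF that]] .
    show "\<nu> (\<sigma> i) > 0" for i by (rule nu')
    show "c' \<ge> 1" by (rule c'_ge)
    show "\<kappa> / (1 + \<kappa>) > 0" using \<kappa> by simp
    show "\<bar>s j - s i\<bar> \<ge> \<kappa> / (1 + \<kappa>) * p j" if ij: "i < j" for i j
    proof -
      have "\<sigma> i \<noteq> \<sigma> j" using \<sigma>_inj ij by (auto dest: injD)
      then have "\<bar>s i - s j\<bar> \<ge> \<kappa> / (1 + \<kappa>) * \<bar>s j\<bar>"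
        unfolding s_def by (rule lacunary_separation[OF conv mono \<kappa> \<sigma>I \<sigma>I])
      then show ?thesis using p_eq[OF s_ne0[of j]] ij by (simp add: abs_minus_commute)
    qed
    show "(\<Sum>i\<le>j. \<nu> (\<sigma> i)) \<le> c' * \<nu> (\<sigma> j)" for j
    proof -
      have "(\<Sum>i\<le>j. \<nu> (\<sigma> i)) = (\<Sum>k\<in>\<sigma> ` {..j}. \<nu> k)"
        using \<sigma>_inj by (subst sum.reindex) (auto intro: inj_on_subset)
      also have "\<dots> \<le> c * \<nu> (\<sigma> j)" by (rule head[OF \<sigma>I]) (use \<sigma>I \<sigma>(2) in auto)
      also have "\<dots> \<le> c' * \<nu> (\<sigma> j)" using c'_ge nu'[of j] by (intro mult_right_mono) auto
      finally show ?thesis .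
    qed
    show "(\<Sum>i=Suc j..m. \<nu> (\<sigma> i) / (p i)\<^sup>2) \<le> c' * (\<nu> (\<sigma> j) / (p j)\<^sup>2)" for j m
    proof -
      let ?K = "\<sigma> ` {Suc j..m}"
      have p2: "(p i)\<^sup>2 = (t (\<sigma> i))\<^sup>2" if "i \<ge> 1" for i
        using p_eq[OF s_ne0[OF that]] by (metis power2_abs s_def)
      have "(\<Sum>i=Suc j..m. \<nu> (\<sigma> i) / (p i)\<^sup>2) = (\<Sum>i=Suc j..m. \<nu> (\<sigma> i) / (t (\<sigma> i))\<^sup>2)"
        by (intro sum.cong) (auto simp: p2)
      also have "\<dots> = (\<Sum>k\<in>?K. \<nu> k / (t k)\<^sup>2)"
        using \<sigma>_inj by (subst sum.reindex) (auto intro: inj_on_subset)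
      finally have eq: "(\<Sum>i=Suc j..m. \<nu> (\<sigma> i) / (p i)\<^sup>2) = (\<Sum>k\<in>?K. \<nu> k / (t k)\<^sup>2)" .
      have K_ge: "k \<in> I \<and> \<bar>t (\<sigma> j)\<bar> \<le> \<bar>t k\<bar>" if "k \<in> ?K" for k using that \<sigma>I \<sigma>(2) by auto
      show ?thesis
      proof (cases "s j = 0")
        case True
        then have j: "j = 0" by (rule s_0)
        have "?K \<subseteq> {k\<in>I. \<bar>t k\<bar> > \<bar>t (\<sigma> 0)\<bar>}"
          using True j s_ne0 \<sigma>I by (auto simp: s_def)
        then have "(\<Sum>k\<in>?K. \<nu> k / (t k)\<^sup>2) \<le> T (\<sigma> 0)" by (intro T_ge) auto
        also have "\<dots> = (T (\<sigma> 0) * (p 0)\<^sup>2 / \<nu> (\<sigma> 0)) * (\<nu> (\<sigma> 0) / (p 0)\<^sup>2)"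
          using p_pos[of 0] nu'[of 0] by simp
        also have "\<dots> \<le> c' * (\<nu> (\<sigma> 0) / (p 0)\<^sup>2)"
          using c'_ge nu'[of 0] by (intro mult_right_mono) auto
        finally show ?thesis unfolding eq using j by simp
      next
        case False
        let ?K1 = "{k\<in>?K. \<bar>t k\<bar> > \<bar>t (\<sigma> j)\<bar>}" and ?K2 = "{k\<in>?K. \<not> \<bar>t k\<bar> > \<bar>t (\<sigma> j)\<bar>}"
        have tj: "(t (\<sigma> j))\<^sup>2 > 0" using False by (simp add: s_def)
        have "(\<Sum>k\<in>?K. \<nu> k / (t k)\<^sup>2) = (\<Sum>k\<in>?K1. \<nu> k / (t k)\<^sup>2) + (\<Sum>k\<in>?K2. \<nu> k / (t k)\<^sup>2)"
          by (subst sum.union_disjoint[symmetric]) (auto intro!: sum.cong)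
        also have "(\<Sum>k\<in>?K1. \<nu> k / (t k)\<^sup>2) \<le> T (\<sigma> j)" by (rule T_ge) (use K_ge in auto)
        also have "T (\<sigma> j) \<le> c * \<nu> (\<sigma> j) / (t (\<sigma> j))\<^sup>2"
          using tail[OF \<sigma>I[of j]] tj by (simp add: pos_le_divide_eq mult.commute)
        also have "(\<Sum>k\<in>?K2. \<nu> k / (t k)\<^sup>2) = (\<Sum>k\<in>?K2. \<nu> k / (t (\<sigma> j))\<^sup>2)"
        proof (rule sum.cong)
          fix k assume "k \<in> ?K2"
          then have "\<bar>t k\<bar> = \<bar>t (\<sigma> j)\<bar>" using K_ge[of k] by auto
          then have "(t k)\<^sup>2 = (t (\<sigma> j))\<^sup>2" by (metis power2_abs)
          then show "\<nu> k / (t k)\<^sup>2 = \<nu> k / (t (\<sigma> j))\<^sup>2" by simp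
        qed simp
        also have "\<dots> = (\<Sum>k\<in>?K2. \<nu> k) / (t (\<sigma> j))\<^sup>2" by (simp add: sum_divide_distrib)
        also have "(\<Sum>k\<in>?K2. \<nu> k) / (t (\<sigma> j))\<^sup>2 \<le> c * \<nu> (\<sigma> j) / (t (\<sigma> j))\<^sup>2"
        proof (rule divide_right_mono)
          show "(\<Sum>k\<in>?K2. \<nu> k) \<le> c * \<nu> (\<sigma> j)" by (rule head[OF \<sigma>I]) (use K_ge in auto)
        qed simp
        also have "c * \<nu> (\<sigma> j) / (t (\<sigma> j))\<^sup>2 + c * \<nu> (\<sigma> j) / (t (\<sigma> j))\<^sup>2 = 2 * c * (\<nu> (\<sigma> j) / (t (\<sigma> j))\<^sup>2)"
          by simp
        also have "\<dots> \<le> c' * (\<nu> (\<sigma> j) / (t (\<sigma> j))\<^sup>2)"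
          using c'_ge nu'[of j] by (intro mult_right_mono) auto
        also have "(t (\<sigma> j))\<^sup>2 = (p j)\<^sup>2" using p_eq[OF False] by (metis power2_abs s_def)
        finally show ?thesis unfolding eq by simp
      qed
    qed
  qed
  have e_\<sigma>: "e i = (\<lambda>z. of_real (sqrt (\<nu> (\<sigma> i))) *
       (if z = of_real (t (\<sigma> i)) then deriv A z else A z / (z - of_real (t (\<sigma> i)))))" for i
    by (rule ext) (simp only: e_def s_def)
  have onb: "de_Branges_basis_axioms E e"
  proof
    show "e n \<in> H" for n
      using basis \<sigma>I[of n] unfolding orthonormal_basis_def e_\<sigma> by blast
    show "ip (e m) (e n) = (if m = n then 1 else 0)" for m n
      using basis \<sigma>I[of n] \<sigma>I[of m] inj_eq[OF \<sigma>_inj, of m n] unfolding orthonormal_basis_def e_\<sigma> by auto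
    fix F and \<epsilon> :: real assume "F \<in> H" "\<epsilon> > 0"
    then obtain J b where J: "finite J" "J \<subseteq> I"
      "nrm (\<lambda>z. F z - (\<Sum>n\<in>J. b n * (of_real (sqrt (\<nu> n)) *
       (if z = of_real (t n) then deriv A z else A z / (z - of_real (t n)))))) < \<epsilon>"
      using basis unfolding orthonormal_basis_def by blast
    define J' where "J' = \<sigma> -` J"
    have J': "finite J'" "\<sigma> ` J' = J"
      using J \<sigma>_inj \<sigma>_range by (auto simp: J'_def finite_vimageI)
    have "(\<Sum>n\<in>J. b n * (of_real (sqrt (\<nu> n)) * (if z = of_real (t n) then deriv A z else A z / (z - of_real (t n)))))
        = (\<Sum>n\<in>J'. b (\<sigma> n) * e n z)" for z
      unfolding J'(2)[symmetric] using \<sigma>_inj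
      by (subst sum.reindex) (auto intro: inj_on_subset simp: e_\<sigma>)
    then show "\<exists>J c. finite J \<and> nrm (\<lambda>z. F z - (\<Sum>n\<in>J. c n * e n z)) < \<epsilon>"
      using J(3) J'(1) by (intro exI[of _ J'] exI[of _ "\<lambda>n. b (\<sigma> n)"]) simp
  qed
  have "spectral_basis_axioms e s (\<lambda>i. \<nu> (\<sigma> i)) A"
  proof
    show "entire A" by (rule A)
    show "{z. A z = 0} = range (\<lambda>n. of_real (s n))"
      unfolding zeros s_def \<sigma>_range[symmetric] by (simp add: image_image)
    show "deriv A (of_real (s n)) \<noteq> 0" for n using dA[OF \<sigma>I[of n]] by (simp add: s_def)
    show "e n z = of_real (sqrt (\<nu> (\<sigma> n))) *
       (if z = of_real (s n) then deriv A z else A z / (z - of_real (s n)))" for n z by (simp add: e_def)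
  qed
  then have "spectral_basis E e s p (\<lambda>i. \<nu> (\<sigma> i)) c' (\<kappa> / (1 + \<kappa>)) A"
    by (rule spectral_basis.intro[OF de_Branges_basis.intro[OF de_Branges_with_polynomials_axioms onb] points])
  then show ?thesis by (rule that)
qed

end

section \<open>Hausdorff operators as diagonal operators\<close>

lemma powi_minus_nat: "of_real u powi (- int k) = (1 / of_real u :: complex) ^ k"
  by (simp add: power_int_minus power_divide inverse_eq_divide)

abbreviation moment :: "real measure \<Rightarrow> (real \<Rightarrow> complex) \<Rightarrow> nat \<Rightarrow> complex" where
  "moment \<mu> \<Phi> n \<equiv> LINT u|completion \<mu>. \<Phi> u * of_real u powi (- int n)"

text \<open>
  Since \<open>\<Phi>\<close> vanishes on \<open>(0, \<delta>)\<close>, the \<open>k\<close>-th term of the Taylor series at \<open>z / u\<close> is bounded on the support of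
  \<open>\<Phi>\<close> by the \<open>k\<close>-th term at \<open>|z| / \<delta>\<close>, and the series may be integrated term by term.
\<close>

lemma hausdorff_power_series:
  assumes sets: "sets \<mu> = sets (restrict_space borel {0<..})"
    and \<delta>: "\<delta> > 0" "AE u in \<mu>. u < \<delta> \<longrightarrow> \<Phi> u = 0"
    and int: "\<And>n. integrable (completion \<mu>) (\<lambda>u. \<Phi> u * of_real u powi (- int n))"
    and F: "entire F"
  shows "integrable (completion \<mu>) (\<lambda>u. \<Phi> u * F (z / of_real u))"
    and "(\<lambda>k. moment \<mu> \<Phi> k * taylor F k * z ^ k)
           sums hausdorff_op \<mu> \<Phi> F z"
proof -
  let ?M = "completion \<mu>"
  define f where "f k u = taylor F k * z ^ k * (\<Phi> u * of_real u powi (- int k))" for k u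
  have f_alt: "f k u = \<Phi> u * (taylor F k * (z / of_real u) ^ k)" for k u
    by (simp add: f_def powi_minus_nat power_divide)
  have absum: "summable (\<lambda>k. norm (taylor F k * w ^ k))" for w
    by (rule powser_insidea[of "taylor F" "of_real (norm w + 1)"])
       (use taylor_sums[OF F] in \<open>auto simp: sums_iff\<close>)
  have sumf: "(\<Sum>k. f k u) = \<Phi> u * F (z / of_real u)" for u
    using sums_mult[OF taylor_sums[OF F, of "z / of_real u"], of "\<Phi> u"] by (simp add: f_alt sums_iff)
  have int_f: "integrable ?M (f k)" for k
    unfolding f_def by (rule integrable_mult_right[OF int])
  have absum_f: "AE u in ?M. summable (\<lambda>k. norm (f k u))"
  proof (rule AE_I2)
    fix u
    show "summable (\<lambda>k. norm (f k u))"
      using summable_mult[OF absum[of "z / of_real u"], of "norm (\<Phi> u)"] by (simp add: f_alt norm_mult)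
  qed
  have int0: "integrable ?M (\<lambda>u. norm (\<Phi> u))" using integrable_norm[OF int[of 0]] by simp
  have AE_\<delta>: "AE u in ?M. u < \<delta> \<longrightarrow> \<Phi> u = 0" using AE_completion[OF \<delta>(2)] .
  have bound: "(LINT u|?M. norm (f k u)) \<le> (LINT u|?M. norm (\<Phi> u)) * norm (taylor F k * (of_real (norm z / \<delta>)) ^ k)" for k
  proof -
    have "(LINT u|?M. norm (f k u)) \<le> (LINT u|?M. norm (\<Phi> u) * norm (taylor F k * (of_real (norm z / \<delta>)) ^ k))"
    proof (rule integral_mono_AE)
      show "AE u in ?M. norm (f k u) \<le> norm (\<Phi> u) * norm (taylor F k * (of_real (norm z / \<delta>)) ^ k)"
        using AE_\<delta>
      proof eventually_elim
        case (elim u)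
        show ?case
        proof (cases "u < \<delta>")
          case True then show ?thesis using elim by (simp add: f_alt)
        next
          case False
          then have "norm z / u \<le> norm z / \<delta>" using \<delta>(1) by (intro divide_left_mono) auto
          then have "(norm z / u) ^ k \<le> (norm z / \<delta>) ^ k" using False \<delta>(1) by (intro power_mono) auto
          then have "norm (\<Phi> u) * (norm (taylor F k) * (norm z / u) ^ k) \<le> norm (\<Phi> u) * (norm (taylor F k) * (norm z / \<delta>) ^ k)"
            by (intro mult_left_mono) auto
          then show ?thesis using False \<delta>(1) by (simp add: f_alt norm_mult norm_power norm_divide del: of_real_divide)
        qed
      qed
    qed (use int_f int0 in \<open>auto intro: integrable_norm\<close>)
    then show ?thesis by simp
  qed
  have sum_int: "summable (\<lambda>k. LINT u|?M. norm (f k u))"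
  proof (rule summable_comparison_test')
    show "summable (\<lambda>k. (LINT u|?M. norm (\<Phi> u)) * norm (taylor F k * (of_real (norm z / \<delta>)) ^ k))"
      by (intro summable_mult absum)
    show "norm (LINT u|?M. norm (f k u)) \<le> (LINT u|?M. norm (\<Phi> u)) * norm (taylor F k * (of_real (norm z / \<delta>)) ^ k)" if "k \<ge> 0" for k
      using bound[of k] by (simp add: integral_nonneg_AE)
  qed
  show "integrable ?M (\<lambda>u. \<Phi> u * F (z / of_real u))"
    using integrable_suminf[OF int_f absum_f sum_int] by (simp add: sumf)
  have "(\<lambda>k. LINT u|?M. f k u) sums hausdorff_op \<mu> \<Phi> F z"
    using sums_integral[OF int_f absum_f sum_int] by (simp add: sumf hausdorff_op_def)
  moreover have "(LINT u|?M. f k u) = (LINT u|?M. \<Phi> u * of_real u powi (- int k)) * taylor F k * z ^ k" for k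
    unfolding f_def by (subst integral_mult_right_zero) (simp add: mult_ac)
  ultimately show "(\<lambda>k. (LINT u|?M. \<Phi> u * of_real u powi (- int k)) * taylor F k * z ^ k) sums hausdorff_op \<mu> \<Phi> F z"
    by simp
qed

lemma hausdorff_op_monomial:
  "hausdorff_op \<mu> \<Phi> (\<lambda>z. a * z ^ n) = (\<lambda>z. a * moment \<mu> \<Phi> n * z ^ n)"
proof
  fix z
  have "hausdorff_op \<mu> \<Phi> (\<lambda>z. a * z ^ n) z
      = (LINT u|completion \<mu>. (a * z ^ n) * (\<Phi> u * of_real u powi (- int n)))"
    unfolding hausdorff_op_def by (simp add: powi_minus_nat power_divide mult_ac)
  also have "\<dots> = (a * z ^ n) * moment \<mu> \<Phi> n"
    by (rule integral_mult_right_zero)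
  finally show "hausdorff_op \<mu> \<Phi> (\<lambda>z. a * z ^ n) z = a * moment \<mu> \<Phi> n * z ^ n"
    by (simp only: mult_ac)
qed

lemma taylor_monomial: "taylor (\<lambda>z. a * z ^ n) k = (if k = n then a else 0)"
proof -
  have "(\<lambda>k. (if k = n then a else 0) * z ^ k) sums (a * z ^ n)" for z
    using sums_single[of n "\<lambda>k. a * z ^ k"] by (rule sums_cong[THEN iffD1, rotated]) auto
  from power_series_entire(2)[OF this] show ?thesis by simp
qed

context spectral_basis
begin

lemma weighted_taylor_tendsto_0:
  assumes F: "F \<in> H" shows "(\<lambda>k. \<omega> k * cmod (taylor F k)) \<longlonglongrightarrow> 0"
proof -
  obtain C where "C > 0" and C: "\<And>F K. F \<in> H \<Longrightarrow> coeff_energy F K \<le> C * (nrm F)\<^sup>2"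
    using taylor_coefficients_bounded by blast
  have "summable (\<lambda>k. (\<omega> k * cmod (taylor F k))\<^sup>2)"
    by (rule summableI_nonneg_bounded[of _ "C * (nrm F)\<^sup>2"]) (use C[OF F] in auto)
  then have "(\<lambda>k. (\<omega> k * cmod (taylor F k))\<^sup>2) \<longlonglongrightarrow> 0" by (rule summable_LIMSEQ_zero)
  from tendsto_real_sqrt[OF this] show ?thesis using \<omega>_pos by (simp add: less_imp_le)
qed

text \<open>
  Suppose \<open>|\<Lambda> k| \<ge> \<epsilon>\<close> for infinitely many \<open>k\<close>. The functions \<open>z\<^sup>k / \<omega> k\<close> are bounded in norm, and their images have
  \<open>k\<close>-th weighted coefficient \<open>\<Lambda> k\<close>. The weighted coefficients of a limit \<open>G\<close> of images tend to zero, so near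
  the limit the images could not have coefficients of modulus at least \<open>\<epsilon>\<close> with \<open>k\<close> tending to infinity.
\<close>

lemma compact_imp_moments_tendsto_0:
  fixes \<mu> :: "real measure" and \<Phi> :: "real \<Rightarrow> complex"
  defines "\<Lambda> \<equiv> \<lambda>n::nat. moment \<mu> \<Phi> n"
  assumes compact: "hausdorff_compact E \<mu> \<Phi>"
  shows "integrable (completion \<mu>) (\<lambda>u. \<Phi> u * of_real u powi (- int n))" and "\<Lambda> \<longlonglongrightarrow> 0"
proof -
  have mono_H: "(\<lambda>z. a * z ^ n) \<in> H" for a n
    using polynomials[of "monom a n"] by (simp add: poly_monom[abs_def])
  have def': "\<forall>F\<in>H. hausdorff_defined \<mu> \<Phi> F" and clo: "compact_linear_operator E (hausdorff_op \<mu> \<Phi>)"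
    using compact by (auto simp: hausdorff_compact_def)
  have "integrable (completion \<mu>) (\<lambda>u. \<Phi> u * (1 * (1 / of_real u) ^ n))"
    using def'[rule_format, OF mono_H[of 1 n]] unfolding hausdorff_defined_def by (rule spec)
  then show "integrable (completion \<mu>) (\<lambda>u. \<Phi> u * of_real u powi (- int n))"
    by (simp only: powi_minus_nat mult_1)
  obtain C where C: "C > 0"
    and C1: "\<And>F K. F \<in> H \<Longrightarrow> coeff_energy F K \<le> C * (nrm F)\<^sup>2"
    and "\<And>G B. entire G \<Longrightarrow> (\<forall>K. coeff_energy G K \<le> B) \<Longrightarrow> G \<in> H"
    and C2: "\<And>G B. entire G \<Longrightarrow> (\<forall>K. coeff_energy G K \<le> B) \<Longrightarrow> (nrm G)\<^sup>2 \<le> C * B"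
    using monomials_riesz_basis by blast
  show "\<Lambda> \<longlonglongrightarrow> 0"
  proof (rule ccontr)
    assume "\<not> \<Lambda> \<longlonglongrightarrow> 0"
    then obtain \<epsilon> where \<epsilon>: "\<epsilon> > 0" "\<And>N. \<exists>n\<ge>N. cmod (\<Lambda> n) \<ge> \<epsilon>"
      unfolding LIMSEQ_iff by (auto simp: not_less)
    then have inf: "infinite {n. cmod (\<Lambda> n) \<ge> \<epsilon>}" unfolding infinite_nat_iff_unbounded_le by blast
    define q where "q = enumerate {n. cmod (\<Lambda> n) \<ge> \<epsilon>}"
    have q: "strict_mono q" "\<And>j. cmod (\<Lambda> (q j)) \<ge> \<epsilon>"
      using strict_mono_enumerate[OF inf] enumerate_in_set[OF inf] by (auto simp: q_def)
    define F where "F j z = of_real (1 / \<omega> (q j)) * z ^ q j" for j and z :: complex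
    have FH: "F j \<in> H" for j unfolding F_def[abs_def] by (rule mono_H)
    have TF: "hausdorff_op \<mu> \<Phi> (F j) = (\<lambda>z. of_real (1 / \<omega> (q j)) * \<Lambda> (q j) * z ^ q j)" for j
      unfolding F_def[abs_def] \<Lambda>_def by (rule hausdorff_op_monomial)
    have bounded: "nrm (F j) \<le> sqrt C" for j
    proof (rule real_le_rsqrt)
      have "coeff_energy (F j) K \<le> 1" for K
      proof -
        have "coeff_energy (F j) K = (\<Sum>k<K. if k = q j then 1 else 0)"
          unfolding F_def[abs_def] taylor_monomial using \<omega>_pos[of "q j"]
          by (intro sum.cong) (auto simp: norm_divide)
        also have "\<dots> \<le> 1" by simp
        finally show ?thesis .
      qed
      from C2[OF entire_H[OF FH] allI[OF this]] show "(nrm (F j))\<^sup>2 \<le> C" by simp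
    qed
    obtain r G where r: "strict_mono (r :: nat \<Rightarrow> nat)" and G: "G \<in> H"
      and lim: "(\<lambda>j. nrm (\<lambda>z. hausdorff_op \<mu> \<Phi> (F (r j)) z - G z)) \<longlonglongrightarrow> 0"
      using clo FH bounded unfolding compact_linear_operator_def by blast
    define k where "k j = q (r j)" for j
    have k_mono: "strict_mono k" using strict_mono_compose[OF q(1) r] unfolding k_def[abs_def] .
    have TH: "hausdorff_op \<mu> \<Phi> (F j) \<in> H" for j
      using clo FH unfolding compact_linear_operator_def by blast
    have le: "\<epsilon> - \<omega> (k j) * cmod (taylor G (k j)) \<le> sqrt C * nrm (\<lambda>z. hausdorff_op \<mu> \<Phi> (F (r j)) z - G z)" for j
    proof -
      let ?D = "\<lambda>z. hausdorff_op \<mu> \<Phi> (F (r j)) z - G z"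
      have DH: "?D \<in> H" by (intro H_diff TH G)
      have "taylor ?D (k j) = taylor (hausdorff_op \<mu> \<Phi> (F (r j))) (k j) - taylor G (k j)"
        using taylor_diff_scale[OF entire_H[OF TH] entire_H[OF G], of "r j" 1 "k j"] by simp
      also have "taylor (hausdorff_op \<mu> \<Phi> (F (r j))) (k j) = of_real (1 / \<omega> (k j)) * \<Lambda> (k j)"
        unfolding TF taylor_monomial by (simp add: k_def)
      finally have eq: "taylor ?D (k j) = of_real (1 / \<omega> (k j)) * \<Lambda> (k j) - taylor G (k j)" .
      have "(\<omega> (k j) * cmod (taylor ?D (k j)))\<^sup>2 \<le> (\<Sum>i<Suc (k j). (\<omega> i * cmod (taylor ?D i))\<^sup>2)"
        by (rule member_le_sum) auto
      also have "\<dots> \<le> C * (nrm ?D)\<^sup>2" by (rule C1[OF DH])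
      also have "\<dots> = (sqrt C * nrm ?D)\<^sup>2" using C by (simp add: power_mult_distrib)
      finally have "\<omega> (k j) * cmod (taylor ?D (k j)) \<le> sqrt C * nrm ?D"
        by (rule power2_le_imp_le) (use C nrm_nonneg in auto)
      moreover have "cmod (\<Lambda> (k j)) - \<omega> (k j) * cmod (taylor G (k j)) \<le> \<omega> (k j) * cmod (taylor ?D (k j))"
      proof -
        have "cmod (of_real (1 / \<omega> (k j)) * \<Lambda> (k j)) - cmod (taylor G (k j)) \<le> cmod (taylor ?D (k j))"
          unfolding eq by (rule norm_triangle_ineq2)
        then have "\<omega> (k j) * (cmod (of_real (1 / \<omega> (k j)) * \<Lambda> (k j)) - cmod (taylor G (k j))) \<le> \<omega> (k j) * cmod (taylor ?D (k j))"
          using \<omega>_pos[of "k j"] by (intro mult_left_mono) auto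
        then show ?thesis using \<omega>_pos[of "k j"] by (simp add: norm_mult norm_divide right_diff_distrib)
      qed
      ultimately show ?thesis using q(2)[of "r j"] by (simp add: k_def)
    qed
    have "(\<lambda>j. \<omega> (k j) * cmod (taylor G (k j))) \<longlonglongrightarrow> 0"
      using LIMSEQ_subseq_LIMSEQ[OF weighted_taylor_tendsto_0[OF G] k_mono] by (simp add: o_def)
    then have "(\<lambda>j. \<epsilon> - \<omega> (k j) * cmod (taylor G (k j))) \<longlonglongrightarrow> \<epsilon> - 0" by (intro tendsto_intros)
    moreover have "(\<lambda>j. sqrt C * nrm (\<lambda>z. hausdorff_op \<mu> \<Phi> (F (r j)) z - G z)) \<longlonglongrightarrow> sqrt C * 0"
      by (intro tendsto_intros lim)
    ultimately have "\<epsilon> - 0 \<le> sqrt C * 0" by (rule LIMSEQ_le) (use le in blast)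
    then show False using \<epsilon> by simp
  qed
qed

text \<open>
  The weighted Taylor coefficients of a bounded sequence are uniformly square summable, so along a
  subsequence they converge in each place, and the limits are the weighted coefficients of some \<open>F'\<close> in the
  space. In the norm of the difference of the images, the coefficients with large index are small because
  the multipliers are, and the remaining finitely many converge.
\<close>

lemma diagonal_operator_compact:
  assumes \<Lambda>_lim: "\<Lambda> \<longlonglongrightarrow> (0 :: complex)"
    and T: "\<And>F z. entire F \<Longrightarrow> (\<lambda>k. \<Lambda> k * taylor F k * z ^ k) sums T F z"
    and lin: "\<And>F G a b. F \<in> H \<Longrightarrow> G \<in> H \<Longrightarrow> T (\<lambda>z. a * F z + b * G z) = (\<lambda>z. a * T F z + b * T G z)"
  shows "compact_linear_operator E T"
proof -
  obtain C where C: "C > 0"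
    and C1: "\<And>F K. F \<in> H \<Longrightarrow> coeff_energy F K \<le> C * (nrm F)\<^sup>2"
    and C2: "\<And>G B. entire G \<Longrightarrow> (\<forall>K. coeff_energy G K \<le> B) \<Longrightarrow> G \<in> H"
    and C3: "\<And>G B. entire G \<Longrightarrow> (\<forall>K. coeff_energy G K \<le> B) \<Longrightarrow> (nrm G)\<^sup>2 \<le> C * B"
    using monomials_riesz_basis by blast
  obtain L where L: "L > 0" "\<And>k. cmod (\<Lambda> k) \<le> L"
    using convergent_imp_Bseq[OF convergentI[OF \<Lambda>_lim]] unfolding Bseq_def by blast
  have T_entire: "entire (T F)" and T_taylor: "taylor (T F) = (\<lambda>k. \<Lambda> k * taylor F k)" if "entire F" for F
    using power_series_entire[OF T[OF that]] by auto
  have T_H: "T F \<in> H" if F: "F \<in> H" for F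
  proof (rule C2[OF T_entire[OF entire_H[OF F]] allI])
    fix K
    have "coeff_energy (T F) K \<le> (\<Sum>k<K. L\<^sup>2 * (\<omega> k * cmod (taylor F k))\<^sup>2)"
    proof (intro sum_mono)
      fix k
      have "(cmod (\<Lambda> k))\<^sup>2 * (\<omega> k * cmod (taylor F k))\<^sup>2 \<le> L\<^sup>2 * (\<omega> k * cmod (taylor F k))\<^sup>2"
        using L by (intro mult_right_mono power_mono) auto
      then show "(\<omega> k * cmod (taylor (T F) k))\<^sup>2 \<le> L\<^sup>2 * (\<omega> k * cmod (taylor F k))\<^sup>2"
        by (simp add: T_taylor[OF entire_H[OF F]] norm_mult power_mult_distrib mult_ac)
    qed
    also have "\<dots> \<le> L\<^sup>2 * (C * (nrm F)\<^sup>2)"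
      unfolding sum_distrib_left[symmetric] by (intro mult_left_mono C1 F) auto
    finally show "coeff_energy (T F) K \<le> L\<^sup>2 * (C * (nrm F)\<^sup>2)" .
  qed
  have subsequence: "\<exists>r :: nat \<Rightarrow> nat. \<exists>G\<in>H. strict_mono r \<and> (\<lambda>j. nrm (\<lambda>z. T (F (r j)) z - G z)) \<longlonglongrightarrow> 0"
    if FH: "\<And>j. F j \<in> H" and bd: "\<And>j. nrm (F j) \<le> B" for F :: "nat \<Rightarrow> complex \<Rightarrow> complex" and B
  proof -
    have B2: "(nrm (F j))\<^sup>2 \<le> B\<^sup>2" for j using bd[of j] nrm_nonneg by (intro power_mono) auto
    define x where "x j k = of_real (\<omega> k) * taylor (F j) k" for j k
    have x_norm: "cmod (x j k) = \<omega> k * cmod (taylor (F j) k)" for j k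
      using \<omega>_pos[of k] by (simp add: x_def norm_mult)
    have x_sum: "(\<Sum>k<K. (cmod (x j k))\<^sup>2) \<le> C * B\<^sup>2" for j K
    proof -
      have "(\<Sum>k<K. (cmod (x j k))\<^sup>2) \<le> C * (nrm (F j))\<^sup>2" unfolding x_norm by (rule C1[OF FH])
      also have "\<dots> \<le> C * B\<^sup>2" using C B2 by (intro mult_left_mono) auto
      finally show ?thesis .
    qed
    have x_le: "cmod (x j k) \<le> sqrt (C * B\<^sup>2)" for j k
    proof (rule real_le_rsqrt)
      have "(cmod (x j k))\<^sup>2 \<le> (\<Sum>i<Suc k. (cmod (x j i))\<^sup>2)" by (rule member_le_sum) auto
      also have "\<dots> \<le> C * B\<^sup>2" by (rule x_sum)
      finally show "(cmod (x j k))\<^sup>2 \<le> C * B\<^sup>2" .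
    qed
    obtain r where r: "strict_mono (r :: nat \<Rightarrow> nat)" "\<And>k. k \<in> UNIV \<Longrightarrow> \<exists>l. (\<lambda>j. x (r j) k) \<longlonglongrightarrow> l"
      using function_convergent_subsequence[of "UNIV :: nat set" x "sqrt (C * B\<^sup>2)"] x_le by auto
    then obtain y where y: "\<And>k. (\<lambda>j. x (r j) k) \<longlonglongrightarrow> y k" by (metis UNIV_I)
    have y_le: "cmod (y k) \<le> sqrt (C * B\<^sup>2)" for k
      by (rule LIMSEQ_le_const2[OF tendsto_norm[OF y]]) (use x_le in blast)
    have y_sum: "(\<Sum>k<K. (cmod (y k))\<^sup>2) \<le> C * B\<^sup>2" for K
    proof (rule LIMSEQ_le_const2)
      show "(\<lambda>j. \<Sum>k<K. (cmod (x (r j) k))\<^sup>2) \<longlonglongrightarrow> (\<Sum>k<K. (cmod (y k))\<^sup>2)"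
        by (intro tendsto_intros y)
    qed (use x_sum in blast)
    have summ: "summable (\<lambda>k. y k / of_real (\<omega> k) * z ^ k)" for z
    proof (rule summable_comparison_test')
      have "cmod z + 1 > 0" by (simp add: add_nonneg_pos)
      then show "summable (\<lambda>k. sqrt (C * B\<^sup>2) * ((cmod z + 1) ^ k / \<omega> k))"
        by (intro summable_mult summable_over_\<omega>)
      fix k :: nat
      have "cmod (y k) * (cmod z ^ k / \<omega> k) \<le> sqrt (C * B\<^sup>2) * ((cmod z + 1) ^ k / \<omega> k)"
        using y_le[of k] \<omega>_pos[of k] C
        by (intro mult_mono divide_right_mono power_mono) auto
      then show "norm (y k / of_real (\<omega> k) * z ^ k) \<le> sqrt (C * B\<^sup>2) * ((cmod z + 1) ^ k / \<omega> k)"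
        using \<omega>_pos[of k] by (simp add: norm_mult norm_divide norm_power)
    qed
    define F' where "F' z = (\<Sum>k. y k / of_real (\<omega> k) * z ^ k)" for z
    have sums: "(\<lambda>k. y k / of_real (\<omega> k) * z ^ k) sums F' z" for z
      unfolding F'_def by (rule summable_sums[OF summ])
    have F'_entire: "entire F'" and F'_taylor: "taylor F' = (\<lambda>k. y k / of_real (\<omega> k))"
      using power_series_entire[OF sums] by auto
    have F'_norm: "\<omega> k * cmod (taylor F' k) = cmod (y k)" for k
      using \<omega>_pos[of k] by (simp add: F'_taylor norm_divide)
    have F'H: "F' \<in> H"
      by (rule C2[OF F'_entire, of "C * B\<^sup>2"]) (simp only: F'_norm y_sum simp_thms)
    have diff_norm: "\<omega> k * cmod (taylor (\<lambda>z. T (F j) z - T F' z) k) = cmod (\<Lambda> k) * cmod (x j k - y k)" for j k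
    proof -
      have "taylor (\<lambda>z. T (F j) z - T F' z) k = taylor (T (F j)) k - taylor (T F') k"
        using taylor_diff_scale[OF T_entire[OF entire_H[OF FH]] T_entire[OF F'_entire], of j 1 k] by simp
      also have "\<dots> = \<Lambda> k * (taylor (F j) k - y k / of_real (\<omega> k))"
        by (simp add: T_taylor[OF entire_H[OF FH]] T_taylor[OF F'_entire] F'_taylor right_diff_distrib)
      also have "\<dots> = \<Lambda> k * ((x j k - y k) / of_real (\<omega> k))"
        using \<omega>_pos[of k] by (simp add: x_def diff_divide_distrib)
      finally show ?thesis using \<omega>_pos[of k] by (simp add: norm_mult norm_divide)
    qed
    have d_sum: "(\<Sum>k<K. (cmod (x j k - y k))\<^sup>2) \<le> 4 * (C * B\<^sup>2)" for j K
    proof -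
      have "(cmod (u - v))\<^sup>2 \<le> 2 * (cmod u)\<^sup>2 + 2 * (cmod v)\<^sup>2" for u v :: complex
      proof -
        have "(cmod (u - v))\<^sup>2 \<le> (cmod u + cmod v)\<^sup>2" by (intro power_mono norm_triangle_ineq4) auto
        also have "\<dots> \<le> 2 * (cmod u)\<^sup>2 + 2 * (cmod v)\<^sup>2"
          using sum_squares_bound[of "cmod u" "cmod v"] by (simp add: power2_sum)
        finally show ?thesis .
      qed
      then have "(\<Sum>k<K. (cmod (x j k - y k))\<^sup>2) \<le> (\<Sum>k<K. 2 * (cmod (x j k))\<^sup>2 + 2 * (cmod (y k))\<^sup>2)"
        by (intro sum_mono)
      also have "\<dots> = 2 * (\<Sum>k<K. (cmod (x j k))\<^sup>2) + 2 * (\<Sum>k<K. (cmod (y k))\<^sup>2)"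
        by (simp add: sum.distrib sum_distrib_left)
      also have "\<dots> \<le> 4 * (C * B\<^sup>2)" using x_sum[of j K] y_sum[of K] by linarith
      finally show ?thesis .
    qed
    have "(\<lambda>j. nrm (\<lambda>z. T (F (r j)) z - T F' z)) \<longlonglongrightarrow> 0"
    proof (rule LIMSEQ_I)
      fix \<eta> :: real assume \<eta>: "\<eta> > 0"
      define B0 where "B0 = 4 * (C * B\<^sup>2)"
      have B0: "B0 \<ge> 0" using C by (simp add: B0_def)
      \<comment> \<open>the squared norm of the difference will be at most C times (\<epsilon> from the first K0 coefficients plus \<epsilon> B0 from the others)\<close>
      define \<epsilon> where "\<epsilon> = \<eta>\<^sup>2 / (2 * (C * (1 + B0)))"
      have \<epsilon>: "\<epsilon> > 0" using \<eta> C B0 by (simp add: \<epsilon>_def)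
      obtain K0 where K0: "\<And>k. k \<ge> K0 \<Longrightarrow> cmod (\<Lambda> k) < sqrt \<epsilon>"
        using LIMSEQ_D[OF \<Lambda>_lim, of "sqrt \<epsilon>"] \<epsilon> by auto
      have "(\<lambda>j. L\<^sup>2 * (\<Sum>k<K0. (cmod (x (r j) k - y k))\<^sup>2)) \<longlonglongrightarrow> L\<^sup>2 * (\<Sum>k<K0. (cmod (y k - y k))\<^sup>2)"
        by (intro tendsto_intros y)
      then have head: "(\<lambda>j. L\<^sup>2 * (\<Sum>k<K0. (cmod (x (r j) k - y k))\<^sup>2)) \<longlonglongrightarrow> 0" by simp
      obtain J where "\<forall>j\<ge>J. norm (L\<^sup>2 * (\<Sum>k<K0. (cmod (x (r j) k - y k))\<^sup>2) - 0) < \<epsilon>"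
        using LIMSEQ_D[OF head \<epsilon>] by (rule exE)
      then have J: "norm (L\<^sup>2 * (\<Sum>k<K0. (cmod (x (r j) k - y k))\<^sup>2)) < \<epsilon>" if "j \<ge> J" for j
        using that by simp
      have "norm (nrm (\<lambda>z. T (F (r j)) z - T F' z) - 0) < \<eta>" if j: "j \<ge> J" for j
      proof -
        let ?D = "\<lambda>z. T (F (r j)) z - T F' z" and ?d = "\<lambda>k. (cmod (x (r j) k - y k))\<^sup>2"
        have D: "?D \<in> H" by (intro H_diff T_H FH F'H)
        have "coeff_energy ?D K \<le> \<epsilon> * (1 + B0)" for K
        proof -
          have "coeff_energy ?D K \<le> (\<Sum>k<K. (if k < K0 then L\<^sup>2 * ?d k else 0) + \<epsilon> * ?d k)"
          proof (intro sum_mono)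
            fix k
            have eq: "(\<omega> k * cmod (taylor ?D k))\<^sup>2 = (cmod (\<Lambda> k))\<^sup>2 * ?d k"
              unfolding diff_norm by (simp add: power_mult_distrib)
            show "(\<omega> k * cmod (taylor ?D k))\<^sup>2 \<le> (if k < K0 then L\<^sup>2 * ?d k else 0) + \<epsilon> * ?d k"
            proof (cases "k < K0")
              case True
              have "(cmod (\<Lambda> k))\<^sup>2 * ?d k \<le> L\<^sup>2 * ?d k" using L by (intro mult_right_mono power_mono) auto
              then show ?thesis using True \<epsilon> unfolding eq by (simp add: add_increasing2)
            next
              case False
              then have "(cmod (\<Lambda> k))\<^sup>2 \<le> (sqrt \<epsilon>)\<^sup>2" using K0[of k] by (intro power_mono) auto
              then have "(cmod (\<Lambda> k))\<^sup>2 * ?d k \<le> \<epsilon> * ?d k" using \<epsilon> by (intro mult_right_mono) auto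
              then show ?thesis using False unfolding eq by simp
            qed
          qed
          also have "\<dots> = (\<Sum>k<K. if k < K0 then L\<^sup>2 * ?d k else 0) + \<epsilon> * (\<Sum>k<K. ?d k)"
            by (simp add: sum.distrib sum_distrib_left)
          also have "(\<Sum>k<K. if k < K0 then L\<^sup>2 * ?d k else 0) = (\<Sum>k\<in>{..<K} \<inter> {k. k < K0}. L\<^sup>2 * ?d k)"
            by (simp add: sum.inter_restrict)
          also have "\<dots> \<le> (\<Sum>k<K0. L\<^sup>2 * ?d k)" by (rule sum_mono2) auto
          also have "\<dots> \<le> \<epsilon>" using J[OF j] by (simp add: sum_distrib_left)
          also have "\<epsilon> * (\<Sum>k<K. ?d k) \<le> \<epsilon> * B0" using d_sum[of "r j" K] \<epsilon> by (intro mult_left_mono) (auto simp: B0_def)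
          finally show ?thesis by (simp add: algebra_simps)
        qed
        from C3[OF entire_H[OF D] allI[OF this]] have "(nrm ?D)\<^sup>2 \<le> C * (\<epsilon> * (1 + B0))" .
        also have "\<dots> = \<epsilon> * (C * (1 + B0))" by (simp only: mult_ac)
        also have "\<dots> = \<eta>\<^sup>2 / 2"
        proof -
          have "C * (1 + B0) \<noteq> 0" using C B0 by simp
          moreover have "X \<noteq> 0 \<Longrightarrow> \<eta>\<^sup>2 / (2 * X) * X = \<eta>\<^sup>2 / 2" for X by simp
          ultimately show ?thesis unfolding \<epsilon>_def by blast
        qed
        also have "\<dots> < \<eta>\<^sup>2" using \<eta> by simp
        finally have "nrm ?D < \<eta>" using \<eta> by (simp add: power_less_imp_less_base)
        then show ?thesis using nrm_nonneg[of ?D] by simp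
      qed
      then show "\<exists>J. \<forall>j\<ge>J. norm (nrm (\<lambda>z. T (F (r j)) z - T F' z) - 0) < \<eta>" by blast
    qed
    then show ?thesis using r(1) T_H[OF F'H] by blast
  qed
  show ?thesis
    unfolding compact_linear_operator_def using T_H lin subsequence by blast
qed

lemma moments_tendsto_0_imp_compact:
  assumes sets: "sets \<mu> = sets (restrict_space borel {0<..})"
    and \<delta>: "\<delta> > 0" "AE u in \<mu>. u < \<delta> \<longrightarrow> \<Phi> u = 0"
    and int: "\<And>n. integrable (completion \<mu>) (\<lambda>u. \<Phi> u * of_real u powi (- int n))"
    and lim: "(\<lambda>n. moment \<mu> \<Phi> n) \<longlonglongrightarrow> 0"
  shows "hausdorff_compact E \<mu> \<Phi>"
proof -
  note series = hausdorff_power_series[OF sets \<delta> int]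
  have "hausdorff_op \<mu> \<Phi> (\<lambda>z. a * F z + b * G z) = (\<lambda>z. a * hausdorff_op \<mu> \<Phi> F z + b * hausdorff_op \<mu> \<Phi> G z)"
    if F: "F \<in> H" and G: "G \<in> H" for F G a b
  proof
    fix z
    have i: "integrable (completion \<mu>) (\<lambda>u. \<Phi> u * F (z / of_real u))" "integrable (completion \<mu>) (\<lambda>u. \<Phi> u * G (z / of_real u))"
      by (intro series(1) entire_H F G)+
    have "hausdorff_op \<mu> \<Phi> (\<lambda>z. a * F z + b * G z) z
       = (LINT u|completion \<mu>. a * (\<Phi> u * F (z / of_real u)) + b * (\<Phi> u * G (z / of_real u)))"
      unfolding hausdorff_op_def by (intro Bochner_Integration.integral_cong) (auto simp: algebra_simps)
    also have "\<dots> = a * hausdorff_op \<mu> \<Phi> F z + b * hausdorff_op \<mu> \<Phi> G z"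
      unfolding hausdorff_op_def using i by simp
    finally show "hausdorff_op \<mu> \<Phi> (\<lambda>z. a * F z + b * G z) z = a * hausdorff_op \<mu> \<Phi> F z + b * hausdorff_op \<mu> \<Phi> G z" .
  qed
  then have "compact_linear_operator E (hausdorff_op \<mu> \<Phi>)"
    by (intro diagonal_operator_compact[OF lim series(2)])
  then show ?thesis
    using series(1) entire_H by (auto simp: hausdorff_compact_def hausdorff_defined_def)
qed

end

theorem theorem8:
  fixes E :: "complex \<Rightarrow> complex" and I :: "int set" and t \<nu> :: "int \<Rightarrow> real"
    and \<mu> :: "real measure" and \<Phi> :: "real \<Rightarrow> complex"
  assumes "hermite_biehler E"
    and "\<And>p :: complex poly. poly p \<in> de_Branges_space E"
    and "spectral_data E I t \<nu>"
    and "regular_spectral_data I t \<nu>"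
    and "lacunary I t"
    and "regular_borel_measure \<mu>"
    and "\<Phi> \<in> borel_measurable (completion \<mu>)"
    and "\<exists>\<delta>>0. AE u in \<mu>. u < \<delta> \<longrightarrow> \<Phi> u = 0"
  shows "hausdorff_compact E \<mu> \<Phi> \<longleftrightarrow>
     (\<forall>n::nat. integrable (completion \<mu>) (\<lambda>u. \<Phi> u * of_real u powi (- int n))) \<and>
     (\<lambda>n::nat. LINT u|completion \<mu>. \<Phi> u * of_real u powi (- int n)) \<longlonglongrightarrow> 0"
proof -
  interpret de_Branges_with_polynomials E
    using assms(1,2) by unfold_locales
  obtain e s p \<nu>' c \<kappa> A where "spectral_basis E e s p \<nu>' c \<kappa> A"
    by (rule regular_lacunary_data_give_spectral_basis[OF assms(3,4,5)])
  then interpret spectral_basis E e s p \<nu>' c \<kappa> A .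
  obtain \<delta> where \<delta>: "\<delta> > 0" "AE u in \<mu>. u < \<delta> \<longrightarrow> \<Phi> u = 0" using assms(8) by blast
  have sets: "sets \<mu> = sets (restrict_space borel {0<..})"
    using assms(6) by (simp add: regular_borel_measure_def)
  show ?thesis
    using compact_imp_moments_tendsto_0[of \<mu> \<Phi>] moments_tendsto_0_imp_compact[OF sets \<delta>] by blast
qed

end
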